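(* For every cdg-Hopf algebra $B$ over $\Bbbk$ there is a functor $T\mathfrak G^{B}:\mathrm{ho}\,\mathrm{cdgA}(\Bbbk)\to\mathrm{Lie}(\Bbbk)$ to the category of Lie algebras over $\Bbbk$, sending (a) each cdg-algebra $A$ to the Lie algebra with underlying vector space $\mathrm{THom}_{\mathrm{ho}\,\mathrm{cdgA}(\Bbbk)}(B,A)$ and bracket $$\big[[\upsilon_1],[\upsilon_2]\big]_{\ast_{B,A}}:=\big[m_A\circ(\upsilon_1\otimes\upsilon_2-\upsilon_2\otimes\upsilon_1)\circ\Delta_B\big],$$ where $\upsilon_1,\upsilon_2\in\mathrm{THom}_{\mathrm{cdgA}(\Bbbk)}(B,A)$ are arbitrary representatives of the homotopy types $[\upsilon_1],[\upsilon_2]$; (b) each morphism $[f]\in\mathrm{Hom}_{\mathrm{ho}\,\mathrm{cdgA}(\Bbbk)}(A,A')$ to the Lie algebra morphism $T\mathfrak G^B([f]):T\mathfrak G^B(A)\to T\mathfrak G^B(A')$, $T\mathfrak G^B([f])([\upsilon]):=[f\circ\upsilon]$, where $f$ and $\upsilon$ are arbitrary representatives. For every $[\psi]\in\mathrm{Hom}_{\mathrm{ho}\,\mathrm{cdgH}(\Bbbk)}(B,B')$ there is a natural transformation $T\mathscr N_{[\psi]}:T\mathfrak G^{B'}\Rightarrow T\mathfrak G^{B}$ of functors $\mathrm{ho}\,\mathrm{cdgA}(\Bbbk)\to\mathrm{Lie}(\Bbbk)$ whose component at each cdg-algebra $A$ is $T\mathscr N^A_{[\psi]}([\upsilon']):=[\upsilon'\circ\psi]$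 for all $[\upsilon']\in\mathrm{THom}_{\mathrm{ho}\,\mathrm{cdgA}(\Bbbk)}(B',A)$, where $\psi\in\mathrm{Hom}_{\mathrm{cdgH}(\Bbbk)}(B,B')$ and $\upsilon'\in\mathrm{THom}_{\mathrm{cdgA}(\Bbbk)}(B',A)$ are arbitrary representatives. The natural transformation $T\mathscr N_{[\psi]}$ is an isomorphism whenever $\psi:B\to B'$ is a homotopy equivalence of cdg-Hopf algebras.
   Context: $\Bbbk$ is a field of characteristic $0$; $\otimes=\otimes_{\Bbbk}$. Everything is $\mathbb Z$-graded, differentials have degree $+1$, Koszul sign convention. $\mathrm{Hom}(V,W)$ is the graded space of $\Bbbk$-linear maps, with $d_{V,W}f=d_W\circ f-(-1)^{|f|}f\circ d_V$. A cdg-algebra $A=(A,u_A,m_A,d_A)$ is a unital associative graded-commutative dg algebra. A cdg-Hopf algebra $B=(B,u_B,m_B,\epsilon_B,\Delta_B,\varsigma_B,d_B)$ is a cdg-algebra and counital coassociative dg coalgebra, with counit $\epsilon_B$ and coproduct $\Delta_B$ algebra maps, and antipode $\varsigma_B$ a cochain map satisfying the usual antipode axiom. Categories: $\mathrm{cdgA}(\Bbbk)$, $\mathrm{cdgH}(\Bbbk)$ (morphisms: degree $0$ maps compatible with all algebra, resp. algebra and coalgebra, structure and with differentials). A homotopy pair on $\mathrm{Hom}_{\mathrm{cdgA}(\Bbbk)}(A,A')$ is a pair $(f(t),\xi(t))\in\mathrm{Hom}(A,A')^0[t]\oplus\mathrm{Hom}(A,A')^{-1}[t]$ with $\frac{d}{dt}f(t)=d_{A,A'}\xi(t)$,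 $f(0)$ a morphism of cdg-algebras, $\xi(t)\circ u_A=0$, $\xi(t)\circ m_A=m_{A'}\circ(f(t)\otimes\xi(t)+\xi(t)\otimes f(t))$. On $\mathrm{Hom}_{\mathrm{cdgH}(\Bbbk)}(B,B')$ one requires in addition that $f(0)$ is a coalgebra map, $\epsilon_{B'}\circ\xi(t)=0$, $\Delta_{B'}\circ\xi(t)=(f(t)\otimes\xi(t)+\xi(t)\otimes f(t))\circ\Delta_B$. Morphisms $f,\tilde f$ are homotopic if there is a homotopy pair with $f(0)=f$, $f(1)=\tilde f$; this is regarded as an equivalence relation and $[f]$ is the class (homotopy type). $\mathrm{ho}\,\mathrm{cdgA}(\Bbbk)$, $\mathrm{ho}\,\mathrm{cdgH}(\Bbbk)$ have homotopy types as morphisms. A homotopy equivalence is a morphism invertible up to homotopy. Put $e_{B,A}:=u_A\circ\epsilon_B$. $\mathrm{THom}_{\mathrm{cdgA}(\Bbbk)}(B,A)$ is the set of $\upsilon\in\mathrm{Hom}(B,A)^0$ with $d_{B,A}\upsilon=0$, $\upsilon\circ u_B=0$ and $\upsilon\circ m_B=m_A\circ(e_{B,A}\otimes\upsilon+\upsilon\otimes e_{B,A})$. A homotopy pair on it is $(\upsilon(t),\sigma(t))\in\mathrm{Hom}(B,A)^0[t]\oplus\mathrm{Hom}(B,A)^{-1}[t]$ with $\frac{d}{dt}\upsilon(t)=d_{B,A}\sigma(t)$, $\upsilon(0)\in\mathrm{THom}_{\mathrm{cdgA}(\Bbbk)}(B,A)$, $\sigma(t)\circ u_B=0$ and $\sigma(t)\circ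 m_B=m_A\circ(e_{B,A}\otimes\sigma(t)+\sigma(t)\otimes e_{B,A})$. Elements $\upsilon,\tilde\upsilon$ are homotopic if connected by a homotopy pair, $\upsilon(0)=\upsilon$, $\upsilon(1)=\tilde\upsilon$. $\mathrm{THom}_{\mathrm{ho}\,\mathrm{cdgA}(\Bbbk)}(B,A)$ is the set of homotopy types $[\upsilon]$. *)

theory Defs
  imports "HOL-Algebra.Module" "HOL-Library.Poly_Mapping"
begin

section \<open>Categories, functors, natural transformations\<close>

text \<open>Hom sets need not be disjoint, so identities and composition carry their objects:
  \<open>Comp C X Y Z g f\<close> is the composite of \<open>f : X \<rightarrow> Y\<close> and \<open>g : Y \<rightarrow> Z\<close>.\<close>

record ('o, 'm) cat =
  Obj :: "'o set"
  Mor :: "'o \<Rightarrow> 'o \<Rightarrow> 'm set"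
  Ident :: "'o \<Rightarrow> 'm"
  Comp :: "'o \<Rightarrow> 'o \<Rightarrow> 'o \<Rightarrow> 'm \<Rightarrow> 'm \<Rightarrow> 'm"

definition category :: "('o, 'm) cat \<Rightarrow> bool" where
  "category C \<longleftrightarrow>
    (\<forall>X\<in>Obj C. Ident C X \<in> Mor C X X) \<and>
    (\<forall>X\<in>Obj C. \<forall>Y\<in>Obj C. \<forall>Z\<in>Obj C. \<forall>f\<in>Mor C X Y. \<forall>g\<in>Mor C Y Z.
       Comp C X Y Z g f \<in> Mor C X Z) \<and>
    (\<forall>X\<in>Obj C. \<forall>Y\<in>Obj C. \<forall>f\<in>Mor C X Y.
       Comp C X X Y f (Ident C X) = f \<and> Comp C X Y Y (Ident C Y) f = f) \<and>
    (\<forall>W\<in>Obj C. \<forall>X\<in>Obj C. \<forall>Y\<in>Obj C. \<forall>Z\<in>Obj C.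
       \<forall>f\<in>Mor C W X. \<forall>g\<in>Mor C X Y. \<forall>h\<in>Mor C Y Z.
       Comp C W X Z (Comp C X Y Z h g) f = Comp C W Y Z h (Comp C W X Y g f))"

record ('o, 'm, 'p, 'n) fctr =
  omap :: "'o \<Rightarrow> 'p"
  mmap :: "'o \<Rightarrow> 'o \<Rightarrow> 'm \<Rightarrow> 'n"

definition is_functor :: "('o, 'm) cat \<Rightarrow> ('p, 'n) cat \<Rightarrow> ('o, 'm, 'p, 'n) fctr \<Rightarrow> bool" where
  "is_functor C D F \<longleftrightarrow> category C \<and> category D \<and>
    (\<forall>X\<in>Obj C. omap F X \<in> Obj D) \<and>
    (\<forall>X\<in>Obj C. \<forall>Y\<in>Obj C. \<forall>f\<in>Mor C X Y. mmap F X Y f \<in> Mor D (omap F X) (omap F Y)) \<and>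
    (\<forall>X\<in>Obj C. mmap F X X (Ident C X) = Ident D (omap F X)) \<and>
    (\<forall>X\<in>Obj C. \<forall>Y\<in>Obj C. \<forall>Z\<in>Obj C. \<forall>f\<in>Mor C X Y. \<forall>g\<in>Mor C Y Z.
       mmap F X Z (Comp C X Y Z g f)
       = Comp D (omap F X) (omap F Y) (omap F Z) (mmap F Y Z g) (mmap F X Y f))"

definition nat_transformation ::
  "('o, 'm) cat \<Rightarrow> ('p, 'n) cat \<Rightarrow> ('o, 'm, 'p, 'n) fctr \<Rightarrow> ('o, 'm, 'p, 'n) fctr
    \<Rightarrow> ('o \<Rightarrow> 'n) \<Rightarrow> bool" where
  "nat_transformation C D F G N \<longleftrightarrow> is_functor C D F \<and> is_functor C D G \<and>
    (\<forall>X\<in>Obj C. N X \<in> Mor D (omap F X) (omap G X)) \<and>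
    (\<forall>X\<in>Obj C. \<forall>Y\<in>Obj C. \<forall>f\<in>Mor C X Y.
       Comp D (omap F X) (omap F Y) (omap G Y) (N Y) (mmap F X Y f)
       = Comp D (omap F X) (omap G X) (omap G Y) (mmap G X Y f) (N X))"

definition is_iso :: "('o, 'm) cat \<Rightarrow> 'o \<Rightarrow> 'o \<Rightarrow> 'm \<Rightarrow> bool" where
  "is_iso C X Y f \<longleftrightarrow> f \<in> Mor C X Y \<and>
    (\<exists>g\<in>Mor C Y X. Comp C X Y X g f = Ident C X \<and> Comp C Y X Y f g = Ident C Y)"

definition nat_isomorphism ::
  "('o, 'm) cat \<Rightarrow> ('p, 'n) cat \<Rightarrow> ('o, 'm, 'p, 'n) fctr \<Rightarrow> ('o, 'm, 'p, 'n) fctr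
    \<Rightarrow> ('o \<Rightarrow> 'n) \<Rightarrow> bool" where
  "nat_isomorphism C D F G N \<longleftrightarrow> nat_transformation C D F G N \<and>
    (\<forall>X\<in>Obj C. is_iso D (omap F X) (omap G X) (N X))"

section \<open>Graded vector spaces with a differential\<close>

text \<open>A single record serves for dg vector spaces and for dg algebras; for the former the ring
  fields \<open>mult\<close> and \<open>one\<close> inherited from \<open>module\<close> are ignored. \<open>gr V n\<close> is the degree \<open>n\<close> part.\<close>

record ('k, 'a) dgmod = "('k, 'a) module" +
  gr :: "int \<Rightarrow> 'a set"
  dd :: "'a \<Rightarrow> 'a"

definition ground :: "('k::field, 'k) dgmod" where
  "ground = \<lparr>carrier = UNIV, mult = (*), one = 1, zero = 0, add = (+), smult = (*),
     gr = (\<lambda>n. if n = 0 then UNIV else {0}), dd = (\<lambda>_. 0)\<rparr>"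

definition msubspace :: "('k::field, 'a, 'm) dgmod_scheme \<Rightarrow> 'a set \<Rightarrow> bool" where
  "msubspace V S \<longleftrightarrow> S \<subseteq> carrier V \<and> \<zero>\<^bsub>V\<^esub> \<in> S \<and>
    (\<forall>x\<in>S. \<forall>y\<in>S. x \<oplus>\<^bsub>V\<^esub> y \<in> S) \<and> (\<forall>c. \<forall>x\<in>S. c \<odot>\<^bsub>V\<^esub> x \<in> S)"

definition hsupp :: "('k, 'a, 'm) dgmod_scheme \<Rightarrow> (int \<Rightarrow> 'a) \<Rightarrow> int set" where
  "hsupp V c = {i. c i \<noteq> \<zero>\<^bsub>V\<^esub>}"

definition is_decomp :: "('k, 'a, 'm) dgmod_scheme \<Rightarrow> 'a \<Rightarrow> (int \<Rightarrow> 'a) \<Rightarrow> bool" where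
  "is_decomp V v c \<longleftrightarrow> (\<forall>i. c i \<in> gr V i) \<and> finite (hsupp V c) \<and> v = finsum V c (hsupp V c)"

text \<open>The carrier is the internal direct sum of the homogeneous parts.\<close>

definition graded_space :: "('k::field, 'a, 'm) dgmod_scheme \<Rightarrow> bool" where
  "graded_space V \<longleftrightarrow> Module.module (ground :: ('k, 'k) dgmod) V \<and>
    (\<forall>i. msubspace V (gr V i)) \<and> (\<forall>v\<in>carrier V. \<exists>!c. is_decomp V v c)"

definition hcomp :: "('k, 'a, 'm) dgmod_scheme \<Rightarrow> int \<Rightarrow> 'a \<Rightarrow> 'a" where
  "hcomp V i v = (THE c. is_decomp V v c) i"

definition sgn_pow :: "int \<Rightarrow> 'k::field" where
  "sgn_pow n = (if even n then 1 else - 1)"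

text \<open>The linear map \<open>v \<mapsto> (-1)\<^bsup>n i\<^esup> v\<close> for \<open>v\<close> of degree \<open>i\<close>.\<close>

definition ksgn :: "('k::field, 'a, 'm) dgmod_scheme \<Rightarrow> int \<Rightarrow> 'a \<Rightarrow> 'a" where
  "ksgn V n v =
    finsum V (\<lambda>i. sgn_pow (n * i) \<odot>\<^bsub>V\<^esub> hcomp V i v) (hsupp V (\<lambda>i. hcomp V i v))"

section \<open>Graded maps\<close>

text \<open>Linear maps are functions that are \<open>undefined\<close> outside the carrier, so that equality of
  functions is equality of maps; composites are therefore written with \<open>compose\<close>.\<close>

definition linear_maps ::
  "('k::field, 'a, 'm) module_scheme \<Rightarrow> ('k, 'b, 'n) module_scheme \<Rightarrow> ('a \<Rightarrow> 'b) set" where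
  "linear_maps V W = {f \<in> carrier V \<rightarrow>\<^sub>E carrier W.
     (\<forall>x\<in>carrier V. \<forall>y\<in>carrier V. f (x \<oplus>\<^bsub>V\<^esub> y) = f x \<oplus>\<^bsub>W\<^esub> f y) \<and>
     (\<forall>c. \<forall>x\<in>carrier V. f (c \<odot>\<^bsub>V\<^esub> x) = c \<odot>\<^bsub>W\<^esub> f x)}"

definition Hom ::
  "('k::field, 'a, 'm) dgmod_scheme \<Rightarrow> ('k, 'b, 'n) dgmod_scheme \<Rightarrow> int \<Rightarrow> ('a \<Rightarrow> 'b) set" where
  "Hom V W n = {f \<in> linear_maps V W. \<forall>i. \<forall>x\<in>gr V i. f x \<in> gr W (i + n)}"

definition id_map :: "('a, 'm) partial_object_scheme \<Rightarrow> 'a \<Rightarrow> 'a" where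
  "id_map V = (\<lambda>x\<in>carrier V. x)"

definition zmap :: "('a, 'm) partial_object_scheme \<Rightarrow> ('b, 'n) ring_scheme \<Rightarrow> 'a \<Rightarrow> 'b" where
  "zmap V W = (\<lambda>x\<in>carrier V. \<zero>\<^bsub>W\<^esub>)"

definition madd :: "('a, 'm) partial_object_scheme \<Rightarrow> ('b, 'n) ring_scheme
    \<Rightarrow> ('a \<Rightarrow> 'b) \<Rightarrow> ('a \<Rightarrow> 'b) \<Rightarrow> 'a \<Rightarrow> 'b" where
  "madd V W f g = (\<lambda>x\<in>carrier V. f x \<oplus>\<^bsub>W\<^esub> g x)"

definition msub :: "('a, 'm) partial_object_scheme \<Rightarrow> ('b, 'n) ring_scheme
    \<Rightarrow> ('a \<Rightarrow> 'b) \<Rightarrow> ('a \<Rightarrow> 'b) \<Rightarrow> 'a \<Rightarrow> 'b" where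
  "msub V W f g = (\<lambda>x\<in>carrier V. f x \<ominus>\<^bsub>W\<^esub> g x)"

definition mscale :: "('a, 'm) partial_object_scheme \<Rightarrow> ('k, 'b, 'n) module_scheme
    \<Rightarrow> 'k \<Rightarrow> ('a \<Rightarrow> 'b) \<Rightarrow> 'a \<Rightarrow> 'b" where
  "mscale V W c f = (\<lambda>x\<in>carrier V. c \<odot>\<^bsub>W\<^esub> f x)"

text \<open>\<open>hom_diff V W n\<close> is the differential of the complex of graded maps on maps of degree \<open>n\<close>.\<close>

definition hom_diff :: "('k::field, 'a, 'm) dgmod_scheme \<Rightarrow> ('k, 'b, 'n) dgmod_scheme
    \<Rightarrow> int \<Rightarrow> ('a \<Rightarrow> 'b) \<Rightarrow> 'a \<Rightarrow> 'b" where
  "hom_diff V W n f = msub V W (compose (carrier V) (dd W) f)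
     (mscale V W (sgn_pow n) (compose (carrier V) f (dd V)))"

definition dg_space :: "('k::field, 'a, 'm) dgmod_scheme \<Rightarrow> bool" where
  "dg_space V \<longleftrightarrow> graded_space V \<and> dd V \<in> Hom V V 1 \<and>
    compose (carrier V) (dd V) (dd V) = zmap V V"

section \<open>Tensor products\<close>

text \<open>The tensor product is the free vector space on \<open>carrier V \<times> carrier W\<close> (finitely
  supported functions) modulo the bilinearity relations; its elements are cosets.\<close>

definition tfree :: "('k::field, 'a, 'm) dgmod_scheme \<Rightarrow> ('k, 'b, 'n) dgmod_scheme
    \<Rightarrow> ('a \<times> 'b \<Rightarrow>\<^sub>0 'k) set" where
  "tfree V W = {p. Poly_Mapping.keys p \<subseteq> carrier V \<times> carrier W}"

inductive_set trel :: "('k::field, 'a, 'm) dgmod_scheme \<Rightarrow> ('k, 'b, 'n) dgmod_scheme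
    \<Rightarrow> ('a \<times> 'b \<Rightarrow>\<^sub>0 'k) set"
  for V :: "('k::field, 'a, 'm) dgmod_scheme" and W :: "('k, 'b, 'n) dgmod_scheme" where
  zero: "0 \<in> trel V W"
| add: "p \<in> trel V W \<Longrightarrow> q \<in> trel V W \<Longrightarrow> p + q \<in> trel V W"
| scale: "p \<in> trel V W \<Longrightarrow> Poly_Mapping.map ((*) c) p \<in> trel V W"
| add_left: "x \<in> carrier V \<Longrightarrow> x' \<in> carrier V \<Longrightarrow> y \<in> carrier W \<Longrightarrow>
    Poly_Mapping.single (x \<oplus>\<^bsub>V\<^esub> x', y) 1
      - Poly_Mapping.single (x, y) 1 - Poly_Mapping.single (x', y) 1 \<in> trel V W"
| add_right: "x \<in> carrier V \<Longrightarrow> y \<in> carrier W \<Longrightarrow> y' \<in> carrier W \<Longrightarrow>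
    Poly_Mapping.single (x, y \<oplus>\<^bsub>W\<^esub> y') 1
      - Poly_Mapping.single (x, y) 1 - Poly_Mapping.single (x, y') 1 \<in> trel V W"
| scale_left: "x \<in> carrier V \<Longrightarrow> y \<in> carrier W \<Longrightarrow>
    Poly_Mapping.single (c \<odot>\<^bsub>V\<^esub> x, y) 1 - Poly_Mapping.single (x, y) c \<in> trel V W"
| scale_right: "x \<in> carrier V \<Longrightarrow> y \<in> carrier W \<Longrightarrow>
    Poly_Mapping.single (x, c \<odot>\<^bsub>W\<^esub> y) 1 - Poly_Mapping.single (x, y) c \<in> trel V W"

definition tcls :: "('k::field, 'a, 'm) dgmod_scheme \<Rightarrow> ('k, 'b, 'n) dgmod_scheme
    \<Rightarrow> ('a \<times> 'b \<Rightarrow>\<^sub>0 'k) \<Rightarrow> ('a \<times> 'b \<Rightarrow>\<^sub>0 'k) set" where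
  "tcls V W p = {q. q - p \<in> trel V W}"

definition tens :: "('k::field, 'a, 'm) dgmod_scheme \<Rightarrow> ('k, 'b, 'n) dgmod_scheme
    \<Rightarrow> 'a \<Rightarrow> 'b \<Rightarrow> ('a \<times> 'b \<Rightarrow>\<^sub>0 'k) set" where
  "tens V W x y = tcls V W (Poly_Mapping.single (x, y) 1)"

text \<open>The underlying graded vector space; multiplication and differential are added below, once
  bilinear maps can be extended to the tensor product. The unions are over equal cosets.\<close>

definition tspace :: "('k::field, 'a, 'm) dgmod_scheme \<Rightarrow> ('k, 'b, 'n) dgmod_scheme
    \<Rightarrow> ('k, ('a \<times> 'b \<Rightarrow>\<^sub>0 'k) set) dgmod" where
  "tspace V W = \<lparr>carrier = tcls V W ` tfree V W, mult = (\<lambda>_ _. undefined), one = undefined,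
     zero = tcls V W 0,
     add = (\<lambda>s t. \<Union>p\<in>s. \<Union>q\<in>t. tcls V W (p + q)),
     smult = (\<lambda>c t. \<Union>p\<in>t. tcls V W (Poly_Mapping.map ((*) c) p)),
     gr = (\<lambda>n. tcls V W ` {p. Poly_Mapping.keys p \<subseteq> (\<Union>i. gr V i \<times> gr W (n - i))}),
     dd = undefined\<rparr>"

text \<open>The linear map \<open>V \<otimes> W \<rightarrow> X\<close> induced by a bilinear map \<open>\<phi>\<close>.\<close>

definition tlift :: "('k::field, 'a, 'm) dgmod_scheme \<Rightarrow> ('k, 'b, 'n) dgmod_scheme
    \<Rightarrow> ('k, 'c, 'p) dgmod_scheme \<Rightarrow> ('a \<Rightarrow> 'b \<Rightarrow> 'c) \<Rightarrow> ('a \<times> 'b \<Rightarrow>\<^sub>0 'k) set \<Rightarrow> 'c" where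
  "tlift V W X \<phi> = (\<lambda>t\<in>carrier (tspace V W).
     let r = (SOME r. r \<in> t)
     in finsum X (\<lambda>(x, y). Poly_Mapping.lookup r (x, y) \<odot>\<^bsub>X\<^esub> \<phi> x y) (Poly_Mapping.keys r))"

text \<open>\<open>tmap V W V' W' n f g\<close> is \<open>f \<otimes> g\<close> for \<open>g\<close> of degree \<open>n\<close>, with the Koszul sign:
  \<open>(f \<otimes> g) (v \<otimes> w) = (-1)\<^bsup>n |v|\<^esup> f v \<otimes> g w\<close>.\<close>

definition tmap :: "('k::field, 'a, 'm) dgmod_scheme \<Rightarrow> ('k, 'b, 'n) dgmod_scheme
    \<Rightarrow> ('k, 'c, 'p) dgmod_scheme \<Rightarrow> ('k, 'd, 'q) dgmod_scheme
    \<Rightarrow> int \<Rightarrow> ('a \<Rightarrow> 'c) \<Rightarrow> ('b \<Rightarrow> 'd) \<Rightarrow> ('a \<times> 'b \<Rightarrow>\<^sub>0 'k) set \<Rightarrow> ('c \<times> 'd \<Rightarrow>\<^sub>0 'k) set" where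
  "tmap V W V' W' n f g =
    tlift V W (tspace V' W') (\<lambda>v w. tens V' W' (f (ksgn V n v)) (g w))"

text \<open>The tensor product of dg algebras, with differential \<open>d \<otimes> id + id \<otimes> d\<close> and product
  \<open>(x \<otimes> y) (x' \<otimes> y') = (-1)\<^bsup>|y| |x'|\<^esup> x x' \<otimes> y y'\<close>; for inhomogeneous \<open>y\<close> one sums over its
  homogeneous components. On mere dg vector spaces the fields \<open>mult\<close> and \<open>one\<close> are meaningless.\<close>

definition tensor :: "('k::field, 'a, 'm) dgmod_scheme \<Rightarrow> ('k, 'b, 'n) dgmod_scheme
    \<Rightarrow> ('k, ('a \<times> 'b \<Rightarrow>\<^sub>0 'k) set) dgmod" where
  "tensor V W = (tspace V W)
    \<lparr>dd := madd (tspace V W) (tspace V W)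
       (tmap V W V W 0 (dd V) (id_map W)) (tmap V W V W 1 (id_map V) (dd W)),
     one := tens V W \<one>\<^bsub>V\<^esub> \<one>\<^bsub>W\<^esub>,
     mult := (\<lambda>s t. tlift V W (tspace V W)
       (\<lambda>x y. tlift V W (tspace V W)
         (\<lambda>x' y'. finsum (tspace V W)
           (\<lambda>j. tens V W (x \<otimes>\<^bsub>V\<^esub> ksgn V j x') (hcomp W j y \<otimes>\<^bsub>W\<^esub> y'))
           (hsupp W (\<lambda>j. hcomp W j y))) t) s)\<rparr>"

definition tassoc :: "('k::field, 'a, 'm) dgmod_scheme \<Rightarrow> ('k, 'b, 'n) dgmod_scheme
    \<Rightarrow> ('k, 'c, 'p) dgmod_scheme
    \<Rightarrow> (('a \<times> 'b \<Rightarrow>\<^sub>0 'k) set \<times> 'c \<Rightarrow>\<^sub>0 'k) set \<Rightarrow> ('a \<times> ('b \<times> 'c \<Rightarrow>\<^sub>0 'k) set \<Rightarrow>\<^sub>0 'k) set" where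
  "tassoc U V W = tlift (tensor U V) W (tensor U (tensor V W))
     (\<lambda>t w. tlift U V (tensor U (tensor V W))
       (\<lambda>u v. tens U (tensor V W) u (tens V W v w)) t)"

section \<open>Cdg-algebras and cdg-Hopf algebras\<close>

definition cdg_algebra :: "('k::field, 'a, 'm) dgmod_scheme \<Rightarrow> bool" where
  "cdg_algebra A \<longleftrightarrow> dg_space A \<and> ring A \<and>
    (\<forall>c. \<forall>x\<in>carrier A. \<forall>y\<in>carrier A.
       (c \<odot>\<^bsub>A\<^esub> x) \<otimes>\<^bsub>A\<^esub> y = c \<odot>\<^bsub>A\<^esub> (x \<otimes>\<^bsub>A\<^esub> y) \<and> x \<otimes>\<^bsub>A\<^esub> (c \<odot>\<^bsub>A\<^esub> y) = c \<odot>\<^bsub>A\<^esub> (x \<otimes>\<^bsub>A\<^esub> y)) \<and>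
    \<one>\<^bsub>A\<^esub> \<in> gr A 0 \<and>
    (\<forall>i j. \<forall>x\<in>gr A i. \<forall>y\<in>gr A j. x \<otimes>\<^bsub>A\<^esub> y \<in> gr A (i + j)) \<and>
    (\<forall>i j. \<forall>x\<in>gr A i. \<forall>y\<in>gr A j. x \<otimes>\<^bsub>A\<^esub> y = sgn_pow (i * j) \<odot>\<^bsub>A\<^esub> (y \<otimes>\<^bsub>A\<^esub> x)) \<and>
    (\<forall>i j. \<forall>x\<in>gr A i. \<forall>y\<in>gr A j.
       dd A (x \<otimes>\<^bsub>A\<^esub> y) = (dd A x \<otimes>\<^bsub>A\<^esub> y) \<oplus>\<^bsub>A\<^esub> (sgn_pow i \<odot>\<^bsub>A\<^esub> (x \<otimes>\<^bsub>A\<^esub> dd A y)))"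

text \<open>The unit \<open>u\<^sub>A : k \<rightarrow> A\<close> and the product \<open>m\<^sub>A : A \<otimes> A \<rightarrow> A\<close> as linear maps.\<close>

definition unit_map :: "('k::field, 'a, 'm) dgmod_scheme \<Rightarrow> 'k \<Rightarrow> 'a" where
  "unit_map A = (\<lambda>c. c \<odot>\<^bsub>A\<^esub> \<one>\<^bsub>A\<^esub>)"

definition mult_map :: "('k::field, 'a, 'm) dgmod_scheme \<Rightarrow> ('a \<times> 'a \<Rightarrow>\<^sub>0 'k) set \<Rightarrow> 'a" where
  "mult_map A = tlift A A A (\<lambda>x y. x \<otimes>\<^bsub>A\<^esub> y)"

definition cdga_hom ::
  "('k::field, 'a, 'm) dgmod_scheme \<Rightarrow> ('k, 'b, 'n) dgmod_scheme \<Rightarrow> ('a \<Rightarrow> 'b) set" where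
  "cdga_hom A A' = {f \<in> Hom A A' 0. f \<one>\<^bsub>A\<^esub> = \<one>\<^bsub>A'\<^esub> \<and>
     (\<forall>x\<in>carrier A. \<forall>y\<in>carrier A. f (x \<otimes>\<^bsub>A\<^esub> y) = f x \<otimes>\<^bsub>A'\<^esub> f y) \<and>
     compose (carrier A) f (dd A) = compose (carrier A) (dd A') f}"

record (overloaded) ('k, 'b) hopf = "('k::zero, 'b) dgmod" +
  counit :: "'b \<Rightarrow> 'k"
  comult :: "'b \<Rightarrow> ('b \<times> 'b \<Rightarrow>\<^sub>0 'k) set"
  antipode :: "'b \<Rightarrow> 'b"

text \<open>Membership of \<open>counit\<close> and \<open>comult\<close> in \<open>cdga_hom\<close> contains that they are cochain maps.\<close>

definition cdg_hopf :: "('k::field, 'b) hopf \<Rightarrow> bool" where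
  "cdg_hopf B \<longleftrightarrow> cdg_algebra B \<and>
    counit B \<in> cdga_hom B ground \<and>
    comult B \<in> cdga_hom B (tensor B B) \<and>
    compose (carrier B) (tassoc B B B)
        (compose (carrier B) (tmap B B (tensor B B) B 0 (comult B) (id_map B)) (comult B))
      = compose (carrier B) (tmap B B B (tensor B B) 0 (id_map B) (comult B)) (comult B) \<and>
    compose (carrier B) (tlift ground B B (\<lambda>c x. c \<odot>\<^bsub>B\<^esub> x))
        (compose (carrier B) (tmap B B ground B 0 (counit B) (id_map B)) (comult B))
      = id_map B \<and>
    compose (carrier B) (tlift B ground B (\<lambda>x c. c \<odot>\<^bsub>B\<^esub> x))
        (compose (carrier B) (tmap B B B ground 0 (id_map B) (counit B)) (comult B))
      = id_map B \<and>
    antipode B \<in> Hom B B 0 \<and>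
    compose (carrier B) (antipode B) (dd B) = compose (carrier B) (dd B) (antipode B) \<and>
    compose (carrier B) (mult_map B)
        (compose (carrier B) (tmap B B B B 0 (antipode B) (id_map B)) (comult B))
      = compose (carrier B) (unit_map B) (counit B) \<and>
    compose (carrier B) (mult_map B)
        (compose (carrier B) (tmap B B B B 0 (id_map B) (antipode B)) (comult B))
      = compose (carrier B) (unit_map B) (counit B)"

definition coalg_map :: "('k::field, 'b) hopf \<Rightarrow> ('k, 'c) hopf \<Rightarrow> ('b \<Rightarrow> 'c) \<Rightarrow> bool" where
  "coalg_map B B' f \<longleftrightarrow>
    compose (carrier B) (counit B') f = counit B \<and>
    compose (carrier B) (comult B') f = compose (carrier B) (tmap B B B' B' 0 f f) (comult B)"

definition cdgh_hom :: "('k::field, 'b) hopf \<Rightarrow> ('k, 'c) hopf \<Rightarrow> ('b \<Rightarrow> 'c) set" where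
  "cdgh_hom B B' = {f \<in> cdga_hom B B'. coalg_map B B' f}"

section \<open>Homotopy pairs\<close>

text \<open>A polynomial in \<open>t\<close> with coefficients in \<open>Hom V W n\<close> is its coefficient sequence.\<close>

definition Hom_poly :: "('k::field, 'a, 'm) dgmod_scheme \<Rightarrow> ('k, 'b, 'n) dgmod_scheme
    \<Rightarrow> int \<Rightarrow> (nat \<Rightarrow> 'a \<Rightarrow> 'b) set" where
  "Hom_poly V W n = {f. (\<forall>k. f k \<in> Hom V W n) \<and> finite {k. f k \<noteq> zmap V W}}"

definition tderiv :: "('k::field, 'a, 'm) dgmod_scheme \<Rightarrow> ('k, 'b, 'n) dgmod_scheme
    \<Rightarrow> (nat \<Rightarrow> 'a \<Rightarrow> 'b) \<Rightarrow> nat \<Rightarrow> 'a \<Rightarrow> 'b" where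
  "tderiv V W f k = mscale V W (of_nat (Suc k)) (f (Suc k))"

definition teval :: "('k::field, 'a, 'm) dgmod_scheme \<Rightarrow> ('k, 'b, 'n) dgmod_scheme
    \<Rightarrow> (nat \<Rightarrow> 'a \<Rightarrow> 'b) \<Rightarrow> 'k \<Rightarrow> 'a \<Rightarrow> 'b" where
  "teval V W f c =
    (\<lambda>x\<in>carrier V. finsum W (\<lambda>k. c ^ k \<odot>\<^bsub>W\<^esub> f k x) {k. f k \<noteq> zmap V W})"

text \<open>Coefficient \<open>k\<close> of \<open>f(t) \<otimes> g(t)\<close>, where \<open>g(t)\<close> has coefficients of degree \<open>n\<close>.\<close>

definition tmap_poly :: "('k::field, 'a, 'm) dgmod_scheme \<Rightarrow> ('k, 'b, 'n) dgmod_scheme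
    \<Rightarrow> ('k, 'c, 'p) dgmod_scheme \<Rightarrow> ('k, 'd, 'q) dgmod_scheme
    \<Rightarrow> int \<Rightarrow> (nat \<Rightarrow> 'a \<Rightarrow> 'c) \<Rightarrow> (nat \<Rightarrow> 'b \<Rightarrow> 'd)
    \<Rightarrow> nat \<Rightarrow> ('a \<times> 'b \<Rightarrow>\<^sub>0 'k) set \<Rightarrow> ('c \<times> 'd \<Rightarrow>\<^sub>0 'k) set" where
  "tmap_poly V W V' W' n f g k = (\<lambda>s\<in>carrier (tensor V W).
     finsum (tensor V' W') (\<lambda>i. tmap V W V' W' n (f i) (g (k - i)) s) {..k})"

text \<open>Coefficient \<open>k\<close> of \<open>f(t) \<otimes> \<xi>(t) + \<xi>(t) \<otimes> f(t)\<close> for \<open>f(t)\<close>, \<open>\<xi>(t)\<close> of degree \<open>0\<close>, \<open>-1\<close>.\<close>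

definition tderivation :: "('k::field, 'a, 'm) dgmod_scheme \<Rightarrow> ('k, 'b, 'n) dgmod_scheme
    \<Rightarrow> (nat \<Rightarrow> 'a \<Rightarrow> 'b) \<Rightarrow> (nat \<Rightarrow> 'a \<Rightarrow> 'b)
    \<Rightarrow> nat \<Rightarrow> ('a \<times> 'a \<Rightarrow>\<^sub>0 'k) set \<Rightarrow> ('b \<times> 'b \<Rightarrow>\<^sub>0 'k) set" where
  "tderivation V W f \<xi> k = madd (tensor V V) (tensor W W)
     (tmap_poly V V W W (- 1) f \<xi> k) (tmap_poly V V W W 0 \<xi> f k)"

definition cdga_hpair :: "('k::field, 'a, 'm) dgmod_scheme \<Rightarrow> ('k, 'b, 'n) dgmod_scheme
    \<Rightarrow> (nat \<Rightarrow> 'a \<Rightarrow> 'b) \<Rightarrow> (nat \<Rightarrow> 'a \<Rightarrow> 'b) \<Rightarrow> bool" where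
  "cdga_hpair A A' f \<xi> \<longleftrightarrow>
    f \<in> Hom_poly A A' 0 \<and> \<xi> \<in> Hom_poly A A' (- 1) \<and>
    (\<forall>k. tderiv A A' f k = hom_diff A A' (- 1) (\<xi> k)) \<and>
    teval A A' f 0 \<in> cdga_hom A A' \<and>
    (\<forall>k. compose UNIV (\<xi> k) (unit_map A) = zmap (ground :: ('k, 'k) dgmod) A') \<and>
    (\<forall>k. compose (carrier (tensor A A)) (\<xi> k) (mult_map A)
       = compose (carrier (tensor A A)) (mult_map A') (tderivation A A' f \<xi> k))"

definition cdgh_hpair :: "('k::field, 'b) hopf \<Rightarrow> ('k, 'c) hopf
    \<Rightarrow> (nat \<Rightarrow> 'b \<Rightarrow> 'c) \<Rightarrow> (nat \<Rightarrow> 'b \<Rightarrow> 'c) \<Rightarrow> bool" where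
  "cdgh_hpair B B' f \<xi> \<longleftrightarrow> cdga_hpair B B' f \<xi> \<and>
    coalg_map B B' (teval B B' f 0) \<and>
    (\<forall>k. compose (carrier B) (counit B') (\<xi> k) = zmap B (ground :: ('k, 'k) dgmod)) \<and>
    (\<forall>k. compose (carrier B) (comult B') (\<xi> k)
       = compose (carrier B) (tderivation B B' f \<xi> k) (comult B))"

definition cdga_homotopic :: "('k::field, 'a, 'm) dgmod_scheme \<Rightarrow> ('k, 'b, 'n) dgmod_scheme
    \<Rightarrow> ('a \<Rightarrow> 'b) \<Rightarrow> ('a \<Rightarrow> 'b) \<Rightarrow> bool" where
  "cdga_homotopic A A' g h \<longleftrightarrow> g \<in> cdga_hom A A' \<and> h \<in> cdga_hom A A' \<and>
    (\<exists>f \<xi>. cdga_hpair A A' f \<xi> \<and> teval A A' f 0 = g \<and> teval A A' f 1 = h)"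

definition cdgh_homotopic :: "('k::field, 'b) hopf \<Rightarrow> ('k, 'c) hopf
    \<Rightarrow> ('b \<Rightarrow> 'c) \<Rightarrow> ('b \<Rightarrow> 'c) \<Rightarrow> bool" where
  "cdgh_homotopic B B' g h \<longleftrightarrow> g \<in> cdgh_hom B B' \<and> h \<in> cdgh_hom B B' \<and>
    (\<exists>f \<xi>. cdgh_hpair B B' f \<xi> \<and> teval B B' f 0 = g \<and> teval B B' f 1 = h)"

text \<open>Homotopy types of morphisms are the classes of the equivalence relation generated by
  homotopy pairs: concatenating two polynomial paths need not give a polynomial path, so
  transitivity of the elementary relation is not taken for granted.\<close>

definition cdga_class :: "('k::field, 'a, 'm) dgmod_scheme \<Rightarrow> ('k, 'b, 'n) dgmod_scheme
    \<Rightarrow> ('a \<Rightarrow> 'b) \<Rightarrow> ('a \<Rightarrow> 'b) set" where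
  "cdga_class A A' f = {g \<in> cdga_hom A A'. equivclp (cdga_homotopic A A') f g}"

definition cdgh_class :: "('k::field, 'b) hopf \<Rightarrow> ('k, 'c) hopf
    \<Rightarrow> ('b \<Rightarrow> 'c) \<Rightarrow> ('b \<Rightarrow> 'c) set" where
  "cdgh_class B B' f = {g \<in> cdgh_hom B B'. equivclp (cdgh_homotopic B B') f g}"

text \<open>Composites of homotopy types are composites of representatives; the unions below are over
  equal classes. Objects are the algebras whose carrier is a subset of the type \<open>'a\<close> (\<open>'b\<close>), which
  plays the role of a universe.\<close>

definition ho_cdgA :: "(('k::field, 'a) dgmod, ('a \<Rightarrow> 'a) set) cat" where
  "ho_cdgA = \<lparr>Obj = {A. cdg_algebra A},
     Mor = (\<lambda>A A'. cdga_class A A' ` cdga_hom A A'),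
     Ident = (\<lambda>A. cdga_class A A (id_map A)),
     Comp = (\<lambda>A A' A'' G F. \<Union>g\<in>G. \<Union>f\<in>F. cdga_class A A'' (compose (carrier A) g f))\<rparr>"

definition ho_cdgH :: "(('k::field, 'b) hopf, ('b \<Rightarrow> 'b) set) cat" where
  "ho_cdgH = \<lparr>Obj = {B. cdg_hopf B},
     Mor = (\<lambda>B B'. cdgh_class B B' ` cdgh_hom B B'),
     Ident = (\<lambda>B. cdgh_class B B (id_map B)),
     Comp = (\<lambda>B B' B'' G F. \<Union>g\<in>G. \<Union>f\<in>F. cdgh_class B B'' (compose (carrier B) g f))\<rparr>"

definition hopf_homotopy_equivalence ::
  "('k::field, 'b) hopf \<Rightarrow> ('k, 'c) hopf \<Rightarrow> ('b \<Rightarrow> 'c) \<Rightarrow> bool" where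
  "hopf_homotopy_equivalence B B' \<psi> \<longleftrightarrow> \<psi> \<in> cdgh_hom B B' \<and>
    (\<exists>\<phi>\<in>cdgh_hom B' B.
       cdgh_class B B (compose (carrier B) \<phi> \<psi>) = cdgh_class B B (id_map B) \<and>
       cdgh_class B' B' (compose (carrier B') \<psi> \<phi>) = cdgh_class B' B' (id_map B'))"

section \<open>Tangential morphisms\<close>

definition e_map :: "('k::field, 'b) hopf \<Rightarrow> ('k, 'a, 'm) dgmod_scheme \<Rightarrow> 'b \<Rightarrow> 'a" where
  "e_map B A = compose (carrier B) (unit_map A) (counit B)"

text \<open>\<open>e_derivation B A n \<sigma>\<close> is \<open>m\<^sub>A \<circ> (e \<otimes> \<sigma> + \<sigma> \<otimes> e)\<close> for \<open>\<sigma>\<close> of degree \<open>n\<close>.\<close>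

definition e_derivation :: "('k::field, 'b) hopf \<Rightarrow> ('k, 'a, 'm) dgmod_scheme
    \<Rightarrow> int \<Rightarrow> ('b \<Rightarrow> 'a) \<Rightarrow> ('b \<times> 'b \<Rightarrow>\<^sub>0 'k) set \<Rightarrow> 'a" where
  "e_derivation B A n \<sigma> = compose (carrier (tensor B B)) (mult_map A)
     (madd (tensor B B) (tensor A A)
       (tmap B B A A n (e_map B A) \<sigma>) (tmap B B A A 0 \<sigma> (e_map B A)))"

definition THom :: "('k::field, 'b) hopf \<Rightarrow> ('k, 'a, 'm) dgmod_scheme \<Rightarrow> ('b \<Rightarrow> 'a) set" where
  "THom B A = {\<upsilon> \<in> Hom B A 0. hom_diff B A 0 \<upsilon> = zmap B A \<and>
     compose UNIV \<upsilon> (unit_map B) = zmap (ground :: ('k, 'k) dgmod) A \<and>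
     compose (carrier (tensor B B)) \<upsilon> (mult_map B) = e_derivation B A 0 \<upsilon>}"

definition thom_hpair :: "('k::field, 'b) hopf \<Rightarrow> ('k, 'a, 'm) dgmod_scheme
    \<Rightarrow> (nat \<Rightarrow> 'b \<Rightarrow> 'a) \<Rightarrow> (nat \<Rightarrow> 'b \<Rightarrow> 'a) \<Rightarrow> bool" where
  "thom_hpair B A \<upsilon> \<sigma> \<longleftrightarrow>
    \<upsilon> \<in> Hom_poly B A 0 \<and> \<sigma> \<in> Hom_poly B A (- 1) \<and>
    (\<forall>k. tderiv B A \<upsilon> k = hom_diff B A (- 1) (\<sigma> k)) \<and>
    teval B A \<upsilon> 0 \<in> THom B A \<and>
    (\<forall>k. compose UNIV (\<sigma> k) (unit_map B) = zmap (ground :: ('k, 'k) dgmod) A) \<and>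
    (\<forall>k. compose (carrier (tensor B B)) (\<sigma> k) (mult_map B) = e_derivation B A (- 1) (\<sigma> k))"

definition thom_homotopic :: "('k::field, 'b) hopf \<Rightarrow> ('k, 'a, 'm) dgmod_scheme
    \<Rightarrow> ('b \<Rightarrow> 'a) \<Rightarrow> ('b \<Rightarrow> 'a) \<Rightarrow> bool" where
  "thom_homotopic B A g h \<longleftrightarrow> g \<in> THom B A \<and> h \<in> THom B A \<and>
    (\<exists>\<upsilon> \<sigma>. thom_hpair B A \<upsilon> \<sigma> \<and> teval B A \<upsilon> 0 = g \<and> teval B A \<upsilon> 1 = h)"

definition thom_class :: "('k::field, 'b) hopf \<Rightarrow> ('k, 'a, 'm) dgmod_scheme
    \<Rightarrow> ('b \<Rightarrow> 'a) \<Rightarrow> ('b \<Rightarrow> 'a) set" where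
  "thom_class B A \<upsilon> = {\<upsilon>' \<in> THom B A. thom_homotopic B A \<upsilon> \<upsilon>'}"

definition THom_ho :: "('k::field, 'b) hopf \<Rightarrow> ('k, 'a, 'm) dgmod_scheme
    \<Rightarrow> ('b \<Rightarrow> 'a) set set" where
  "THom_ho B A = thom_class B A ` THom B A"

text \<open>\<open>m\<^sub>A \<circ> (\<upsilon>\<^sub>1 \<otimes> \<upsilon>\<^sub>2 - \<upsilon>\<^sub>2 \<otimes> \<upsilon>\<^sub>1) \<circ> \<Delta>\<^sub>B\<close>\<close>

definition conv_commutator :: "('k::field, 'b) hopf \<Rightarrow> ('k, 'a, 'm) dgmod_scheme
    \<Rightarrow> ('b \<Rightarrow> 'a) \<Rightarrow> ('b \<Rightarrow> 'a) \<Rightarrow> 'b \<Rightarrow> 'a" where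
  "conv_commutator B A \<upsilon>1 \<upsilon>2 = compose (carrier B) (mult_map A)
     (compose (carrier B)
       (msub (tensor B B) (tensor A A) (tmap B B A A 0 \<upsilon>1 \<upsilon>2) (tmap B B A A 0 \<upsilon>2 \<upsilon>1))
       (comult B))"

section \<open>Lie algebras\<close>

text \<open>The ring fields \<open>mult\<close> and \<open>one\<close> inherited from \<open>module\<close> are ignored.\<close>

record ('k, 'l) lie = "('k, 'l) module" +
  lbr :: "'l \<Rightarrow> 'l \<Rightarrow> 'l"

definition lie_algebra :: "('k::field, 'l) lie \<Rightarrow> bool" where
  "lie_algebra L \<longleftrightarrow> Module.module (ground :: ('k, 'k) dgmod) L \<and>
    (\<forall>x\<in>carrier L. \<forall>y\<in>carrier L. lbr L x y \<in> carrier L) \<and>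
    (\<forall>x\<in>carrier L. \<forall>y\<in>carrier L. \<forall>z\<in>carrier L.
       lbr L (x \<oplus>\<^bsub>L\<^esub> y) z = lbr L x z \<oplus>\<^bsub>L\<^esub> lbr L y z \<and>
       lbr L z (x \<oplus>\<^bsub>L\<^esub> y) = lbr L z x \<oplus>\<^bsub>L\<^esub> lbr L z y) \<and>
    (\<forall>c. \<forall>x\<in>carrier L. \<forall>y\<in>carrier L.
       lbr L (c \<odot>\<^bsub>L\<^esub> x) y = c \<odot>\<^bsub>L\<^esub> lbr L x y \<and> lbr L x (c \<odot>\<^bsub>L\<^esub> y) = c \<odot>\<^bsub>L\<^esub> lbr L x y) \<and>
    (\<forall>x\<in>carrier L. lbr L x x = \<zero>\<^bsub>L\<^esub>) \<and>
    (\<forall>x\<in>carrier L. \<forall>y\<in>carrier L. \<forall>z\<in>carrier L.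
       lbr L x (lbr L y z) \<oplus>\<^bsub>L\<^esub> lbr L y (lbr L z x) \<oplus>\<^bsub>L\<^esub> lbr L z (lbr L x y) = \<zero>\<^bsub>L\<^esub>)"

definition lie_hom :: "('k::field, 'l) lie \<Rightarrow> ('k, 'l) lie \<Rightarrow> ('l \<Rightarrow> 'l) set" where
  "lie_hom L L' = {f \<in> linear_maps L L'.
     \<forall>x\<in>carrier L. \<forall>y\<in>carrier L. f (lbr L x y) = lbr L' (f x) (f y)}"

definition LieCat :: "(('k::field, 'l) lie, 'l \<Rightarrow> 'l) cat" where
  "LieCat = \<lparr>Obj = {L. lie_algebra L}, Mor = lie_hom, Ident = id_map,
     Comp = (\<lambda>L L' L'' g f. compose (carrier L) g f)\<rparr>"

end

theory Submission
  imports Defs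
begin

text \<open>Write \<open>\<epsilon>\<close>, \<open>\<Delta>\<close> for the counit and coproduct of \<open>B\<close>, and \<open>D\<close> for the differential on graded maps. An
  \<open>\<epsilon>\<close>-derivation is a graded map \<open>\<sigma> : B \<rightarrow> A\<close> with \<open>\<sigma>(xy) = \<epsilon>(x) \<sigma>(y) + \<epsilon>(y) \<sigma>(x)\<close>. The
  \<open>\<epsilon>\<close>-derivations form a complex, and its cocycles of degree \<open>0\<close> are the tangential morphisms. Their
  conditions are linear, so a homotopy pair can be integrated over \<open>t\<close>: two tangential morphisms
  are homotopic iff they differ by \<open>D \<sigma>\<close> for an \<open>\<epsilon>\<close>-derivation \<open>\<sigma>\<close> of degree \<open>-1\<close>
  (\<open>thom_homotopic_iff\<close>). The homotopy types thus form the homology of this complex in degree \<open>0\<close>.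

  The bracket is the commutator of the convolution product \<open>f * g = m \<circ> (f \<otimes> g) \<circ> \<Delta>\<close>, which is
  associative by coassociativity (\<open>conv_assoc\<close>); this gives the Jacobi identity. Commutators of
  \<open>\<epsilon>\<close>-derivations are \<open>\<epsilon>\<close>-derivations because \<open>A\<close> is graded commutative (\<open>tlift_cform_mult\<close>,
  \<open>cbr_eder\<close>). Bracketing with a cocycle commutes with \<open>D\<close> (\<open>hom_diff_cbr\<close>), so the boundaries are an
  ideal in the Lie algebra of cocycles, and the bracket descends to homotopy types.

  An algebra map \<open>f\<close> acts by \<open>\<upsilon> \<mapsto> f \<circ> \<upsilon>\<close>. Homotopic maps differ by some \<open>D \<eta>\<close>, and then \<open>f \<circ> \<upsilon>\<close>
  changes by \<open>D (\<eta> \<circ> \<upsilon>)\<close>; here \<open>\<eta> \<circ> \<upsilon>\<close> is an \<open>\<epsilon>\<close>-derivation since the rule above has scalar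
  coefficients (\<open>compose_eder\<close>). A Hopf map \<open>\<psi>\<close> acts by \<open>\<upsilon> \<mapsto> \<upsilon> \<circ> \<psi>\<close>. Along a homotopy \<open>(f(t), \<xi>(t))\<close> of
  Hopf maps, \<open>\<upsilon> \<circ> \<xi>(t)\<close> is a derivation along \<open>\<epsilon> \<circ> f(t)\<close>, and \<open>\<epsilon> \<circ> f(t)\<close> is constantly \<open>\<epsilon>\<close>
  (\<open>cdgh_hpair_counit\<close>); so \<open>\<upsilon> \<circ> \<psi>\<close> changes by a boundary too. Both actions therefore depend only on
  homotopy types, and homotopy inverse Hopf maps induce inverse maps.

  Identities between maps on tensor products are reduced by the universal property to pure
  tensors of homogeneous elements, where the Koszul signs are explicit.\<close>

section \<open>Vector spaces and linear maps\<close>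

lemma ground_simps [simp]:
  "carrier (ground :: ('k::field, 'k) dgmod) = UNIV"
  "zero (ground :: ('k::field, 'k) dgmod) = 0"
  "one (ground :: ('k::field, 'k) dgmod) = 1"
  "add (ground :: ('k::field, 'k) dgmod) = (+)"
  "monoid.mult (ground :: ('k::field, 'k) dgmod) = (*)"
  "smult (ground :: ('k::field, 'k) dgmod) = (*)"
  "gr (ground :: ('k::field, 'k) dgmod) n = (if n = 0 then UNIV else {0})"
  "dd (ground :: ('k::field, 'k) dgmod) = (\<lambda>_. 0)"
  by (simp_all add: ground_def)

lemma cring_ground: "cring (ground :: ('k::field, 'k) dgmod)"
proof (rule cringI)
  show "abelian_group (ground :: ('k, 'k) dgmod)"
  proof (rule abelian_groupI)
    fix x :: 'k
    show "\<exists>y\<in>carrier ground. y \<oplus>\<^bsub>ground\<^esub> x = \<zero>\<^bsub>ground\<^esub>"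
      by (rule bexI[of _ "- x"]) simp_all
  qed (auto simp: algebra_simps)
  show "Group.comm_monoid (ground :: ('k, 'k) dgmod)"
    by (rule comm_monoidI) (auto simp: algebra_simps)
qed (auto simp: algebra_simps)

text \<open>Modules over \<open>ground\<close> with the scalar axioms stated over the type of scalars, so that no
  side conditions \<open>c \<in> carrier ground\<close> arise.\<close>

locale kspace = abelian_group V
  for V :: "('k::field, 'a, 'm) module_scheme" (structure) +
  assumes smult_closed [simp, intro]: "x \<in> carrier V \<Longrightarrow> (c::'k) \<odot> x \<in> carrier V"
    and smult_add_left: "x \<in> carrier V \<Longrightarrow> (c + d) \<odot> x = c \<odot> x \<oplus> d \<odot> x"
    and smult_add_right: "x \<in> carrier V \<Longrightarrow> y \<in> carrier V \<Longrightarrow> c \<odot> (x \<oplus> y) = c \<odot> x \<oplus> c \<odot> y"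
    and smult_smult: "x \<in> carrier V \<Longrightarrow> c \<odot> (d \<odot> x) = (c * d) \<odot> x"
    and smult_one [simp]: "x \<in> carrier V \<Longrightarrow> 1 \<odot> x = x"

lemma kspace_iff_module:
  fixes V :: "('k::field, 'a, 'm) module_scheme"
  shows "kspace V \<longleftrightarrow> Module.module (ground :: ('k, 'k) dgmod) V"
proof
  assume "kspace V"
  then interpret kspace V .
  show "Module.module (ground :: ('k, 'k) dgmod) V"
    by (rule moduleI[OF cring_ground abelian_group_axioms])
      (auto simp: smult_add_left smult_add_right smult_smult)
next
  assume "Module.module (ground :: ('k, 'k) dgmod) V"
  then interpret module "ground :: ('k, 'k) dgmod" V .
  show "kspace V"
  proof (intro kspace.intro kspace_axioms.intro)
    show "abelian_group V" by (rule M.abelian_group_axioms)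
  qed (use smult_closed smult_l_distr smult_r_distr smult_assoc1 smult_one in auto)
qed

lemma kspace_ground: "kspace (ground :: ('k::field, 'k) dgmod)"
proof -
  interpret cring "ground :: ('k, 'k) dgmod" by (rule cring_ground)
  show ?thesis
    by (intro kspace.intro kspace_axioms.intro abelian_group_axioms) (auto simp: algebra_simps)
qed

context kspace
begin

lemma smult_zero_left [simp]: "x \<in> carrier V \<Longrightarrow> 0 \<odot> x = \<zero>"
  using smult_add_left[of x 0 0] by (metis add.l_cancel_one add_0 smult_closed)

lemma smult_zero_right [simp]: "c \<odot> \<zero> = \<zero>"
  using smult_smult[of "\<zero>" c 0] by simp

lemma minus_eq_smult: "x \<in> carrier V \<Longrightarrow> \<ominus> x = (- 1) \<odot> x"
proof -
  assume x: "x \<in> carrier V"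
  have "(- 1) \<odot> x \<oplus> x = (- 1 + 1) \<odot> x"
    using x smult_add_left[of x "- 1" 1] by simp
  then have "(- 1) \<odot> x \<oplus> x = \<zero>" using x by simp
  then show ?thesis using x by (simp add: minus_equality)
qed

lemma smult_minus_right: "x \<in> carrier V \<Longrightarrow> c \<odot> (\<ominus> x) = \<ominus> (c \<odot> x)"
  by (simp add: minus_eq_smult smult_smult)

lemma smult_diff_right: "x \<in> carrier V \<Longrightarrow> y \<in> carrier V \<Longrightarrow> c \<odot> (x \<ominus> y) = c \<odot> x \<ominus> c \<odot> y"
  by (simp add: minus_eq smult_add_right smult_minus_right)

lemma finsum_smult:
  "f \<in> A \<rightarrow> carrier V \<Longrightarrow> c \<odot> finsum V f A = finsum V (\<lambda>i. c \<odot> f i) A"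
proof (induction A rule: infinite_finite_induct)
  case (insert x F)
  then show ?case by (simp add: Pi_def smult_add_right)
qed (simp_all add: finsum_infinite)

lemma finsum_superset:
  assumes "finite S" "T \<subseteq> S" "f \<in> S \<rightarrow> carrier V" "\<And>i. i \<in> S - T \<Longrightarrow> f i = \<zero>"
  shows "finsum V f T = finsum V f S"
  using assms by (intro add.finprod_mono_neutral_cong_left) auto

lemma finsum_add:
  "f \<in> A \<rightarrow> carrier V \<Longrightarrow> g \<in> A \<rightarrow> carrier V \<Longrightarrow>
    finsum V (\<lambda>i. f i \<oplus> g i) A = finsum V f A \<oplus> finsum V g A"
  by (rule finsum_addf)

lemma minus_cancel_diff:
  "x \<in> carrier V \<Longrightarrow> y \<in> carrier V \<Longrightarrow> x \<oplus> (y \<ominus> x) = y"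
  by (metis a_minus_def add.inv_closed add.m_lcomm r_neg r_zero)

lemma diff_eq_zero_iff: "x \<in> carrier V \<Longrightarrow> y \<in> carrier V \<Longrightarrow> x \<ominus> y = \<zero> \<longleftrightarrow> x = y"
  by (metis minus_cancel_diff a_minus_def r_neg r_zero)

end

lemma linear_mapsI:
  assumes "\<And>x. x \<in> carrier V \<Longrightarrow> f x \<in> carrier W"
    and "\<And>x. x \<notin> carrier V \<Longrightarrow> f x = undefined"
    and "\<And>x y. x \<in> carrier V \<Longrightarrow> y \<in> carrier V \<Longrightarrow> f (x \<oplus>\<^bsub>V\<^esub> y) = f x \<oplus>\<^bsub>W\<^esub> f y"
    and "\<And>c x. x \<in> carrier V \<Longrightarrow> f (c \<odot>\<^bsub>V\<^esub> x) = c \<odot>\<^bsub>W\<^esub> f x"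
  shows "f \<in> linear_maps V W"
  using assms by (auto simp: linear_maps_def PiE_def extensional_def)

lemma linear_mapsD:
  assumes "f \<in> linear_maps V W"
  shows linear_closed: "\<And>x. x \<in> carrier V \<Longrightarrow> f x \<in> carrier W"
    and linear_undefined: "\<And>x. x \<notin> carrier V \<Longrightarrow> f x = undefined"
    and linear_add: "\<And>x y. x \<in> carrier V \<Longrightarrow> y \<in> carrier V \<Longrightarrow> f (x \<oplus>\<^bsub>V\<^esub> y) = f x \<oplus>\<^bsub>W\<^esub> f y"
    and linear_smult: "\<And>c x. x \<in> carrier V \<Longrightarrow> f (c \<odot>\<^bsub>V\<^esub> x) = c \<odot>\<^bsub>W\<^esub> f x"
  using assms by (auto simp: linear_maps_def PiE_def extensional_def)

lemma linear_eqI: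
  assumes "f \<in> linear_maps V W" "g \<in> linear_maps V' W'" "carrier V = carrier V'"
    "\<And>x. x \<in> carrier V \<Longrightarrow> f x = g x"
  shows "f = g"
  using assms by (metis ext linear_undefined)

lemma linear_zero:
  assumes "kspace V" "kspace W" "f \<in> linear_maps V W"
  shows "f \<zero>\<^bsub>V\<^esub> = \<zero>\<^bsub>W\<^esub>"
proof -
  interpret V: kspace V by fact
  interpret W: kspace W by fact
  have "f (0 \<odot>\<^bsub>V\<^esub> \<zero>\<^bsub>V\<^esub>) = 0 \<odot>\<^bsub>W\<^esub> f \<zero>\<^bsub>V\<^esub>" using assms(3) linear_smult V.zero_closed by metis
  then show ?thesis using assms(3) by (simp add: linear_closed)
qed

lemma linear_minus:
  assumes "kspace V" "kspace W" "f \<in> linear_maps V W" "x \<in> carrier V"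
  shows "f (\<ominus>\<^bsub>V\<^esub> x) = \<ominus>\<^bsub>W\<^esub> f x"
proof -
  interpret V: kspace V by fact
  interpret W: kspace W by fact
  show ?thesis using assms(3,4)
    by (simp add: V.minus_eq_smult W.minus_eq_smult linear_smult linear_closed)
qed

lemma linear_diff:
  assumes "kspace V" "kspace W" "f \<in> linear_maps V W" "x \<in> carrier V" "y \<in> carrier V"
  shows "f (x \<ominus>\<^bsub>V\<^esub> y) = f x \<ominus>\<^bsub>W\<^esub> f y"
proof -
  interpret V: kspace V by fact
  show ?thesis using assms by (simp add: a_minus_def linear_add linear_minus)
qed

lemma linear_finsum:
  assumes "kspace V" "kspace W" "f \<in> linear_maps V W" "g \<in> A \<rightarrow> carrier V"
  shows "f (finsum V g A) = finsum W (\<lambda>i. f (g i)) A"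
proof -
  interpret V: kspace V by fact
  interpret W: kspace W by fact
  show ?thesis using assms(4)
  proof (induction A rule: infinite_finite_induct)
    case (insert x F)
    then have "f (finsum V g (insert x F)) = f (g x) \<oplus>\<^bsub>W\<^esub> f (finsum V g F)"
      using assms(3) by (simp add: Pi_def linear_add)
    also have "\<dots> = finsum W (\<lambda>i. f (g i)) (insert x F)"
      using insert linear_closed[OF assms(3)]
      by (subst W.finsum_insert) (auto simp: Pi_def)
    finally show ?case .
  qed (use assms in \<open>simp_all add: V.finsum_infinite W.finsum_infinite linear_zero\<close>)
qed

lemma linear_compose:
  assumes "kspace U" "f \<in> linear_maps U V" "g \<in> linear_maps V W"
  shows "compose (carrier U) g f \<in> linear_maps U W"
proof -
  interpret kspace U by fact
  show ?thesis using assms(2,3)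
    by (intro linear_mapsI) (auto simp: compose_def linear_closed linear_add linear_smult)
qed

lemma linear_zmap: "kspace V \<Longrightarrow> kspace W \<Longrightarrow> zmap V W \<in> linear_maps V W"
proof -
  assume "kspace V" "kspace W"
  then interpret V: kspace V + W: kspace W by auto
  show ?thesis by (rule linear_mapsI) (auto simp: zmap_def)
qed

lemma linear_madd:
  assumes "kspace V" "kspace W" "f \<in> linear_maps V W" "g \<in> linear_maps V W"
  shows "madd V W f g \<in> linear_maps V W"
proof -
  interpret V: kspace V by fact
  interpret W: kspace W by fact
  show ?thesis using assms(3,4)
    by (intro linear_mapsI)
      (auto simp: madd_def linear_closed linear_add linear_smult W.smult_add_right W.a_ac)
qed

lemma linear_mscale:
  assumes "kspace V" "kspace W" "f \<in> linear_maps V W"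
  shows "mscale V W c f \<in> linear_maps V W"
proof -
  interpret V: kspace V by fact
  interpret W: kspace W by fact
  show ?thesis using assms(3)
    by (intro linear_mapsI)
      (auto simp: mscale_def linear_closed linear_add linear_smult W.smult_add_right W.smult_smult mult.commute)
qed

lemma msub_eq_madd_mscale:
  assumes "kspace V" "kspace W" "f \<in> linear_maps V W" "g \<in> linear_maps V W"
  shows "msub V W f g = madd V W f (mscale V W (- 1) g)"
proof -
  interpret W: kspace W by fact
  show ?thesis using assms(3,4)
    by (auto simp: msub_def madd_def mscale_def a_minus_def W.minus_eq_smult linear_closed
        intro!: restrict_ext)
qed

lemma linear_msub:
  assumes "kspace V" "kspace W" "f \<in> linear_maps V W" "g \<in> linear_maps V W"
  shows "msub V W f g \<in> linear_maps V W"
  using assms by (simp add: msub_eq_madd_mscale linear_madd linear_mscale)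

lemma id_map_apply [simp]: "x \<in> carrier V \<Longrightarrow> id_map V x = x"
  by (simp add: id_map_def)

lemma linear_id_map: "kspace V \<Longrightarrow> id_map V \<in> linear_maps V V"
proof -
  assume "kspace V"
  then interpret V: kspace V .
  show ?thesis by (rule linear_mapsI) (auto simp: id_map_def)
qed

definition bilinear :: "('k::field, 'a, 'm) module_scheme \<Rightarrow> ('k, 'b, 'n) module_scheme
    \<Rightarrow> ('k, 'c, 'p) module_scheme \<Rightarrow> ('a \<Rightarrow> 'b \<Rightarrow> 'c) \<Rightarrow> bool" where
  "bilinear V W X \<phi> \<longleftrightarrow>
    (\<forall>x\<in>carrier V. \<forall>y\<in>carrier W. \<phi> x y \<in> carrier X) \<and>
    (\<forall>x\<in>carrier V. \<forall>x'\<in>carrier V. \<forall>y\<in>carrier W. \<phi> (x \<oplus>\<^bsub>V\<^esub> x') y = \<phi> x y \<oplus>\<^bsub>X\<^esub> \<phi> x' y) \<and>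
    (\<forall>x\<in>carrier V. \<forall>y\<in>carrier W. \<forall>y'\<in>carrier W. \<phi> x (y \<oplus>\<^bsub>W\<^esub> y') = \<phi> x y \<oplus>\<^bsub>X\<^esub> \<phi> x y') \<and>
    (\<forall>c. \<forall>x\<in>carrier V. \<forall>y\<in>carrier W. \<phi> (c \<odot>\<^bsub>V\<^esub> x) y = c \<odot>\<^bsub>X\<^esub> \<phi> x y) \<and>
    (\<forall>c. \<forall>x\<in>carrier V. \<forall>y\<in>carrier W. \<phi> x (c \<odot>\<^bsub>W\<^esub> y) = c \<odot>\<^bsub>X\<^esub> \<phi> x y)"

lemma bilinearI:
  assumes "\<And>x y. x \<in> carrier V \<Longrightarrow> y \<in> carrier W \<Longrightarrow> \<phi> x y \<in> carrier X"
    and "\<And>x x' y. x \<in> carrier V \<Longrightarrow> x' \<in> carrier V \<Longrightarrow> y \<in> carrier W \<Longrightarrow>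
      \<phi> (x \<oplus>\<^bsub>V\<^esub> x') y = \<phi> x y \<oplus>\<^bsub>X\<^esub> \<phi> x' y"
    and "\<And>x y y'. x \<in> carrier V \<Longrightarrow> y \<in> carrier W \<Longrightarrow> y' \<in> carrier W \<Longrightarrow>
      \<phi> x (y \<oplus>\<^bsub>W\<^esub> y') = \<phi> x y \<oplus>\<^bsub>X\<^esub> \<phi> x y'"
    and "\<And>c x y. x \<in> carrier V \<Longrightarrow> y \<in> carrier W \<Longrightarrow> \<phi> (c \<odot>\<^bsub>V\<^esub> x) y = c \<odot>\<^bsub>X\<^esub> \<phi> x y"
    and "\<And>c x y. x \<in> carrier V \<Longrightarrow> y \<in> carrier W \<Longrightarrow> \<phi> x (c \<odot>\<^bsub>W\<^esub> y) = c \<odot>\<^bsub>X\<^esub> \<phi> x y"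
  shows "bilinear V W X \<phi>"
  using assms unfolding bilinear_def by blast

lemma bilinearD:
  assumes "bilinear V W X \<phi>" "x \<in> carrier V" "y \<in> carrier W"
  shows "\<phi> x y \<in> carrier X"
    and "x' \<in> carrier V \<Longrightarrow> \<phi> (x \<oplus>\<^bsub>V\<^esub> x') y = \<phi> x y \<oplus>\<^bsub>X\<^esub> \<phi> x' y"
    and "y' \<in> carrier W \<Longrightarrow> \<phi> x (y \<oplus>\<^bsub>W\<^esub> y') = \<phi> x y \<oplus>\<^bsub>X\<^esub> \<phi> x y'"
    and "\<phi> (c \<odot>\<^bsub>V\<^esub> x) y = c \<odot>\<^bsub>X\<^esub> \<phi> x y"
    and "\<phi> x (c \<odot>\<^bsub>W\<^esub> y) = c \<odot>\<^bsub>X\<^esub> \<phi> x y"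
  using assms unfolding bilinear_def by blast+

lemma bilinear_compose:
  assumes "bilinear V W X \<phi>" "f \<in> linear_maps V' V" "g \<in> linear_maps W' W"
  shows "bilinear V' W' X (\<lambda>x y. \<phi> (f x) (g y))"
  using assms by (intro bilinearI) (auto simp: bilinearD linear_closed linear_add linear_smult)

lemma linear_o_bilinear:
  assumes "bilinear V W X \<phi>" "h \<in> linear_maps X Y"
  shows "bilinear V W Y (\<lambda>x y. h (\<phi> x y))"
  using assms by (intro bilinearI) (auto simp: bilinearD linear_closed linear_add linear_smult)

lemma bilinear_add:
  assumes "kspace X" "bilinear V W X \<phi>" "bilinear V W X \<psi>"
  shows "bilinear V W X (\<lambda>x y. \<phi> x y \<oplus>\<^bsub>X\<^esub> \<psi> x y)"
proof -
  interpret X: kspace X by fact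
  show ?thesis
    using assms(2,3) by (intro bilinearI) (auto simp: bilinearD X.smult_add_right X.a_ac)
qed

lemma bilinear_diff:
  assumes "kspace X" "bilinear V W X \<phi>" "bilinear V W X \<psi>"
  shows "bilinear V W X (\<lambda>x y. \<phi> x y \<ominus>\<^bsub>X\<^esub> \<psi> x y)"
proof -
  interpret X: kspace X by fact
  have minus: "u \<ominus>\<^bsub>X\<^esub> v = u \<oplus>\<^bsub>X\<^esub> (- 1) \<odot>\<^bsub>X\<^esub> v" if "v \<in> carrier X" for u v
    using that by (simp add: a_minus_def X.minus_eq_smult)
  show ?thesis
    using assms(2,3)
    by (intro bilinearI)
      (simp_all add: minus bilinearD X.smult_add_right X.smult_smult X.a_ac mult.commute)
qed

lemma bilinear_scalar: "kspace X \<Longrightarrow> bilinear (ground :: ('k::field, 'k) dgmod) X X (\<lambda>c x. c \<odot>\<^bsub>X\<^esub> x)"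
proof -
  assume "kspace X"
  then interpret kspace X .
  show ?thesis
    by (intro bilinearI) (auto simp: smult_add_left smult_add_right smult_smult mult.commute)
qed

section \<open>Gradings\<close>

lemma graded_kspace: "graded_space V \<Longrightarrow> kspace V"
  by (simp add: graded_space_def kspace_iff_module)

locale graded = kspace V for V :: "('k::field, 'a, 'm) dgmod_scheme" (structure) +
  assumes graded_space: "graded_space V"

lemma graded_iff: "graded V \<longleftrightarrow> graded_space V"
  using graded.graded_space graded_kspace graded.intro graded_axioms.intro by blast

lemma sgn_pow_simps [simp]:
  "sgn_pow 0 = 1" "sgn_pow n * sgn_pow n = (1 :: 'k::field)" "sgn_pow n * (sgn_pow n * c) = (c :: 'k)"
  "sgn_pow (- n) = (sgn_pow n :: 'k)" "sgn_pow 1 = (- 1 :: 'k)"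
  by (auto simp: sgn_pow_def)

lemma sgn_pow_add: "sgn_pow (m + n) = (sgn_pow m * sgn_pow n :: 'k::field)"
  by (auto simp: sgn_pow_def)

text \<open>The linear map that is \<open>F j\<close> on the degree \<open>j\<close> part; \<open>ksgn\<close> and the product of a
  tensor product are of this form.\<close>

definition hsum :: "('k::field, 'a, 'm) dgmod_scheme \<Rightarrow> ('k, 'b, 'n) module_scheme
    \<Rightarrow> (int \<Rightarrow> 'a \<Rightarrow> 'b) \<Rightarrow> 'a \<Rightarrow> 'b" where
  "hsum V X F y = finsum X (\<lambda>j. F j (hcomp V j y)) (hsupp V (\<lambda>j. hcomp V j y))"

context graded
begin

lemma gr_subset: "x \<in> gr V i \<Longrightarrow> x \<in> carrier V"
  and gr_zero [simp, intro]: "\<zero> \<in> gr V i"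
  and gr_add: "x \<in> gr V i \<Longrightarrow> y \<in> gr V i \<Longrightarrow> x \<oplus> y \<in> gr V i"
  and gr_smult: "x \<in> gr V i \<Longrightarrow> c \<odot> x \<in> gr V i"
  using graded_space unfolding graded_space_def msubspace_def by blast+

lemma is_decomp_ex1: "v \<in> carrier V \<Longrightarrow> \<exists>!c. is_decomp V v c"
  using graded_space unfolding graded_space_def by blast

lemma is_decomp_hcomp: "v \<in> carrier V \<Longrightarrow> is_decomp V v (\<lambda>i. hcomp V i v)"
  unfolding hcomp_def using theI'[OF is_decomp_ex1] by simp

lemma hcomp_unique: "v \<in> carrier V \<Longrightarrow> is_decomp V v c \<Longrightarrow> hcomp V i v = c i"
  unfolding hcomp_def using the1_equality[OF is_decomp_ex1] by simp

lemma hcomp_gr [simp, intro]: "v \<in> carrier V \<Longrightarrow> hcomp V i v \<in> gr V i"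
  and hcomp_closed [simp, intro]: "v \<in> carrier V \<Longrightarrow> hcomp V i v \<in> carrier V"
  and finite_hsupp [simp, intro]: "v \<in> carrier V \<Longrightarrow> finite (hsupp V (\<lambda>i. hcomp V i v))"
  and finsum_hcomp: "v \<in> carrier V \<Longrightarrow> finsum V (\<lambda>i. hcomp V i v) (hsupp V (\<lambda>i. hcomp V i v)) = v"
  using is_decomp_hcomp[of v] gr_subset unfolding is_decomp_def by auto

lemma is_decompI:
  assumes "\<And>i. c i \<in> gr V i" "finite S" "\<And>i. i \<notin> S \<Longrightarrow> c i = \<zero>" "v = finsum V c S"
  shows "is_decomp V v c"
proof -
  have sub: "hsupp V c \<subseteq> S" using assms(3) by (auto simp: hsupp_def)
  moreover have "finsum V c (hsupp V c) = finsum V c S"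
    using assms(2) sub
    by (intro finsum_superset) (auto simp: hsupp_def intro: gr_subset[OF assms(1)])
  ultimately show ?thesis
    using assms finite_subset unfolding is_decomp_def by auto
qed

lemma hcomp_of_gr: "x \<in> gr V i \<Longrightarrow> hcomp V j x = (if j = i then x else \<zero>)"
proof -
  assume x: "x \<in> gr V i"
  have "is_decomp V x (\<lambda>j. if j = i then x else \<zero>)"
    using x by (intro is_decompI[where S = "{i}"]) (auto simp: gr_subset)
  from hcomp_unique[OF _ this] show ?thesis using x gr_subset by auto
qed

lemma finsum_hcomp_superset:
  assumes "v \<in> carrier V" "finite S" "hsupp V (\<lambda>i. hcomp V i v) \<subseteq> S"
  shows "finsum V (\<lambda>i. hcomp V i v) S = v"
proof -
  have "finsum V (\<lambda>i. hcomp V i v) (hsupp V (\<lambda>i. hcomp V i v)) = finsum V (\<lambda>i. hcomp V i v) S"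
    using assms by (intro finsum_superset) (auto simp: hsupp_def)
  then show ?thesis using assms(1) by (simp add: finsum_hcomp)
qed

text \<open>Linear because homogeneous decompositions are unique.\<close>

lemma hcomp_linear:
  shows hcomp_add: "x \<in> carrier V \<Longrightarrow> y \<in> carrier V \<Longrightarrow> hcomp V i (x \<oplus> y) = hcomp V i x \<oplus> hcomp V i y"
    and hcomp_smult: "x \<in> carrier V \<Longrightarrow> hcomp V i (c \<odot> x) = c \<odot> hcomp V i x"
proof -
  assume x: "x \<in> carrier V"
  have "is_decomp V (c \<odot> x) (\<lambda>i. c \<odot> hcomp V i x)"
  proof (rule is_decompI)
    show "finite (hsupp V (\<lambda>i. hcomp V i x))" using x by (rule finite_hsupp)
    show "c \<odot> x = finsum V (\<lambda>i. c \<odot> hcomp V i x) (hsupp V (\<lambda>i. hcomp V i x))"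
      using x by (simp add: finsum_smult[symmetric] Pi_def finsum_hcomp)
    show "c \<odot> hcomp V i x = \<zero>" if "i \<notin> hsupp V (\<lambda>i. hcomp V i x)" for i
      using that by (simp add: hsupp_def)
  qed (use x in \<open>simp add: gr_smult\<close>)
  then show "hcomp V i (c \<odot> x) = c \<odot> hcomp V i x" using x by (simp add: hcomp_unique)
  assume y: "y \<in> carrier V"
  let ?S = "hsupp V (\<lambda>i. hcomp V i x) \<union> hsupp V (\<lambda>i. hcomp V i y)"
  have "is_decomp V (x \<oplus> y) (\<lambda>i. hcomp V i x \<oplus> hcomp V i y)"
  proof (rule is_decompI[where S = ?S])
    show "x \<oplus> y = finsum V (\<lambda>i. hcomp V i x \<oplus> hcomp V i y) ?S"
      using x y by (simp add: finsum_add Pi_def finsum_hcomp_superset)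
    show "finite ?S" using x y finite_hsupp by simp
    show "hcomp V i x \<oplus> hcomp V i y = \<zero>" if "i \<notin> ?S" for i
      using that by (simp add: hsupp_def)
  qed (use x y in \<open>simp add: gr_add\<close>)
  then show "hcomp V i (x \<oplus> y) = hcomp V i x \<oplus> hcomp V i y" using x y by (simp add: hcomp_unique)
qed

text \<open>Koszul signs are defined through homogeneous components; this rule is what makes them explicit.\<close>

lemma homogeneous_induct [consumes 1, case_names zero add homogeneous]:
  assumes "v \<in> carrier V" "P \<zero>"
    and "\<And>x y. x \<in> carrier V \<Longrightarrow> y \<in> carrier V \<Longrightarrow> P x \<Longrightarrow> P y \<Longrightarrow> P (x \<oplus> y)"
    and "\<And>i x. x \<in> gr V i \<Longrightarrow> P x"
  shows "P v"
proof -
  have "finite S \<Longrightarrow> P (finsum V (\<lambda>i. hcomp V i v) S)" for S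
  proof (induction S rule: finite_induct)
    case (insert i F)
    then show ?case using assms(1) by (auto intro!: assms(3) assms(4)[OF hcomp_gr] simp: Pi_def)
  qed (simp add: assms(2))
  from this[of "hsupp V (\<lambda>i. hcomp V i v)"] show ?thesis using assms(1) by (simp add: finsum_hcomp)
qed

lemma hsum_linear:
  assumes "kspace X" "\<And>j. F j \<in> linear_maps V X"
  shows hsum_closed: "x \<in> carrier V \<Longrightarrow> hsum V X F x \<in> carrier X"
    and hsum_add: "x \<in> carrier V \<Longrightarrow> y \<in> carrier V \<Longrightarrow> hsum V X F (x \<oplus> y) = hsum V X F x \<oplus>\<^bsub>X\<^esub> hsum V X F y"
    and hsum_smult: "x \<in> carrier V \<Longrightarrow> hsum V X F (c \<odot> x) = c \<odot>\<^bsub>X\<^esub> hsum V X F x"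
    and hsum_homogeneous: "x \<in> gr V i \<Longrightarrow> hsum V X F x = F i x"
proof -
  interpret X: kspace X by fact
  note F = linear_closed[OF assms(2)] linear_add[OF assms(2)] linear_smult[OF assms(2)]
    linear_zero[OF kspace_axioms assms]
  have sup: "hsum V X F x = finsum X (\<lambda>j. F j (hcomp V j x)) S"
    if "x \<in> carrier V" "finite S" "hsupp V (\<lambda>j. hcomp V j x) \<subseteq> S" for x S
    unfolding hsum_def using that
    by (intro X.finsum_superset) (auto simp: F hsupp_def)
  { assume x: "x \<in> carrier V"
    then show "hsum V X F x \<in> carrier X" by (auto simp: hsum_def F intro!: X.finsum_closed)
    have "hsupp V (\<lambda>j. hcomp V j (c \<odot> x)) \<subseteq> hsupp V (\<lambda>j. hcomp V j x)"
      using x by (auto simp: hsupp_def hcomp_smult)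
    then show "hsum V X F (c \<odot> x) = c \<odot>\<^bsub>X\<^esub> hsum V X F x"
      using x sup[of "c \<odot> x" "hsupp V (\<lambda>j. hcomp V j x)"]
      by (simp add: hsum_def X.finsum_smult Pi_def F hcomp_smult)
    assume y: "y \<in> carrier V"
    let ?S = "hsupp V (\<lambda>j. hcomp V j x) \<union> hsupp V (\<lambda>j. hcomp V j y)"
    have "hsupp V (\<lambda>j. hcomp V j (x \<oplus> y)) \<subseteq> ?S"
      using x y by (auto simp: hsupp_def hcomp_add)
    then show "hsum V X F (x \<oplus> y) = hsum V X F x \<oplus>\<^bsub>X\<^esub> hsum V X F y"
      using x y sup[of "x \<oplus> y" ?S] sup[of x ?S] sup[of y ?S]
      by (simp add: X.finsum_add Pi_def F hcomp_add)
  }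
  assume x: "x \<in> gr V i"
  then have "hsum V X F x = finsum X (\<lambda>j. F j (hcomp V j x)) {i}"
    by (intro sup) (auto simp: hsupp_def hcomp_of_gr gr_subset)
  then show "hsum V X F x = F i x" using x by (simp add: F hcomp_of_gr gr_subset)
qed

lemma ksgn_eq_hsum: "v \<in> carrier V \<Longrightarrow> ksgn V n v = hsum V V (\<lambda>i. mscale V V (sgn_pow (n * i)) (id_map V)) v"
  by (auto simp: ksgn_def hsum_def mscale_def id_map_def intro!: finsum_cong)

lemma linear_ksgn_component: "mscale V V c (id_map V) \<in> linear_maps V V"
  using kspace_axioms by (intro linear_mscale linear_id_map) 

lemma ksgn_closed [simp, intro]: "x \<in> carrier V \<Longrightarrow> ksgn V n x \<in> carrier V"
  and ksgn_add: "x \<in> carrier V \<Longrightarrow> y \<in> carrier V \<Longrightarrow> ksgn V n (x \<oplus> y) = ksgn V n x \<oplus> ksgn V n y"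
  and ksgn_smult: "x \<in> carrier V \<Longrightarrow> ksgn V n (c \<odot> x) = c \<odot> ksgn V n x"
  and ksgn_homogeneous: "x \<in> gr V i \<Longrightarrow> ksgn V n x = sgn_pow (n * i) \<odot> x"
  using hsum_closed[OF kspace_axioms linear_ksgn_component]
    hsum_add[OF kspace_axioms linear_ksgn_component]
    hsum_smult[OF kspace_axioms linear_ksgn_component]
    hsum_homogeneous[OF kspace_axioms linear_ksgn_component]
  by (simp_all add: ksgn_eq_hsum gr_subset mscale_def id_map_def)

lemma ksgn_zero_degree [simp]: "x \<in> carrier V \<Longrightarrow> ksgn V 0 x = x"
  by (simp add: ksgn_def finsum_hcomp cong: finsum_cong)

lemma ksgn_gr: "x \<in> gr V i \<Longrightarrow> ksgn V n x \<in> gr V i"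
  by (simp add: ksgn_homogeneous gr_smult)

end

text \<open>For the product of a tensor product, which sums over the components of one of its four arguments
  and has to be linear in the three others as well.\<close>

lemma (in graded) hsum_param_add:
  assumes "kspace X" "y \<in> carrier V"
    "\<And>j w. w \<in> carrier V \<Longrightarrow> F j w \<in> carrier X" "\<And>j w. w \<in> carrier V \<Longrightarrow> G j w \<in> carrier X"
    "\<And>j w. w \<in> carrier V \<Longrightarrow> H j w = F j w \<oplus>\<^bsub>X\<^esub> G j w"
  shows "hsum V X H y = hsum V X F y \<oplus>\<^bsub>X\<^esub> hsum V X G y"
proof -
  interpret X: kspace X by fact
  show ?thesis using assms unfolding hsum_def
    by (subst X.finsum_add[symmetric]) (auto intro!: X.finsum_cong')
qed

lemma (in graded) hsum_param_smult:
  assumes "kspace X" "y \<in> carrier V" "\<And>j w. w \<in> carrier V \<Longrightarrow> F j w \<in> carrier X"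
    "\<And>j w. w \<in> carrier V \<Longrightarrow> H j w = c \<odot>\<^bsub>X\<^esub> F j w"
  shows "hsum V X H y = c \<odot>\<^bsub>X\<^esub> hsum V X F y"
proof -
  interpret X: kspace X by fact
  show ?thesis using assms unfolding hsum_def
    by (subst X.finsum_smult) (auto intro!: X.finsum_cong')
qed

section \<open>Tensor products\<close>

lemma lookup_scale [simp]:
  "Poly_Mapping.lookup (Poly_Mapping.map ((*) (c :: 'k::field)) p) k = c * Poly_Mapping.lookup p k"
  by (simp add: Poly_Mapping.map.rep_eq when_def)

lemma scale_simps:
  "Poly_Mapping.map ((*) (c :: 'k::field)) (p + q)
    = Poly_Mapping.map ((*) c) p + Poly_Mapping.map ((*) c) q"
  "Poly_Mapping.map ((*) c) (p - q) = Poly_Mapping.map ((*) c) p - Poly_Mapping.map ((*) c) q"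
  "Poly_Mapping.map ((*) (c + d)) p = Poly_Mapping.map ((*) c) p + Poly_Mapping.map ((*) d) p"
  "Poly_Mapping.map ((*) c) (Poly_Mapping.map ((*) d) p) = Poly_Mapping.map ((*) (c * d)) p"
  "Poly_Mapping.map ((*) 1) p = p"
  "Poly_Mapping.map ((*) c) (0 :: _ \<Rightarrow>\<^sub>0 'k) = 0"
  "Poly_Mapping.map ((*) (- 1)) p = - p"
  "Poly_Mapping.map ((*) c) (Poly_Mapping.single x d) = Poly_Mapping.single x (c * d)"
  by (auto intro!: poly_mapping_eqI simp: lookup_add lookup_minus lookup_single algebra_simps when_def)

lemma keys_scale: "Poly_Mapping.keys (Poly_Mapping.map ((*) (c :: 'k::field)) p) \<subseteq> Poly_Mapping.keys p"
  by (auto simp: in_keys_iff)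

lemma keys_sub: "Poly_Mapping.keys (p - q) \<subseteq> Poly_Mapping.keys p \<union> Poly_Mapping.keys (q :: 'a \<Rightarrow>\<^sub>0 'k::field)"
  by (auto simp: in_keys_iff lookup_minus)

text \<open>Every tensor is represented by a finite combination of pairs; this is the induction over such combinations.\<close>

lemma finite_combination_induct [consumes 1, case_names zero add single]:
  fixes p :: "'a \<Rightarrow>\<^sub>0 'k::field"
  assumes "Poly_Mapping.keys p \<subseteq> S" "P 0"
    and "\<And>p q. Poly_Mapping.keys p \<subseteq> S \<Longrightarrow> Poly_Mapping.keys q \<subseteq> S \<Longrightarrow> P p \<Longrightarrow> P q \<Longrightarrow> P (p + q)"
    and "\<And>k c. k \<in> S \<Longrightarrow> P (Poly_Mapping.single k c)"
  shows "P p"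
  using assms(1)
proof (induction "card (Poly_Mapping.keys p)" arbitrary: p)
  case 0
  then show ?case using assms(2) by simp
next
  case (Suc n)
  then obtain k where k: "k \<in> Poly_Mapping.keys p" by (metis card.empty ex_in_conv nat.simps(3))
  define q where "q = p - Poly_Mapping.single k (Poly_Mapping.lookup p k)"
  have keys: "Poly_Mapping.keys q = Poly_Mapping.keys p - {k}"
    by (auto simp: q_def in_keys_iff lookup_minus lookup_single when_def split: if_splits)
  have "P q" using Suc.hyps(2) Suc.prems k by (intro Suc.hyps(1)) (auto simp: keys card_Diff_singleton)
  moreover have "P (Poly_Mapping.single k (Poly_Mapping.lookup p k))" using Suc k by (auto intro: assms(4))
  moreover have "p = q + Poly_Mapping.single k (Poly_Mapping.lookup p k)" by (simp add: q_def)
  moreover have "Poly_Mapping.keys q \<subseteq> S"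
    "Poly_Mapping.keys (Poly_Mapping.single k (Poly_Mapping.lookup p k)) \<subseteq> S"
    using Suc.prems k by (auto simp: keys)
  ultimately show ?case using assms(3) by metis
qed

lemma UN_eq_const: "a \<in> A \<Longrightarrow> (\<And>x. x \<in> A \<Longrightarrow> F x = C) \<Longrightarrow> (\<Union>x\<in>A. F x) = C"
  by auto

lemma tensor_simps [simp]:
  "carrier (tensor V W) = carrier (tspace V W)" "zero (tensor V W) = zero (tspace V W)"
  "add (tensor V W) = add (tspace V W)" "smult (tensor V W) = smult (tspace V W)"
  "gr (tensor V W) = gr (tspace V W)"
  by (simp_all add: tensor_def)

lemma linear_maps_tensor [simp]:
  "linear_maps (tensor V W) X = linear_maps (tspace V W) X"
  "linear_maps X (tensor V W) = linear_maps X (tspace V W)"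
  by (simp_all add: linear_maps_def)

lemma bilinear_tensor [simp]:
  "bilinear U U' (tensor V W) \<phi> = bilinear U U' (tspace V W) \<phi>"
  "bilinear (tensor V W) U X \<phi> = bilinear (tspace V W) U X \<phi>"
  "bilinear U (tensor V W) X \<phi> = bilinear U (tspace V W) X \<phi>"
  by (simp_all add: bilinear_def)

locale kspace_pair = V: kspace V + W: kspace W
  for V :: "('k::field, 'a, 'm) dgmod_scheme" and W :: "('k, 'b, 'n) dgmod_scheme"
begin

text \<open>The relations mention only elements of the carriers. So every representative of a tensor is a
  combination of pairs from the carriers, whichever one is chosen.\<close>

lemma trel_keys: "p \<in> trel V W \<Longrightarrow> Poly_Mapping.keys p \<subseteq> carrier V \<times> carrier W"
proof (induction rule: trel.induct)
  case (add p q)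
  then show ?case using Poly_Mapping.keys_add[of p q] by blast
next
  case (scale p c)
  then show ?case using keys_scale[of c p] by blast
qed (auto simp: in_keys_iff lookup_minus lookup_single when_def split: if_splits)

lemma trel_diff: "p \<in> trel V W \<Longrightarrow> q \<in> trel V W \<Longrightarrow> p - q \<in> trel V W"
  using trel.add[of p V W "- q"] trel.scale[of q V W "- 1"] by (simp add: scale_simps)

lemma tcls_eq_iff: "tcls V W p = tcls V W q \<longleftrightarrow> p - q \<in> trel V W"
proof
  assume "tcls V W p = tcls V W q"
  moreover have "p \<in> tcls V W p" by (simp add: tcls_def trel.zero)
  ultimately show "p - q \<in> trel V W" by (simp add: tcls_def)
next
  assume pq: "p - q \<in> trel V W"
  show "tcls V W p = tcls V W q"
  proof (intro Set.set_eqI)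
    fix r
    have "r - q = (r - p) + (p - q)" "r - p = (r - q) - (p - q)" by simp_all
    then show "r \<in> tcls V W p \<longleftrightarrow> r \<in> tcls V W q"
      unfolding tcls_def mem_Collect_eq by (metis pq trel.add trel_diff)
  qed
qed

lemma tcls_self: "p \<in> tcls V W p"
  by (simp add: tcls_def trel.zero)

lemma tspace_zero: "\<zero>\<^bsub>tspace V W\<^esub> = tcls V W 0"
  by (simp add: tspace_def)

lemma tspace_add: "tcls V W p \<oplus>\<^bsub>tspace V W\<^esub> tcls V W q = tcls V W (p + q)"
proof -
  have "tcls V W (p' + q') = tcls V W (p + q)" if "p' \<in> tcls V W p" "q' \<in> tcls V W q" for p' q'
  proof -
    have "(p' - p) + (q' - q) \<in> trel V W" using that by (auto simp: tcls_def intro: trel.add)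
    moreover have "(p' - p) + (q' - q) = (p' + q') - (p + q)" by simp
    ultimately show ?thesis by (simp only: tcls_eq_iff)
  qed
  then have "(\<Union>p'\<in>tcls V W p. \<Union>q'\<in>tcls V W q. tcls V W (p' + q')) = tcls V W (p + q)"
    by (intro UN_eq_const[OF tcls_self])
  then show ?thesis by (simp add: tspace_def)
qed

lemma tspace_smult: "c \<odot>\<^bsub>tspace V W\<^esub> tcls V W p = tcls V W (Poly_Mapping.map ((*) c) p)"
proof -
  have "tcls V W (Poly_Mapping.map ((*) c) p') = tcls V W (Poly_Mapping.map ((*) c) p)"
    if "p' \<in> tcls V W p" for p'
    using that trel.scale[of "p' - p" V W c] by (simp add: tcls_eq_iff) (simp add: tcls_def scale_simps)
  then have "(\<Union>p'\<in>tcls V W p. tcls V W (Poly_Mapping.map ((*) c) p')) = tcls V W (Poly_Mapping.map ((*) c) p)"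
    by (intro UN_eq_const[OF tcls_self])
  then show ?thesis by (simp add: tspace_def)
qed

lemma tspace_carrier: "t \<in> carrier (tspace V W) \<longleftrightarrow>
    (\<exists>p. t = tcls V W p \<and> Poly_Mapping.keys p \<subseteq> carrier V \<times> carrier W)"
  by (auto simp: tspace_def tfree_def)

lemma tcls_carrier [intro]:
  "Poly_Mapping.keys p \<subseteq> carrier V \<times> carrier W \<Longrightarrow> tcls V W p \<in> carrier (tspace V W)"
  using tspace_carrier by blast

lemma kspace_tspace: "kspace (tspace V W)"
proof (intro kspace.intro kspace_axioms.intro abelian_groupI)
  note [simp] = tspace_add tspace_smult tspace_zero
  fix x y assume "x \<in> carrier (tspace V W)" "y \<in> carrier (tspace V W)"
  then obtain p q where pq: "x = tcls V W p" "Poly_Mapping.keys p \<subseteq> carrier V \<times> carrier W"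
    "y = tcls V W q" "Poly_Mapping.keys q \<subseteq> carrier V \<times> carrier W"
    by (auto simp: tspace_carrier)
  then show "x \<oplus>\<^bsub>tspace V W\<^esub> y \<in> carrier (tspace V W)"
    using Poly_Mapping.keys_add[of p q] by (auto intro!: tcls_carrier)
  show "x \<oplus>\<^bsub>tspace V W\<^esub> y = y \<oplus>\<^bsub>tspace V W\<^esub> x" using pq by (simp add: add.commute)
  show "c \<odot>\<^bsub>tspace V W\<^esub> (x \<oplus>\<^bsub>tspace V W\<^esub> y) = c \<odot>\<^bsub>tspace V W\<^esub> x \<oplus>\<^bsub>tspace V W\<^esub> c \<odot>\<^bsub>tspace V W\<^esub> y" for c
    using pq by (simp add: scale_simps)
next
  fix x y z assume "x \<in> carrier (tspace V W)" "y \<in> carrier (tspace V W)" "z \<in> carrier (tspace V W)"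
  then show "x \<oplus>\<^bsub>tspace V W\<^esub> y \<oplus>\<^bsub>tspace V W\<^esub> z = x \<oplus>\<^bsub>tspace V W\<^esub> (y \<oplus>\<^bsub>tspace V W\<^esub> z)"
    by (auto simp: tspace_carrier tspace_add add.assoc)
next
  show "\<zero>\<^bsub>tspace V W\<^esub> \<in> carrier (tspace V W)" by (auto simp: tspace_zero)
next
  note [simp] = tspace_add tspace_smult tspace_zero
  fix x assume "x \<in> carrier (tspace V W)"
  then obtain p where p: "x = tcls V W p" "Poly_Mapping.keys p \<subseteq> carrier V \<times> carrier W"
    by (auto simp: tspace_carrier)
  show "\<zero>\<^bsub>tspace V W\<^esub> \<oplus>\<^bsub>tspace V W\<^esub> x = x" using p by simp
  have "tcls V W (- p) \<in> carrier (tspace V W)" using p by (intro tcls_carrier) (auto simp: in_keys_iff)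
  then show "\<exists>y\<in>carrier (tspace V W). y \<oplus>\<^bsub>tspace V W\<^esub> x = \<zero>\<^bsub>tspace V W\<^esub>"
    using p by (intro bexI[of _ "tcls V W (- p)"]) simp_all
  fix c d :: 'k
  show "c \<odot>\<^bsub>tspace V W\<^esub> x \<in> carrier (tspace V W)"
    using p keys_scale[of c p] by (auto intro!: tcls_carrier)
  show "(c + d) \<odot>\<^bsub>tspace V W\<^esub> x = c \<odot>\<^bsub>tspace V W\<^esub> x \<oplus>\<^bsub>tspace V W\<^esub> d \<odot>\<^bsub>tspace V W\<^esub> x"
    using p by (simp add: scale_simps)
  show "c \<odot>\<^bsub>tspace V W\<^esub> (d \<odot>\<^bsub>tspace V W\<^esub> x) = (c * d) \<odot>\<^bsub>tspace V W\<^esub> x"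
    using p by (simp add: scale_simps)
  show "1 \<odot>\<^bsub>tspace V W\<^esub> x = x" using p by (simp add: scale_simps)
qed

lemma bilinear_tens: "bilinear V W (tspace V W) (tens V W)"
proof (rule bilinearI)
  show "tens V W x y \<in> carrier (tspace V W)" if "x \<in> carrier V" "y \<in> carrier W" for x y
    unfolding tens_def using that by (intro tcls_carrier) auto
qed (auto simp: tens_def tspace_add tspace_smult tcls_eq_iff scale_simps diff_diff_eq[symmetric]
    intro: trel.intros)

lemmas tens_closed [simp, intro] = bilinearD(1)[OF bilinear_tens]

lemma tcls_single:
  "x \<in> carrier V \<Longrightarrow> y \<in> carrier W \<Longrightarrow> tcls V W (Poly_Mapping.single (x, y) c) = tens V W (c \<odot>\<^bsub>V\<^esub> x) y"
  by (simp add: bilinearD(4)[OF bilinear_tens]) (simp add: tens_def tspace_smult scale_simps)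

lemma tens_induct [consumes 1, case_names zero add tens]:
  assumes "t \<in> carrier (tspace V W)" "P \<zero>\<^bsub>tspace V W\<^esub>"
    and "\<And>s t. s \<in> carrier (tspace V W) \<Longrightarrow> t \<in> carrier (tspace V W) \<Longrightarrow> P s \<Longrightarrow> P t
      \<Longrightarrow> P (s \<oplus>\<^bsub>tspace V W\<^esub> t)"
    and "\<And>x y. x \<in> carrier V \<Longrightarrow> y \<in> carrier W \<Longrightarrow> P (tens V W x y)"
  shows "P t"
proof -
  obtain p where t: "t = tcls V W p" and p: "Poly_Mapping.keys p \<subseteq> carrier V \<times> carrier W"
    using assms(1) by (auto simp: tspace_carrier)
  have "P (tcls V W p)" using p
  proof (induction p rule: finite_combination_induct)
    case (add p q)
    then show ?case using assms(3)[of "tcls V W p" "tcls V W q"] by (simp add: tspace_add tcls_carrier)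
  next
    case (single k c)
    then show ?case by (cases k) (auto simp: tcls_single intro!: assms(4))
  qed (use assms(2) in \<open>simp add: tspace_zero\<close>)
  then show ?thesis using t by simp
qed

text \<open>The universal property: a bilinear map kills the relations, so its value on a coset does not
  depend on the representative that \<^const>\<open>tlift\<close> chooses.\<close>

context
  fixes X :: "('k, 'c, 'p) dgmod_scheme" and \<phi>
  assumes X: "kspace X" and bil: "bilinear V W X \<phi>"
begin

interpretation X: kspace X by (rule X)

private definition tsum where
  "tsum p = finsum X (\<lambda>(x, y). Poly_Mapping.lookup p (x, y) \<odot>\<^bsub>X\<^esub> \<phi> x y) (Poly_Mapping.keys p)"

private lemma tsum_superset:
  assumes "finite S" "Poly_Mapping.keys p \<subseteq> S" "S \<subseteq> carrier V \<times> carrier W"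
  shows "tsum p = finsum X (\<lambda>(x, y). Poly_Mapping.lookup p (x, y) \<odot>\<^bsub>X\<^esub> \<phi> x y) S"
proof -
  have "\<phi> x y \<in> carrier X" if "(x, y) \<in> S" for x y
    using that assms(3) bilinearD(1)[OF bil] by blast
  then show ?thesis
    unfolding tsum_def using assms(1,2)
    by (intro X.finsum_superset) (auto simp: in_keys_iff)
qed

private lemma tsum_closed:
  "Poly_Mapping.keys p \<subseteq> carrier V \<times> carrier W \<Longrightarrow> tsum p \<in> carrier X"
  unfolding tsum_def by (intro X.finsum_closed) (auto intro!: X.smult_closed bilinearD[OF bil])

private lemma tsum_add:
  assumes "Poly_Mapping.keys p \<subseteq> carrier V \<times> carrier W" "Poly_Mapping.keys q \<subseteq> carrier V \<times> carrier W"
  shows "tsum (p + q) = tsum p \<oplus>\<^bsub>X\<^esub> tsum q"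
proof -
  let ?S = "Poly_Mapping.keys p \<union> Poly_Mapping.keys q"
  have S: "finite ?S" "?S \<subseteq> carrier V \<times> carrier W" using assms by auto
  have phi: "x \<in> carrier V" "y \<in> carrier W" "\<phi> x y \<in> carrier X" if "(x, y) \<in> ?S" for x y
    using that S bilinearD(1)[OF bil] by blast+
  have "tsum (p + q) = finsum X (\<lambda>(x, y). Poly_Mapping.lookup (p + q) (x, y) \<odot>\<^bsub>X\<^esub> \<phi> x y) ?S"
    using S Poly_Mapping.keys_add[of p q] by (intro tsum_superset) auto
  also have "\<dots> = finsum X (\<lambda>k. (case k of (x, y) \<Rightarrow> Poly_Mapping.lookup p (x, y) \<odot>\<^bsub>X\<^esub> \<phi> x y)
      \<oplus>\<^bsub>X\<^esub> (case k of (x, y) \<Rightarrow> Poly_Mapping.lookup q (x, y) \<odot>\<^bsub>X\<^esub> \<phi> x y)) ?S"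
    by (rule X.finsum_cong') (use phi in \<open>auto simp: lookup_add X.smult_add_left\<close>)
  also have "\<dots> = tsum p \<oplus>\<^bsub>X\<^esub> tsum q"
    using S tsum_superset[of ?S p] tsum_superset[of ?S q]
    by (subst X.finsum_add) (use phi in auto)
  finally show ?thesis .
qed

private lemma tsum_scale:
  assumes "Poly_Mapping.keys p \<subseteq> carrier V \<times> carrier W"
  shows "tsum (Poly_Mapping.map ((*) c) p) = c \<odot>\<^bsub>X\<^esub> tsum p"
proof -
  let ?S = "Poly_Mapping.keys p"
  have S: "finite ?S" "?S \<subseteq> carrier V \<times> carrier W" using assms by auto
  have phi: "x \<in> carrier V" "y \<in> carrier W" "\<phi> x y \<in> carrier X" if "(x, y) \<in> ?S" for x y
    using that S bilinearD(1)[OF bil] by blast+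
  have "tsum (Poly_Mapping.map ((*) c) p)
      = finsum X (\<lambda>(x, y). Poly_Mapping.lookup (Poly_Mapping.map ((*) c) p) (x, y) \<odot>\<^bsub>X\<^esub> \<phi> x y) ?S"
    using S keys_scale[of c p] by (intro tsum_superset) auto
  also have "\<dots> = finsum X (\<lambda>k. c \<odot>\<^bsub>X\<^esub> (case k of (x, y) \<Rightarrow> Poly_Mapping.lookup p (x, y) \<odot>\<^bsub>X\<^esub> \<phi> x y)) ?S"
    by (rule X.finsum_cong') (use phi in \<open>auto simp: X.smult_smult\<close>)
  also have "\<dots> = c \<odot>\<^bsub>X\<^esub> tsum p"
    unfolding tsum_def by (subst X.finsum_smult) (use phi in auto)
  finally show ?thesis .
qed

private lemma tsum_single:
  "x \<in> carrier V \<Longrightarrow> y \<in> carrier W \<Longrightarrow> tsum (Poly_Mapping.single (x, y) c) = c \<odot>\<^bsub>X\<^esub> \<phi> x y"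
  by (subst tsum_superset[where S = "{(x, y)}"]) (use bilinearD(1)[OF bil, of x y] in auto)

private lemma tsum_diff:
  assumes "Poly_Mapping.keys p \<subseteq> carrier V \<times> carrier W" "Poly_Mapping.keys q \<subseteq> carrier V \<times> carrier W"
  shows "tsum (p - q) = tsum p \<ominus>\<^bsub>X\<^esub> tsum q"
proof -
  have keys: "Poly_Mapping.keys (Poly_Mapping.map ((*) (- 1)) q) \<subseteq> carrier V \<times> carrier W"
    using assms(2) keys_scale[of "- 1" q] by (rule order_trans[rotated])
  have "tsum (p - q) = tsum (p + Poly_Mapping.map ((*) (- 1)) q)" by (simp add: scale_simps)
  also have "\<dots> = tsum p \<oplus>\<^bsub>X\<^esub> (- 1) \<odot>\<^bsub>X\<^esub> tsum q"
    using tsum_add[OF assms(1) keys] tsum_scale[OF assms(2), of "- 1"] by metis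
  also have "\<dots> = tsum p \<ominus>\<^bsub>X\<^esub> tsum q"
    using X.minus_eq_smult[OF tsum_closed[OF assms(2)]] by (simp add: a_minus_def)
  finally show ?thesis .
qed

private lemma tsum_diff3:
  assumes "Poly_Mapping.keys p \<subseteq> carrier V \<times> carrier W" "Poly_Mapping.keys q \<subseteq> carrier V \<times> carrier W"
    "Poly_Mapping.keys r \<subseteq> carrier V \<times> carrier W"
  shows "tsum (p - q - r) = tsum p \<ominus>\<^bsub>X\<^esub> tsum q \<ominus>\<^bsub>X\<^esub> tsum r"
  using assms keys_sub[of p q] by (subst tsum_diff) (auto simp: tsum_diff)

private lemma cancel: "u \<in> carrier X \<Longrightarrow> v \<in> carrier X \<Longrightarrow> u \<oplus>\<^bsub>X\<^esub> v \<ominus>\<^bsub>X\<^esub> u \<ominus>\<^bsub>X\<^esub> v = \<zero>\<^bsub>X\<^esub>"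
  by (simp add: a_minus_def X.a_assoc X.a_lcomm[of v] X.r_neg X.a_comm[of v])

private lemma tsum_trel: "p \<in> trel V W \<Longrightarrow> tsum p = \<zero>\<^bsub>X\<^esub>"
proof (induction rule: trel.induct)
  case zero
  then show ?case by (simp add: tsum_def)
next
  case (add p q)
  then show ?case by (simp add: tsum_add trel_keys)
next
  case (scale p c)
  then show ?case by (simp add: tsum_scale trel_keys)
next
  case (add_left x x' y)
  then show ?case
    by (simp add: tsum_diff3 tsum_single bilinearD[OF bil] cancel)
next
  case (add_right x y y')
  then show ?case
    by (simp add: tsum_diff3 tsum_single bilinearD[OF bil] cancel)
next
  case (scale_left x y c)
  then show ?case
    by (subst tsum_diff) (auto simp: tsum_single bilinearD[OF bil] X.minus_eq X.r_neg)
next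
  case (scale_right x y c)
  then show ?case
    by (subst tsum_diff) (auto simp: tsum_single bilinearD[OF bil] X.minus_eq X.r_neg)
qed

private lemma tlift_tcls:
  assumes p: "Poly_Mapping.keys p \<subseteq> carrier V \<times> carrier W"
  shows "tlift V W X \<phi> (tcls V W p) = tsum p"
proof -
  define r where "r = (SOME r. r \<in> tcls V W p)"
  have "r \<in> tcls V W p" unfolding r_def using tcls_self by (rule someI)
  then have rel: "r - p \<in> trel V W" by (simp add: tcls_def)
  moreover have "r = p + (r - p)" by simp
  ultimately have "tsum r = tsum p \<oplus>\<^bsub>X\<^esub> \<zero>\<^bsub>X\<^esub>"
    using p by (metis tsum_add tsum_trel trel_keys)
  then have "tsum r = tsum p" using p by (simp add: tsum_closed)
  then show ?thesis
    using p tcls_carrier by (simp add: tlift_def r_def[symmetric] tsum_def Let_def)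
qed

lemma tlift_tens [simp]: "x \<in> carrier V \<Longrightarrow> y \<in> carrier W \<Longrightarrow> tlift V W X \<phi> (tens V W x y) = \<phi> x y"
  by (simp add: tens_def tlift_tcls tsum_single bilinearD[OF bil])

lemma linear_tlift: "tlift V W X \<phi> \<in> linear_maps (tspace V W) X"
proof (rule linear_mapsI)
  show "tlift V W X \<phi> x = undefined" if "x \<notin> carrier (tspace V W)" for x
    using that by (simp add: tlift_def)
next
  fix x y assume "x \<in> carrier (tspace V W)" "y \<in> carrier (tspace V W)"
  then obtain p q where pq: "x = tcls V W p" "Poly_Mapping.keys p \<subseteq> carrier V \<times> carrier W"
    "y = tcls V W q" "Poly_Mapping.keys q \<subseteq> carrier V \<times> carrier W"
    by (auto simp: tspace_carrier)
  moreover have "Poly_Mapping.keys (p + q) \<subseteq> carrier V \<times> carrier W"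
    using pq Poly_Mapping.keys_add[of p q] by blast
  ultimately show "tlift V W X \<phi> (x \<oplus>\<^bsub>tspace V W\<^esub> y) = tlift V W X \<phi> x \<oplus>\<^bsub>X\<^esub> tlift V W X \<phi> y"
    by (simp add: tspace_add tlift_tcls tsum_add)
next
  fix c x assume "x \<in> carrier (tspace V W)"
  then obtain p where p: "x = tcls V W p" "Poly_Mapping.keys p \<subseteq> carrier V \<times> carrier W"
    by (auto simp: tspace_carrier)
  from p(2) have "Poly_Mapping.keys (Poly_Mapping.map ((*) c) p) \<subseteq> carrier V \<times> carrier W"
    using keys_scale[of c p] by (rule order_trans[rotated])
  then show "tlift V W X \<phi> (c \<odot>\<^bsub>tspace V W\<^esub> x) = c \<odot>\<^bsub>X\<^esub> tlift V W X \<phi> x"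
    using p by (simp add: tspace_smult tlift_tcls tsum_scale)
  show "tlift V W X \<phi> x \<in> carrier X" using p by (simp add: tlift_tcls tsum_closed)
qed

end

lemma linear_eq_on_tens:
  assumes "kspace X" "f \<in> linear_maps (tspace V W) X" "g \<in> linear_maps (tspace V W) X"
    "\<And>x y. x \<in> carrier V \<Longrightarrow> y \<in> carrier W \<Longrightarrow> f (tens V W x y) = g (tens V W x y)"
    and t: "t \<in> carrier (tspace V W)"
  shows "f t = g t"
  using t
  by (induction rule: tens_induct)
    (use assms linear_zero[OF kspace_tspace assms(1,2)] linear_zero[OF kspace_tspace assms(1,3)]
      in \<open>auto simp: linear_add\<close>)

end

lemma kspace_tensor:
  assumes "kspace V" "kspace W"
  shows "kspace (tensor V W)"
proof -
  interpret kspace_pair V W using assms by (simp add: kspace_pair_def)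
  from kspace_tspace interpret T: kspace "tspace V W" .
  show ?thesis
    by (intro kspace.intro kspace_axioms.intro abelian_groupI)
      (auto simp: T.a_ac T.smult_add_left T.smult_add_right T.smult_smult
        intro: T.add.l_inv_ex)
qed

lemma a_minus_tensor [simp]: "a_minus (tensor V W) = a_minus (tspace V W)"
  by (simp add: a_minus_def a_inv_def fun_eq_iff m_inv_def)

locale graded_pair = V: graded V + W: graded W
  for V :: "('k::field, 'a, 'm) dgmod_scheme" and W :: "('k, 'b, 'n) dgmod_scheme"
begin

sublocale kspace_pair V W ..

lemma tspace_gr: "t \<in> gr (tspace V W) n \<longleftrightarrow>
    (\<exists>p. t = tcls V W p \<and> Poly_Mapping.keys p \<subseteq> (\<Union>i. gr V i \<times> gr W (n - i)))"
  by (auto simp: tspace_def)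

lemma tens_gr_induct [consumes 1, case_names zero add tens]:
  assumes "t \<in> gr (tspace V W) n" "P \<zero>\<^bsub>tspace V W\<^esub>"
    and "\<And>s t. s \<in> carrier (tspace V W) \<Longrightarrow> t \<in> carrier (tspace V W) \<Longrightarrow> P s \<Longrightarrow> P t
      \<Longrightarrow> P (s \<oplus>\<^bsub>tspace V W\<^esub> t)"
    and "\<And>i x y. x \<in> gr V i \<Longrightarrow> y \<in> gr W (n - i) \<Longrightarrow> P (tens V W x y)"
  shows "P t"
proof -
  let ?S = "\<Union>i. gr V i \<times> gr W (n - i)"
  have S: "?S \<subseteq> carrier V \<times> carrier W" by (auto simp: V.gr_subset W.gr_subset)
  obtain p where t: "t = tcls V W p" and p: "Poly_Mapping.keys p \<subseteq> ?S"
    using assms(1) by (auto simp: tspace_gr)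
  have "P (tcls V W p)" using p
  proof (induction p rule: finite_combination_induct)
    case (add p q)
    then show ?case using assms(3)[of "tcls V W p" "tcls V W q"] S by (simp add: tspace_add tcls_carrier)
  next
    case (single k c)
    then obtain x y i where k: "k = (x, y)" "x \<in> gr V i" "y \<in> gr W (n - i)" by auto
    then have "tcls V W (Poly_Mapping.single k c) = tens V W (c \<odot>\<^bsub>V\<^esub> x) y"
      by (simp add: tcls_single V.gr_subset W.gr_subset)
    then show ?case using k by (simp add: assms(4)[OF V.gr_smult])
  qed (use assms(2) in \<open>simp add: tspace_zero\<close>)
  then show ?thesis using t by simp
qed

text \<open>Expanding both factors into homogeneous components, by bilinearity of \<open>tens\<close>.\<close>

lemma tens_homogeneous_induct [consumes 1, case_names zero add tens]:
  assumes "t \<in> carrier (tspace V W)" "P \<zero>\<^bsub>tspace V W\<^esub>"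
    and add: "\<And>s t. s \<in> carrier (tspace V W) \<Longrightarrow> t \<in> carrier (tspace V W) \<Longrightarrow> P s \<Longrightarrow> P t
      \<Longrightarrow> P (s \<oplus>\<^bsub>tspace V W\<^esub> t)"
    and tens: "\<And>i j x y. x \<in> gr V i \<Longrightarrow> y \<in> gr W j \<Longrightarrow> P (tens V W x y)"
  shows "P t"
  using assms(1)
proof (induction rule: tens_induct)
  note bil = bilinearD[OF bilinear_tens]
  interpret T: kspace "tspace V W" by (rule kspace_tspace)
  have zl: "tens V W \<zero>\<^bsub>V\<^esub> y = \<zero>\<^bsub>tspace V W\<^esub>" if "y \<in> carrier W" for y
    using bil(4)[of "\<zero>\<^bsub>V\<^esub>" y 0] that by simp
  have zr: "tens V W x \<zero>\<^bsub>W\<^esub> = \<zero>\<^bsub>tspace V W\<^esub>" if "x \<in> carrier V" for x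
    using bil(5)[of x "\<zero>\<^bsub>W\<^esub>" 0] that by simp
  case (tens x y)
  from tens(1) show ?case
  proof (induction rule: V.homogeneous_induct)
    case (homogeneous i x)
    from tens(2) show ?case
      by (induction rule: W.homogeneous_induct)
        (use homogeneous in \<open>auto simp: zr V.gr_subset bil assms(2) intro: add assms(4)\<close>)
  qed (use tens in \<open>auto simp: zl bil assms(2) intro: add\<close>)
qed (use assms in auto)

lemma tmap_bilinear:
  assumes "kspace V'" "kspace W'" "f \<in> linear_maps V V'" "g \<in> linear_maps W W'"
  shows "bilinear V W (tspace V' W') (\<lambda>v w. tens V' W' (f (ksgn V n v)) (g w))"
proof -
  interpret P: kspace_pair V' W' using assms by (simp add: kspace_pair_def)
  show ?thesis using assms(3,4)
    by (intro bilinearI)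
      (auto simp: bilinearD[OF P.bilinear_tens] linear_closed linear_add linear_smult V.ksgn_add V.ksgn_smult)
qed

lemma linear_tmap:
  assumes "kspace V'" "kspace W'" "f \<in> linear_maps V V'" "g \<in> linear_maps W W'"
  shows "tmap V W V' W' n f g \<in> linear_maps (tspace V W) (tspace V' W')"
proof -
  interpret P: kspace_pair V' W' using assms by (simp add: kspace_pair_def)
  show ?thesis unfolding tmap_def by (rule linear_tlift[OF P.kspace_tspace tmap_bilinear[OF assms]])
qed

lemma tmap_tens:
  assumes "kspace V'" "kspace W'" "f \<in> linear_maps V V'" "g \<in> linear_maps W W'"
    "v \<in> carrier V" "w \<in> carrier W"
  shows "tmap V W V' W' n f g (tens V W v w) = tens V' W' (f (ksgn V n v)) (g w)"
proof -
  interpret P: kspace_pair V' W' using assms by (simp add: kspace_pair_def)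
  show ?thesis unfolding tmap_def using assms(5,6)
    by (simp add: tlift_tens[OF P.kspace_tspace tmap_bilinear[OF assms(1-4)]])
qed

end

context kspace_pair
begin

text \<open>The induced map depends linearly on the bilinear map. The hypotheses are pointwise on the carriers, so
  that they can be used for bilinear maps that are sums only there.\<close>

lemma tlift_cong:
  assumes "kspace X" "bilinear V W X \<phi>" "bilinear V W X \<psi>"
    "\<And>x y. x \<in> carrier V \<Longrightarrow> y \<in> carrier W \<Longrightarrow> \<phi> x y = \<psi> x y" "t \<in> carrier (tspace V W)"
  shows "tlift V W X \<phi> t = tlift V W X \<psi> t"
  by (rule linear_eq_on_tens[OF assms(1) linear_tlift[OF assms(1,2)] linear_tlift[OF assms(1,3)]])
    (use assms in \<open>simp_all add: tlift_tens\<close>)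

lemma tlift_add:
  assumes X: "kspace X" and \<chi>: "bilinear V W X \<chi>" and \<phi>: "bilinear V W X \<phi>" and \<psi>: "bilinear V W X \<psi>"
    and eq: "\<And>x y. x \<in> carrier V \<Longrightarrow> y \<in> carrier W \<Longrightarrow> \<chi> x y = \<phi> x y \<oplus>\<^bsub>X\<^esub> \<psi> x y"
    and t: "t \<in> carrier (tspace V W)"
  shows "tlift V W X \<chi> t = tlift V W X \<phi> t \<oplus>\<^bsub>X\<^esub> tlift V W X \<psi> t"
proof -
  have "madd (tspace V W) X (tlift V W X \<phi>) (tlift V W X \<psi>) \<in> linear_maps (tspace V W) X"
    by (intro linear_madd linear_tlift kspace_tspace X \<phi> \<psi>)
  then have "tlift V W X \<chi> t = madd (tspace V W) X (tlift V W X \<phi>) (tlift V W X \<psi>) t"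
    by (rule linear_eq_on_tens[OF X linear_tlift[OF X \<chi>]])
      (use t in \<open>simp_all add: eq tlift_tens[OF X \<chi>] tlift_tens[OF X \<phi>] tlift_tens[OF X \<psi>]
        madd_def tens_closed\<close>)
  then show ?thesis using t by (simp add: madd_def)
qed

lemma tlift_smult:
  assumes X: "kspace X" and \<chi>: "bilinear V W X \<chi>" and \<phi>: "bilinear V W X \<phi>"
    and eq: "\<And>x y. x \<in> carrier V \<Longrightarrow> y \<in> carrier W \<Longrightarrow> \<chi> x y = c \<odot>\<^bsub>X\<^esub> \<phi> x y"
    and t: "t \<in> carrier (tspace V W)"
  shows "tlift V W X \<chi> t = c \<odot>\<^bsub>X\<^esub> tlift V W X \<phi> t"
proof -
  have "mscale (tspace V W) X c (tlift V W X \<phi>) \<in> linear_maps (tspace V W) X"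
    by (intro linear_mscale linear_tlift kspace_tspace X \<phi>)
  then have "tlift V W X \<chi> t = mscale (tspace V W) X c (tlift V W X \<phi>) t"
    by (rule linear_eq_on_tens[OF X linear_tlift[OF X \<chi>]])
      (use t in \<open>simp_all add: eq tlift_tens[OF X \<chi>] tlift_tens[OF X \<phi>]
        mscale_def tens_closed\<close>)
  then show ?thesis using t by (simp add: mscale_def)
qed

lemma tlift_diff:
  assumes X: "kspace X" and \<chi>: "bilinear V W X \<chi>" and \<phi>: "bilinear V W X \<phi>" and \<psi>: "bilinear V W X \<psi>"
    and eq: "\<And>x y. x \<in> carrier V \<Longrightarrow> y \<in> carrier W \<Longrightarrow> \<chi> x y = \<phi> x y \<ominus>\<^bsub>X\<^esub> \<psi> x y"
    and t: "t \<in> carrier (tspace V W)"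
  shows "tlift V W X \<chi> t = tlift V W X \<phi> t \<ominus>\<^bsub>X\<^esub> tlift V W X \<psi> t"
proof -
  have "msub (tspace V W) X (tlift V W X \<phi>) (tlift V W X \<psi>) \<in> linear_maps (tspace V W) X"
    by (intro linear_msub linear_tlift kspace_tspace X \<phi> \<psi>)
  then have "tlift V W X \<chi> t = msub (tspace V W) X (tlift V W X \<phi>) (tlift V W X \<psi>) t"
    by (rule linear_eq_on_tens[OF X linear_tlift[OF X \<chi>]])
      (use t in \<open>simp_all add: eq tlift_tens[OF X \<chi>] tlift_tens[OF X \<phi>] tlift_tens[OF X \<psi>]
        msub_def tens_closed\<close>)
  then show ?thesis using t by (simp add: msub_def)
qed

lemma linear_tlift_apply:
  assumes X: "kspace X" and Y: "kspace Y" and bil: "bilinear V W X \<phi>" and h: "h \<in> linear_maps X Y"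
    and t: "t \<in> carrier (tspace V W)"
  shows "h (tlift V W X \<phi> t) = tlift V W Y (\<lambda>x y. h (\<phi> x y)) t"
proof -
  have lin: "compose (carrier (tspace V W)) h (tlift V W X \<phi>) \<in> linear_maps (tspace V W) Y"
    by (intro linear_compose[OF kspace_tspace linear_tlift[OF X bil] h])
  have "compose (carrier (tspace V W)) h (tlift V W X \<phi>) t = tlift V W Y (\<lambda>x y. h (\<phi> x y)) t"
    by (rule linear_eq_on_tens[OF Y lin])
      (use X Y bil t h in \<open>auto intro!: linear_compose[OF kspace_tspace] linear_tlift simp: tlift_tens linear_o_bilinear compose_def tens_closed\<close>)
  then show ?thesis using t by (simp add: compose_def)
qed

end

lemma (in graded_pair) bilinear_eq_on_homogeneous_tens:
  assumes X: "kspace X"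
    and \<phi>: "bilinear (tspace V W) (tspace V W) X \<phi>" and \<psi>: "bilinear (tspace V W) (tspace V W) X \<psi>"
    and eq: "\<And>i j k l x y x' y'. x \<in> gr V i \<Longrightarrow> y \<in> gr W j \<Longrightarrow> x' \<in> gr V k \<Longrightarrow> y' \<in> gr W l \<Longrightarrow>
      \<phi> (tens V W x y) (tens V W x' y') = \<psi> (tens V W x y) (tens V W x' y')"
    and s: "s \<in> carrier (tspace V W)" and t: "t \<in> carrier (tspace V W)"
  shows "\<phi> s t = \<psi> s t"
proof -
  interpret T: kspace "tspace V W" by (rule kspace_tspace)
  interpret X: kspace X by (rule X)
  have zero: "\<chi> \<zero>\<^bsub>tspace V W\<^esub> u = \<zero>\<^bsub>X\<^esub>" "\<chi> u \<zero>\<^bsub>tspace V W\<^esub> = \<zero>\<^bsub>X\<^esub>"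
    if "bilinear (tspace V W) (tspace V W) X \<chi>" "u \<in> carrier (tspace V W)" for \<chi> u
    using bilinearD(4)[OF that(1) T.zero_closed that(2), of 0]
      bilinearD(5)[OF that(1) that(2) T.zero_closed, of 0] bilinearD(1)[OF that(1)] that(2) by auto
  from s show ?thesis
  proof (induction rule: tens_homogeneous_induct)
    case (tens i j x y)
    then have xy: "tens V W x y \<in> carrier (tspace V W)" using V.gr_subset W.gr_subset by auto
    from t show ?case
      by (induction rule: tens_homogeneous_induct)
        (use tens eq xy in \<open>auto simp: zero[OF \<phi>] zero[OF \<psi>] bilinearD[OF \<phi>] bilinearD[OF \<psi>]\<close>)
  qed (use t in \<open>auto simp: zero[OF \<phi>] zero[OF \<psi>] bilinearD[OF \<phi>] bilinearD[OF \<psi>]\<close>)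
qed

section \<open>Complexes of graded maps\<close>

lemma HomI: "f \<in> linear_maps V W \<Longrightarrow> (\<And>i x. x \<in> gr V i \<Longrightarrow> f x \<in> gr W (i + n)) \<Longrightarrow> f \<in> Hom V W n"
  by (simp add: Hom_def)

lemma HomD:
  assumes "f \<in> Hom V W n"
  shows Hom_linear: "f \<in> linear_maps V W" and Hom_gr: "\<And>i x. x \<in> gr V i \<Longrightarrow> f x \<in> gr W (i + n)"
  using assms by (auto simp: Hom_def)

lemmas Hom_closed = linear_closed[OF Hom_linear]

locale dgspace = graded V for V :: "('k::field, 'a, 'm) dgmod_scheme" (structure) +
  assumes dg_space: "dg_space V"
begin

lemma dd_Hom: "dd V \<in> Hom V V 1"
  using dg_space by (simp add: dg_space_def)

lemma dd_linear: "dd V \<in> linear_maps V V"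
  using dd_Hom by (rule Hom_linear)

lemma dd_closed [simp, intro]: "x \<in> carrier V \<Longrightarrow> dd V x \<in> carrier V"
  and dd_add: "x \<in> carrier V \<Longrightarrow> y \<in> carrier V \<Longrightarrow> dd V (x \<oplus> y) = dd V x \<oplus> dd V y"
  and dd_smult: "x \<in> carrier V \<Longrightarrow> dd V (c \<odot> x) = c \<odot> dd V x"
  and dd_zero [simp]: "dd V \<zero> = \<zero>"
  using dd_linear linear_zero[OF kspace_axioms kspace_axioms dd_linear]
  by (auto simp: linear_closed linear_add linear_smult)

lemma dd_gr: "x \<in> gr V i \<Longrightarrow> dd V x \<in> gr V (i + 1)"
  using dd_Hom by (rule Hom_gr)

end

locale dg_pair = V: dgspace V + W: dgspace W
  for V :: "('k::field, 'a, 'm) dgmod_scheme" and W :: "('k, 'b, 'n) dgmod_scheme"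
begin

lemma zmap_Hom: "zmap V W \<in> Hom V W n"
  by (rule HomI[OF linear_zmap]) (auto simp: zmap_def V.gr_subset V.kspace_axioms W.kspace_axioms)

lemma madd_Hom: "f \<in> Hom V W n \<Longrightarrow> g \<in> Hom V W n \<Longrightarrow> madd V W f g \<in> Hom V W n"
  by (rule HomI[OF linear_madd])
    (auto simp: madd_def V.gr_subset V.kspace_axioms W.kspace_axioms Hom_linear Hom_gr intro: W.gr_add)

lemma mscale_Hom: "f \<in> Hom V W n \<Longrightarrow> mscale V W c f \<in> Hom V W n"
  by (rule HomI[OF linear_mscale])
    (auto simp: mscale_def V.gr_subset V.kspace_axioms W.kspace_axioms Hom_linear Hom_gr intro: W.gr_smult)

lemma hom_diff_apply: "x \<in> carrier V \<Longrightarrow>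
    hom_diff V W n f x = dd W (f x) \<ominus>\<^bsub>W\<^esub> sgn_pow n \<odot>\<^bsub>W\<^esub> f (dd V x)"
  by (simp add: hom_diff_def msub_def mscale_def compose_def)

lemma linear_hom_diff: "f \<in> linear_maps V W \<Longrightarrow> hom_diff V W n f \<in> linear_maps V W"
  unfolding hom_diff_def
  by (intro linear_msub linear_mscale linear_compose[OF V.kspace_axioms _ W.dd_linear]
      linear_compose[OF V.kspace_axioms V.dd_linear] V.kspace_axioms W.kspace_axioms)

lemma hom_diff_Hom: "f \<in> Hom V W n \<Longrightarrow> hom_diff V W n f \<in> Hom V W (n + 1)"
proof (rule HomI[OF linear_hom_diff])
  assume f: "f \<in> Hom V W n"
  fix i x assume x: "x \<in> gr V i"
  have "dd W (f x) \<in> gr W (i + (n + 1))"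
    using W.dd_gr[OF Hom_gr[OF f x]] by (simp add: add.assoc)
  moreover have "f (dd V x) \<in> gr W (i + (n + 1))"
    using Hom_gr[OF f V.dd_gr[OF x]] by (simp add: algebra_simps)
  ultimately show "hom_diff V W n f x \<in> gr W (i + (n + 1))"
    using x f V.gr_subset[OF x]
    by (simp add: hom_diff_apply a_minus_def W.minus_eq_smult Hom_closed W.gr_add W.gr_smult)
qed (rule Hom_linear)

lemma hom_diff_eq_zero_iff:
  assumes "f \<in> linear_maps V W"
  shows "hom_diff V W 0 f = zmap V W \<longleftrightarrow> (\<forall>x\<in>carrier V. dd W (f x) = f (dd V x))"
proof
  assume eq: "hom_diff V W 0 f = zmap V W"
  show "\<forall>x\<in>carrier V. dd W (f x) = f (dd V x)"
  proof
    fix x assume x: "x \<in> carrier V"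
    have "dd W (f x) \<ominus>\<^bsub>W\<^esub> f (dd V x) = \<zero>\<^bsub>W\<^esub>"
      using fun_cong[OF eq, of x] x assms by (simp add: hom_diff_apply zmap_def linear_closed)
    then show "dd W (f x) = f (dd V x)"
      using x assms by (simp add: W.diff_eq_zero_iff linear_closed)
  qed
next
  assume "\<forall>x\<in>carrier V. dd W (f x) = f (dd V x)"
  then show "hom_diff V W 0 f = zmap V W"
    using assms
    by (intro linear_eqI[OF linear_hom_diff linear_zmap])
      (auto simp: V.kspace_axioms W.kspace_axioms hom_diff_apply zmap_def linear_closed a_minus_def W.r_neg)
qed

lemma hom_diff_madd:
  assumes "f \<in> linear_maps V W" "g \<in> linear_maps V W"
  shows "hom_diff V W n (madd V W f g) = madd V W (hom_diff V W n f) (hom_diff V W n g)"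
proof -
  note lin = linear_madd[OF V.kspace_axioms W.kspace_axioms]
  show ?thesis
    by (rule linear_eqI[OF linear_hom_diff[OF lin[OF assms]]
          lin[OF linear_hom_diff[OF assms(1)] linear_hom_diff[OF assms(2)]]])
      (use assms in \<open>auto simp: hom_diff_apply madd_def linear_closed a_minus_def
        W.dd_add W.smult_add_right W.minus_add W.a_ac\<close>)
qed

lemma hom_diff_mscale:
  assumes "f \<in> linear_maps V W"
  shows "hom_diff V W n (mscale V W c f) = mscale V W c (hom_diff V W n f)"
proof -
  note lin = linear_mscale[OF V.kspace_axioms W.kspace_axioms]
  show ?thesis
    by (rule linear_eqI[OF linear_hom_diff[OF lin[OF assms]] lin[OF linear_hom_diff[OF assms]]])
      (use assms in \<open>auto simp: hom_diff_apply mscale_def linear_closed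
        W.dd_smult W.smult_smult W.smult_diff_right mult.commute\<close>)
qed

lemma hom_diff_zmap: "hom_diff V W n (zmap V W) = zmap V W"
proof -
  note lin = linear_zmap[OF V.kspace_axioms W.kspace_axioms]
  show ?thesis
    by (rule linear_eqI[OF linear_hom_diff[OF lin] lin])
      (auto simp: hom_diff_apply zmap_def a_minus_def W.r_neg)
qed

end

section \<open>Differential graded algebras and their tensor squares\<close>

locale cdga = dgspace A + ring A for A :: "('k::field, 'a, 'm) dgmod_scheme" (structure) +
  assumes cdg_algebra: "cdg_algebra A"

lemma cdga_iff: "cdga A \<longleftrightarrow> cdg_algebra A"
proof
  assume A: "cdg_algebra A"
  then have "dg_space A" "ring A" by (simp_all add: cdg_algebra_def)
  moreover from this have "graded A" by (simp add: dg_space_def graded_iff)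
  ultimately show "cdga A"
    using A by (intro cdga.intro cdga_axioms.intro dgspace.intro dgspace_axioms.intro)
qed (rule cdga.cdg_algebra)

context cdga
begin

lemma mult_smult:
  shows mult_smult_left: "x \<in> carrier A \<Longrightarrow> y \<in> carrier A \<Longrightarrow> (c \<odot> x) \<otimes> y = c \<odot> (x \<otimes> y)"
    and mult_smult_right: "x \<in> carrier A \<Longrightarrow> y \<in> carrier A \<Longrightarrow> x \<otimes> (c \<odot> y) = c \<odot> (x \<otimes> y)"
  using cdg_algebra by (auto simp: cdg_algebra_def)

lemma mult_gr: "x \<in> gr A i \<Longrightarrow> y \<in> gr A j \<Longrightarrow> x \<otimes> y \<in> gr A (i + j)"
  and graded_comm: "x \<in> gr A i \<Longrightarrow> y \<in> gr A j \<Longrightarrow> x \<otimes> y = sgn_pow (i * j) \<odot> (y \<otimes> x)"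
  and leibniz: "x \<in> gr A i \<Longrightarrow> y \<in> gr A j \<Longrightarrow>
    dd A (x \<otimes> y) = (dd A x \<otimes> y) \<oplus> (sgn_pow i \<odot> (x \<otimes> dd A y))"
  using cdg_algebra unfolding cdg_algebra_def by blast+

lemma bilinear_mult: "bilinear A A A (\<lambda>x y. x \<otimes> y)"
  by (intro bilinearI) (auto simp: l_distr r_distr mult_smult)

sublocale AA: graded_pair A A ..

lemma linear_mult_map: "mult_map A \<in> linear_maps (tspace A A) A"
  unfolding mult_map_def by (rule AA.linear_tlift[OF kspace_axioms bilinear_mult])

lemma mult_map_tens [simp]:
  "x \<in> carrier A \<Longrightarrow> y \<in> carrier A \<Longrightarrow> mult_map A (tens A A x y) = x \<otimes> y"
  unfolding mult_map_def by (rule AA.tlift_tens[OF kspace_axioms bilinear_mult])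

end

lemma (in cdga) unit_zero_iff:
  fixes W :: "('k, 'c, 'p) dgmod_scheme"
  assumes W: "kspace W" and \<sigma>: "\<sigma> \<in> linear_maps A W"
  shows "compose UNIV \<sigma> (unit_map A) = zmap (ground :: ('k, 'k) dgmod) W \<longleftrightarrow> \<sigma> \<one> = \<zero>\<^bsub>W\<^esub>"
proof
  interpret W: kspace W by (rule W)
  assume "compose UNIV \<sigma> (unit_map A) = zmap (ground :: ('k, 'k) dgmod) W"
  from fun_cong[OF this, of 1] show "\<sigma> \<one> = \<zero>\<^bsub>W\<^esub>"
    by (simp add: compose_def unit_map_def zmap_def)
qed (use kspace.smult_zero_right[OF W] in
    \<open>auto simp: compose_def unit_map_def zmap_def fun_eq_iff linear_smult[OF \<sigma>]\<close>)

text \<open>Conditions on \<open>\<sigma> \<circ> m\<close> are stated as equations of maps on \<open>A \<otimes> A\<close>; on pure tensors they become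
  product rules for elements.\<close>

lemma (in cdga) mult_map_eq_iff:
  fixes W :: "('k, 'c, 'p) dgmod_scheme"
  assumes W: "kspace W" and \<sigma>: "\<sigma> \<in> linear_maps A W" and G: "G \<in> linear_maps (tspace A A) W"
  shows "compose (carrier (tensor A A)) \<sigma> (mult_map A) = G \<longleftrightarrow>
    (\<forall>x\<in>carrier A. \<forall>y\<in>carrier A. \<sigma> (x \<otimes> y) = G (tens A A x y))" (is "?l \<longleftrightarrow> ?r")
proof
  assume l: ?l
  show ?r
  proof (intro ballI)
    fix x y assume "x \<in> carrier A" "y \<in> carrier A"
    then show "\<sigma> (x \<otimes> y) = G (tens A A x y)"
      using fun_cong[OF l, of "tens A A x y"] by (simp add: compose_eq AA.tens_closed)
  qed
next
  assume r: ?r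
  have lin: "compose (carrier (tensor A A)) \<sigma> (mult_map A) \<in> linear_maps (tspace A A) W"
    using linear_compose[OF AA.kspace_tspace linear_mult_map \<sigma>] by simp
  show ?l
    by (rule linear_eqI[OF lin G refl], rule AA.linear_eq_on_tens[OF W lin G])
      (simp_all add: r compose_eq AA.tens_closed)
qed

context cdga
begin

context
begin

interpretation T: kspace "tspace A A" by (rule AA.kspace_tspace)

text \<open>The value of the product of \<open>A \<otimes> A\<close> on pure tensors. The sum over the components of \<open>y\<close> is of the form
  \<open>hsum\<close>, hence linear in \<open>y\<close>, and the universal property applies in both factors.\<close>

private definition tmul where
  "tmul x y x' y' = finsum (tspace A A)
    (\<lambda>j. tens A A (x \<otimes> ksgn A j x') (hcomp A j y \<otimes> y')) (hsupp A (\<lambda>j. hcomp A j y))"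

private definition tmulF where
  "tmulF x x' y' j = (\<lambda>w\<in>carrier A. tens A A (x \<otimes> ksgn A j x') (w \<otimes> y'))"

private lemma tmul_eq_hsum:
  assumes "x \<in> carrier A" "y \<in> carrier A" "x' \<in> carrier A" "y' \<in> carrier A"
  shows "tmul x y x' y' = hsum A (tspace A A) (tmulF x x' y') y"
  unfolding tmul_def hsum_def tmulF_def
  using assms by (intro T.finsum_cong') auto

private lemmas tb = bilinearD[OF AA.bilinear_tens]

private lemma tmulF_linear:
  assumes "x \<in> carrier A" "x' \<in> carrier A" "y' \<in> carrier A"
  shows "tmulF x x' y' j \<in> linear_maps A (tspace A A)"
  using assms unfolding tmulF_def
  by (intro linear_mapsI) (auto simp: l_distr mult_smult tb)

private lemma tmul_closed:
  assumes "x \<in> carrier A" "y \<in> carrier A" "x' \<in> carrier A" "y' \<in> carrier A"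
  shows "tmul x y x' y' \<in> carrier (tspace A A)"
  using assms by (simp add: tmul_eq_hsum hsum_closed[OF T.kspace_axioms tmulF_linear])

private lemma tmul_bilinear_right:
  assumes xy: "x \<in> carrier A" "y \<in> carrier A"
  shows "bilinear A A (tspace A A) (tmul x y)"
proof (rule bilinearI)
  note T = T.kspace_axioms
  fix u v c assume uv: "u \<in> carrier A" "v \<in> carrier A"
  show "tmul x y u v \<in> carrier (tspace A A)" using xy uv by (rule tmul_closed)
  note [simp] = xy uv tmul_eq_hsum tmulF_def ksgn_add ksgn_smult r_distr mult_smult tb
  show "tmul x y (c \<odot> u) v = c \<odot>\<^bsub>tspace A A\<^esub> tmul x y u v"
    by (simp, rule hsum_param_smult[OF T]) simp_all
  show "tmul x y u (c \<odot> v) = c \<odot>\<^bsub>tspace A A\<^esub> tmul x y u v"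
    by (simp, rule hsum_param_smult[OF T]) simp_all
  fix w assume w[simp]: "w \<in> carrier A"
  show "tmul x y (u \<oplus> w) v = tmul x y u v \<oplus>\<^bsub>tspace A A\<^esub> tmul x y w v"
    by (simp, rule hsum_param_add[OF T]) simp_all
  show "tmul x y u (v \<oplus> w) = tmul x y u v \<oplus>\<^bsub>tspace A A\<^esub> tmul x y u w"
    by (simp, rule hsum_param_add[OF T]) simp_all
qed

private lemma tmul_bilinear_left:
  assumes uv: "u \<in> carrier A" "v \<in> carrier A"
  shows "bilinear A A (tspace A A) (\<lambda>x y. tmul x y u v)"
proof (rule bilinearI)
  note T = T.kspace_axioms
  fix x y c assume xy: "x \<in> carrier A" "y \<in> carrier A"
  show "tmul x y u v \<in> carrier (tspace A A)" using xy uv by (rule tmul_closed)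
  note lin = hsum_add[OF T tmulF_linear] hsum_smult[OF T tmulF_linear]
  show "tmul x (c \<odot> y) u v = c \<odot>\<^bsub>tspace A A\<^esub> tmul x y u v"
    using xy uv by (simp add: tmul_eq_hsum lin)
  fix w assume w: "w \<in> carrier A"
  show "tmul x (y \<oplus> w) u v = tmul x y u v \<oplus>\<^bsub>tspace A A\<^esub> tmul x w u v"
    using xy uv w by (simp add: tmul_eq_hsum lin)
  note [simp] = xy uv w tmul_eq_hsum tmulF_def l_distr mult_smult tb
  show "tmul (c \<odot> x) y u v = c \<odot>\<^bsub>tspace A A\<^esub> tmul x y u v"
    by (simp, rule hsum_param_smult[OF T]) simp_all
  show "tmul (x \<oplus> w) y u v = tmul x y u v \<oplus>\<^bsub>tspace A A\<^esub> tmul w y u v"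
    by (simp, rule hsum_param_add[OF T]) simp_all
qed

private lemma tmul_homogeneous:
  assumes "x \<in> carrier A" "y \<in> gr A j" "x' \<in> carrier A" "y' \<in> carrier A"
  shows "tmul x y x' y' = tens A A (x \<otimes> ksgn A j x') (y \<otimes> y')"
  using assms
  by (simp add: tmul_eq_hsum gr_subset hsum_homogeneous[OF T.kspace_axioms tmulF_linear])
    (simp add: tmulF_def gr_subset)

private lemma mult_tensor_eq: "s \<otimes>\<^bsub>tensor A A\<^esub> t
    = tlift A A (tspace A A) (\<lambda>x y. tlift A A (tspace A A) (tmul x y) t) s"
  by (simp add: tensor_def tmul_def[abs_def])

private lemma tmul_bilinear_outer:
  assumes t: "t \<in> carrier (tspace A A)"
  shows "bilinear A A (tspace A A) (\<lambda>x y. tlift A A (tspace A A) (tmul x y) t)"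
proof (rule bilinearI)
  note T = T.kspace_axioms and R = tmul_bilinear_right and L = bilinearD[OF tmul_bilinear_left]
  fix x y assume xy: "x \<in> carrier A" "y \<in> carrier A"
  show "tlift A A (tspace A A) (tmul x y) t \<in> carrier (tspace A A)"
    using xy t by (simp add: linear_closed[OF AA.linear_tlift[OF T R]])
  show "tlift A A (tspace A A) (tmul (c \<odot> x) y) t = c \<odot>\<^bsub>tspace A A\<^esub> tlift A A (tspace A A) (tmul x y) t" for c
    using xy t by (intro AA.tlift_smult[OF T R R]) (auto simp: L)
  show "tlift A A (tspace A A) (tmul x (c \<odot> y)) t = c \<odot>\<^bsub>tspace A A\<^esub> tlift A A (tspace A A) (tmul x y) t" for c
    using xy t by (intro AA.tlift_smult[OF T R R]) (auto simp: L)
  fix z assume z: "z \<in> carrier A"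
  show "tlift A A (tspace A A) (tmul (x \<oplus> z) y) t
      = tlift A A (tspace A A) (tmul x y) t \<oplus>\<^bsub>tspace A A\<^esub> tlift A A (tspace A A) (tmul z y) t"
    using xy t z by (intro AA.tlift_add[OF T R R R]) (auto simp: L)
  show "tlift A A (tspace A A) (tmul x (y \<oplus> z)) t
      = tlift A A (tspace A A) (tmul x y) t \<oplus>\<^bsub>tspace A A\<^esub> tlift A A (tspace A A) (tmul x z) t"
    using xy t z by (intro AA.tlift_add[OF T R R R]) (auto simp: L)
qed

lemma bilinear_mult_tensor:
  "bilinear (tspace A A) (tspace A A) (tspace A A) (\<lambda>s t. s \<otimes>\<^bsub>tensor A A\<^esub> t)"
proof (rule bilinearI)
  note T = T.kspace_axioms and R = tmul_bilinear_right and O = tmul_bilinear_outer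
  fix s t assume s: "s \<in> carrier (tspace A A)" and t: "t \<in> carrier (tspace A A)"
  note lin = AA.linear_tlift[OF T O[OF t]]
  show "s \<otimes>\<^bsub>tensor A A\<^esub> t \<in> carrier (tspace A A)"
    using s by (simp add: mult_tensor_eq linear_closed[OF lin])
  show "c \<odot>\<^bsub>tspace A A\<^esub> s \<otimes>\<^bsub>tensor A A\<^esub> t = c \<odot>\<^bsub>tspace A A\<^esub> (s \<otimes>\<^bsub>tensor A A\<^esub> t)" for c
    using s by (simp add: mult_tensor_eq linear_smult[OF lin])
  show "s \<otimes>\<^bsub>tensor A A\<^esub> (c \<odot>\<^bsub>tspace A A\<^esub> t) = c \<odot>\<^bsub>tspace A A\<^esub> (s \<otimes>\<^bsub>tensor A A\<^esub> t)" for c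
    unfolding mult_tensor_eq using s t
    by (intro AA.tlift_smult[OF T O O]) (auto simp: linear_smult[OF AA.linear_tlift[OF T R]])
  fix u assume u: "u \<in> carrier (tspace A A)"
  show "(s \<oplus>\<^bsub>tspace A A\<^esub> u) \<otimes>\<^bsub>tensor A A\<^esub> t
      = s \<otimes>\<^bsub>tensor A A\<^esub> t \<oplus>\<^bsub>tspace A A\<^esub> u \<otimes>\<^bsub>tensor A A\<^esub> t"
    using s u by (simp add: mult_tensor_eq linear_add[OF lin])
  show "s \<otimes>\<^bsub>tensor A A\<^esub> (t \<oplus>\<^bsub>tspace A A\<^esub> u)
      = s \<otimes>\<^bsub>tensor A A\<^esub> t \<oplus>\<^bsub>tspace A A\<^esub> s \<otimes>\<^bsub>tensor A A\<^esub> u"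
    unfolding mult_tensor_eq using s t u
    by (intro AA.tlift_add[OF T O O O]) (auto simp: linear_add[OF AA.linear_tlift[OF T R]])
qed

lemma mult_tensor_tens:
  assumes "x \<in> carrier A" "y \<in> gr A j" "x' \<in> carrier A" "y' \<in> carrier A"
  shows "tens A A x y \<otimes>\<^bsub>tensor A A\<^esub> tens A A x' y' = tens A A (x \<otimes> ksgn A j x') (y \<otimes> y')"
  using assms
  by (simp add: mult_tensor_eq gr_subset AA.tlift_tens[OF T.kspace_axioms tmul_bilinear_outer]
      AA.tlift_tens[OF T.kspace_axioms tmul_bilinear_right] tmul_homogeneous)

lemma linear_dd_tensor: "dd (tensor A A) \<in> linear_maps (tspace A A) (tspace A A)"
  unfolding tensor_def
  by (simp, intro linear_madd AA.linear_tmap T.kspace_axioms kspace_axioms dd_linear linear_id_map)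

lemma dd_tensor_tens:
  assumes "x \<in> carrier A" "y \<in> carrier A"
  shows "dd (tensor A A) (tens A A x y)
    = tens A A (dd A x) y \<oplus>\<^bsub>tspace A A\<^esub> tens A A (ksgn A 1 x) (dd A y)"
  using assms unfolding tensor_def
  by (simp add: madd_def AA.tmap_tens kspace_axioms dd_linear linear_id_map)

end

end

section \<open>Graded-commutative Hopf algebras\<close>

locale cdg_hopf_algebra = cdga B for B :: "('k::field, 'b) hopf" (structure) +
  assumes cdg_hopf: "cdg_hopf B"

lemma cdg_hopf_algebra_iff: "cdg_hopf_algebra B \<longleftrightarrow> cdg_hopf B"
  using cdg_hopf_algebra.cdg_hopf
  by (auto simp: cdg_hopf_algebra_def cdg_hopf_algebra_axioms_def cdga_iff cdg_hopf_def)

context cdg_hopf_algebra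
begin

lemma counit_linear: "counit B \<in> linear_maps B (ground :: ('k, 'k) dgmod)"
  and counit_one [simp]: "counit B \<one> = 1"
  and counit_gr: "x \<in> gr B i \<Longrightarrow> i \<noteq> 0 \<Longrightarrow> counit B x = 0"
  and counit_dd: "x \<in> carrier B \<Longrightarrow> counit B (dd B x) = 0"
proof -
  have hom: "counit B \<in> cdga_hom B ground" using cdg_hopf by (simp add: cdg_hopf_def)
  then show "counit B \<in> linear_maps B (ground :: ('k, 'k) dgmod)" "counit B \<one> = 1"
    by (auto simp: cdga_hom_def Hom_def)
  show "counit B x = 0" if "x \<in> gr B i" "i \<noteq> 0"
    using hom that Hom_gr[of "counit B" B ground 0 x i] by (auto simp: cdga_hom_def)
  have "compose (carrier B) (counit B) (dd B) = compose (carrier B) (dd ground) (counit B)"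
    using hom by (auto simp: cdga_hom_def)
  from fun_cong[OF this, of x] show "counit B (dd B x) = 0" if "x \<in> carrier B"
    using that by (simp add: compose_def)
qed

lemma counit_add: "x \<in> carrier B \<Longrightarrow> y \<in> carrier B \<Longrightarrow> counit B (x \<oplus> y) = counit B x + counit B y"
  and counit_smult: "x \<in> carrier B \<Longrightarrow> counit B (c \<odot> x) = c * counit B x"
  using linear_add[OF counit_linear] linear_smult[OF counit_linear] by auto

lemma counit_ksgn: "x \<in> carrier B \<Longrightarrow> counit B (ksgn B n x) = counit B x"
proof (induction rule: homogeneous_induct)
  case (homogeneous i x)
  then show ?case
    by (cases "i = 0") (auto simp: ksgn_homogeneous counit_smult gr_subset counit_gr)
qed (use linear_zero[OF kspace_axioms kspace_ground counit_linear] in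
    \<open>auto simp: ksgn_add counit_add ksgn_homogeneous[OF gr_zero[of 0], of n]\<close>)

lemma comult_linear: "comult B \<in> linear_maps B (tspace B B)"
  and comult_gr: "x \<in> gr B i \<Longrightarrow> comult B x \<in> gr (tspace B B) i"
  and comult_mult: "x \<in> carrier B \<Longrightarrow> y \<in> carrier B \<Longrightarrow>
    comult B (x \<otimes> y) = comult B x \<otimes>\<^bsub>tensor B B\<^esub> comult B y"
  and comult_dd: "x \<in> carrier B \<Longrightarrow> comult B (dd B x) = dd (tensor B B) (comult B x)"
proof -
  have hom: "comult B \<in> cdga_hom B (tensor B B)" using cdg_hopf by (simp add: cdg_hopf_def)
  then show "comult B \<in> linear_maps B (tspace B B)"
    "x \<in> gr B i \<Longrightarrow> comult B x \<in> gr (tspace B B) i"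
    "x \<in> carrier B \<Longrightarrow> y \<in> carrier B \<Longrightarrow> comult B (x \<otimes> y) = comult B x \<otimes>\<^bsub>tensor B B\<^esub> comult B y"
    using Hom_gr[of "comult B" B "tensor B B" 0 x i] by (auto simp: cdga_hom_def dest: Hom_linear)
  have "compose (carrier B) (comult B) (dd B) = compose (carrier B) (dd (tensor B B)) (comult B)"
    using hom by (auto simp: cdga_hom_def)
  from fun_cong[OF this, of x] show "comult B (dd B x) = dd (tensor B B) (comult B x)" if "x \<in> carrier B"
    using that by (simp add: compose_def)
qed

lemma comult_closed [simp, intro]: "x \<in> carrier B \<Longrightarrow> comult B x \<in> carrier (tspace B B)"
  by (rule linear_closed[OF comult_linear])

text \<open>The contractions \<open>\<epsilon> \<otimes> id\<close> and \<open>id \<otimes> \<epsilon>\<close>, with values in \<open>B\<close> itself.\<close>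

definition contract_left where "contract_left = tlift B B B (\<lambda>x y. counit B x \<odot> y)"
definition contract_right where "contract_right = tlift B B B (\<lambda>x y. counit B y \<odot> x)"

lemma bilinear_contract:
  "bilinear B B B (\<lambda>x y. counit B x \<odot> y)" "bilinear B B B (\<lambda>x y. counit B y \<odot> x)"
  by (intro bilinearI; simp add: counit_add counit_smult smult_add_left smult_add_right smult_smult mult.commute)+

lemma contract_linear: "contract_left \<in> linear_maps (tspace B B) B" "contract_right \<in> linear_maps (tspace B B) B"
  unfolding contract_left_def contract_right_def
  by (intro AA.linear_tlift kspace_axioms bilinear_contract)+

lemma contract_tens [simp]:
  "x \<in> carrier B \<Longrightarrow> y \<in> carrier B \<Longrightarrow> contract_left (tens B B x y) = counit B x \<odot> y"
  "x \<in> carrier B \<Longrightarrow> y \<in> carrier B \<Longrightarrow> contract_right (tens B B x y) = counit B y \<odot> x"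
  unfolding contract_left_def contract_right_def
  by (simp_all add: AA.tlift_tens[OF kspace_axioms bilinear_contract(1)]
      AA.tlift_tens[OF kspace_axioms bilinear_contract(2)])

text \<open>The counit axioms, after identifying \<open>k \<otimes> B\<close> and \<open>B \<otimes> k\<close> with \<open>B\<close>.\<close>

lemma contract_left_comult [simp]:
  assumes b: "b \<in> carrier B"
  shows "contract_left (comult B b) = b"
proof -
  interpret gB: kspace_pair "ground :: ('k, 'k) dgmod" B
    by (simp add: kspace_pair_def kspace_ground kspace_axioms)
  note lin1 = AA.linear_tmap[OF kspace_ground kspace_axioms counit_linear linear_id_map[OF kspace_axioms]]
  note lin2 = gB.linear_tlift[OF kspace_axioms bilinear_scalar[OF kspace_axioms]]
  have "compose (carrier (tspace B B)) (tlift ground B B (\<lambda>c x. c \<odot> x))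
      (tmap B B ground B 0 (counit B) (id_map B)) t = contract_left t"
    if "t \<in> carrier (tspace B B)" for t
    by (rule AA.linear_eq_on_tens[OF kspace_axioms linear_compose[OF AA.kspace_tspace lin1 lin2]
          contract_linear(1) _ that])
      (simp add: compose_def AA.tmap_tens kspace_ground kspace_axioms counit_linear linear_id_map
        gB.tlift_tens[OF kspace_axioms bilinear_scalar[OF kspace_axioms]])
  then have *: "tlift ground B B (\<lambda>c x. c \<odot> x) (tmap B B ground B 0 (counit B) (id_map B) t) = contract_left t"
    if "t \<in> carrier (tspace B B)" for t
    using that by (simp add: compose_def)
  have "compose (carrier B) (tlift ground B B (\<lambda>c x. c \<odot> x))
        (compose (carrier B) (tmap B B ground B 0 (counit B) (id_map B)) (comult B)) b = id_map B b"
    using cdg_hopf by (simp add: cdg_hopf_def)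
  then show ?thesis using b by (simp add: compose_def *)
qed

lemma contract_right_comult [simp]:
  assumes b: "b \<in> carrier B"
  shows "contract_right (comult B b) = b"
proof -
  interpret Bg: kspace_pair B "ground :: ('k, 'k) dgmod"
    by (simp add: kspace_pair_def kspace_ground kspace_axioms)
  have bil: "bilinear B (ground :: ('k, 'k) dgmod) B (\<lambda>x c. c \<odot> x)"
    using bilinearD[OF bilinear_scalar[OF kspace_axioms]] by (intro bilinearI) auto
  note lin1 = AA.linear_tmap[OF kspace_axioms kspace_ground linear_id_map[OF kspace_axioms] counit_linear]
  note lin2 = Bg.linear_tlift[OF kspace_axioms bil]
  have "compose (carrier (tspace B B)) (tlift B ground B (\<lambda>x c. c \<odot> x))
      (tmap B B B ground 0 (id_map B) (counit B)) t = contract_right t"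
    if "t \<in> carrier (tspace B B)" for t
    by (rule AA.linear_eq_on_tens[OF kspace_axioms linear_compose[OF AA.kspace_tspace lin1 lin2]
          contract_linear(2) _ that])
      (simp add: compose_def AA.tmap_tens kspace_ground kspace_axioms counit_linear linear_id_map
        Bg.tlift_tens[OF kspace_axioms bil])
  then have *: "tlift B ground B (\<lambda>x c. c \<odot> x) (tmap B B B ground 0 (id_map B) (counit B) t) = contract_right t"
    if "t \<in> carrier (tspace B B)" for t
    using that by (simp add: compose_def)
  have "compose (carrier B) (tlift B ground B (\<lambda>x c. c \<odot> x))
        (compose (carrier B) (tmap B B B ground 0 (id_map B) (counit B)) (comult B)) b = id_map B b"
    using cdg_hopf by (simp add: cdg_hopf_def)
  then show ?thesis using b by (simp add: compose_def *)
qed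

lemma coassoc:
  assumes b: "b \<in> carrier B"
  shows "tassoc B B B (tmap B B (tensor B B) B 0 (comult B) (id_map B) (comult B b))
    = tmap B B B (tensor B B) 0 (id_map B) (comult B) (comult B b)"
proof -
  have "compose (carrier B) (tassoc B B B)
        (compose (carrier B) (tmap B B (tensor B B) B 0 (comult B) (id_map B)) (comult B)) b
      = compose (carrier B) (tmap B B B (tensor B B) 0 (id_map B) (comult B)) (comult B) b"
    using cdg_hopf by (simp add: cdg_hopf_def)
  then show ?thesis using b by (simp add: compose_def)
qed

end

section \<open>Derivations along the counit\<close>

text \<open>The \<open>\<epsilon>\<close>-derivations of degree \<open>n\<close>. Their product rule has no sign \<open>(-1)\<^bsup>n |x|\<^esup>\<close> in front of \<open>\<epsilon>(x) \<sigma>(y)\<close> in any degree \<open>n\<close>, because \<open>\<epsilon>\<close> vanishes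
  outside degree \<open>0\<close>.\<close>

definition eder :: "('k::field, 'b) hopf \<Rightarrow> ('k, 'a, 'm) dgmod_scheme \<Rightarrow> int \<Rightarrow> ('b \<Rightarrow> 'a) set" where
  "eder B A n = {\<sigma> \<in> Hom B A n. \<sigma> \<one>\<^bsub>B\<^esub> = \<zero>\<^bsub>A\<^esub> \<and>
    (\<forall>x\<in>carrier B. \<forall>y\<in>carrier B. \<sigma> (x \<otimes>\<^bsub>B\<^esub> y) = counit B x \<odot>\<^bsub>A\<^esub> \<sigma> y \<oplus>\<^bsub>A\<^esub> counit B y \<odot>\<^bsub>A\<^esub> \<sigma> x)}"

lemma ederD:
  assumes "\<sigma> \<in> eder B A n"
  shows eder_Hom: "\<sigma> \<in> Hom B A n" and eder_linear: "\<sigma> \<in> linear_maps B A"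
    and eder_one: "\<sigma> \<one>\<^bsub>B\<^esub> = \<zero>\<^bsub>A\<^esub>"
    and eder_mult: "\<And>x y. x \<in> carrier B \<Longrightarrow> y \<in> carrier B \<Longrightarrow>
      \<sigma> (x \<otimes>\<^bsub>B\<^esub> y) = counit B x \<odot>\<^bsub>A\<^esub> \<sigma> y \<oplus>\<^bsub>A\<^esub> counit B y \<odot>\<^bsub>A\<^esub> \<sigma> x"
  using assms by (auto simp: eder_def dest: Hom_linear)

lemma ederI:
  assumes "\<sigma> \<in> Hom B A n" "\<sigma> \<one>\<^bsub>B\<^esub> = \<zero>\<^bsub>A\<^esub>"
    "\<And>x y. x \<in> carrier B \<Longrightarrow> y \<in> carrier B \<Longrightarrow>
      \<sigma> (x \<otimes>\<^bsub>B\<^esub> y) = counit B x \<odot>\<^bsub>A\<^esub> \<sigma> y \<oplus>\<^bsub>A\<^esub> counit B y \<odot>\<^bsub>A\<^esub> \<sigma> x"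
  shows "\<sigma> \<in> eder B A n"
  using assms by (auto simp: eder_def)

lemmas eder_closed = linear_closed[OF eder_linear]
lemmas eder_gr = Hom_gr[OF eder_Hom]

locale hopf_cdga = B: cdg_hopf_algebra B + A: cdga A
  for B :: "('k::field, 'b) hopf" and A :: "('k, 'a, 'm) dgmod_scheme"
begin

sublocale BA: dg_pair B A ..

lemma e_map_apply: "b \<in> carrier B \<Longrightarrow> e_map B A b = counit B b \<odot>\<^bsub>A\<^esub> \<one>\<^bsub>A\<^esub>"
  by (simp add: e_map_def compose_def unit_map_def)

lemma e_map_linear: "e_map B A \<in> linear_maps B A"
  by (rule linear_mapsI)
    (auto simp: e_map_apply B.counit_add B.counit_smult A.smult_add_left A.smult_smult,
      simp add: e_map_def compose_def)

lemma e_derivation_linear: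
  assumes "\<sigma> \<in> linear_maps B A"
  shows "e_derivation B A n \<sigma> \<in> linear_maps (tspace B B) A"
proof -
  note K = B.kspace_axioms A.kspace_axioms B.AA.kspace_tspace A.AA.kspace_tspace
  have "madd (tensor B B) (tensor A A) (tmap B B A A n (e_map B A) \<sigma>) (tmap B B A A 0 \<sigma> (e_map B A))
      = madd (tspace B B) (tspace A A) (tmap B B A A n (e_map B A) \<sigma>) (tmap B B A A 0 \<sigma> (e_map B A))"
    by (simp add: madd_def)
  then show ?thesis
    unfolding e_derivation_def using assms e_map_linear
    by (auto intro!: linear_compose[OF K(3) _ A.linear_mult_map] linear_madd B.AA.linear_tmap K)
qed

lemma e_derivation_tens:
  assumes \<sigma>: "\<sigma> \<in> linear_maps B A" and xy: "x \<in> carrier B" "y \<in> carrier B"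
  shows "e_derivation B A n \<sigma> (tens B B x y)
    = counit B x \<odot>\<^bsub>A\<^esub> \<sigma> y \<oplus>\<^bsub>A\<^esub> counit B y \<odot>\<^bsub>A\<^esub> \<sigma> x"
proof -
  note K = B.kspace_axioms A.kspace_axioms
  have "e_derivation B A n \<sigma> (tens B B x y)
      = mult_map A (tens A A (e_map B A (ksgn B n x)) (\<sigma> y) \<oplus>\<^bsub>tspace A A\<^esub> tens A A (\<sigma> x) (e_map B A y))"
    using xy by (simp add: e_derivation_def compose_def madd_def B.AA.tmap_tens K e_map_linear \<sigma>)
  also have "\<dots> = e_map B A (ksgn B n x) \<otimes>\<^bsub>A\<^esub> \<sigma> y \<oplus>\<^bsub>A\<^esub> \<sigma> x \<otimes>\<^bsub>A\<^esub> e_map B A y"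
    using xy \<sigma> by (simp add: linear_add[OF A.linear_mult_map] linear_closed[OF \<sigma>] linear_closed[OF e_map_linear])
  finally show ?thesis
    using xy \<sigma> by (simp add: e_map_apply B.counit_ksgn A.mult_smult linear_closed)
qed

lemma eder_iff: "\<sigma> \<in> eder B A n \<longleftrightarrow> \<sigma> \<in> Hom B A n \<and>
    compose UNIV \<sigma> (unit_map B) = zmap (ground :: ('k, 'k) dgmod) A \<and>
    compose (carrier (tensor B B)) \<sigma> (mult_map B) = e_derivation B A n \<sigma>"
proof (cases "\<sigma> \<in> Hom B A n")
  case True
  note lin = Hom_linear[OF True]
  show ?thesis
    using True
    by (simp add: eder_def B.unit_zero_iff[OF A.kspace_axioms lin]
        B.mult_map_eq_iff[OF A.kspace_axioms lin e_derivation_linear[OF lin], simplified] e_derivation_tens[OF lin])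
qed (simp add: eder_def)

lemma THom_iff: "\<upsilon> \<in> THom B A \<longleftrightarrow> \<upsilon> \<in> eder B A 0 \<and> (\<forall>x\<in>carrier B. dd A (\<upsilon> x) = \<upsilon> (dd B x))"
  using BA.hom_diff_eq_zero_iff Hom_linear unfolding THom_def mem_Collect_eq eder_iff by blast

lemma THomD:
  assumes "\<upsilon> \<in> THom B A"
  shows THom_eder: "\<upsilon> \<in> eder B A 0" and THom_dd: "\<And>x. x \<in> carrier B \<Longrightarrow> dd A (\<upsilon> x) = \<upsilon> (dd B x)"
  using assms by (auto simp: THom_iff)

lemmas THom_linear = eder_linear[OF THom_eder]
lemmas THom_closed = eder_closed[OF THom_eder]

lemma eder_zmap: "zmap B A \<in> eder B A n"
  using BA.zmap_Hom by (intro ederI) (auto simp: zmap_def)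

lemma eder_madd: "\<sigma> \<in> eder B A n \<Longrightarrow> \<tau> \<in> eder B A n \<Longrightarrow> madd B A \<sigma> \<tau> \<in> eder B A n"
  by (intro ederI BA.madd_Hom)
    (auto simp: madd_def eder_Hom eder_one eder_mult eder_closed A.smult_add_right A.a_ac)

lemma eder_mscale: "\<sigma> \<in> eder B A n \<Longrightarrow> mscale B A c \<sigma> \<in> eder B A n"
  by (intro ederI BA.mscale_Hom)
    (auto simp: mscale_def eder_Hom eder_one eder_mult eder_closed A.smult_add_right A.smult_smult mult.commute)

lemma THom_zmap: "zmap B A \<in> THom B A"
  by (simp add: THom_iff eder_zmap) (simp add: zmap_def)

lemma THom_madd: "\<upsilon> \<in> THom B A \<Longrightarrow> \<upsilon>' \<in> THom B A \<Longrightarrow> madd B A \<upsilon> \<upsilon>' \<in> THom B A"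
  by (auto simp: THom_iff eder_madd) (simp add: madd_def A.dd_add eder_closed)

lemma THom_mscale: "\<upsilon> \<in> THom B A \<Longrightarrow> mscale B A c \<upsilon> \<in> THom B A"
  by (auto simp: THom_iff eder_mscale) (simp add: mscale_def A.dd_smult eder_closed)

end

section \<open>The convolution commutator\<close>

context hopf_cdga
begin

text \<open>For \<open>\<upsilon>\<close> of degree \<open>0\<close> and \<open>\<sigma>\<close> of degree \<open>n\<close>, the graded commutator is \<open>\<upsilon> * \<sigma> - \<sigma> * \<upsilon>\<close> for the
  convolution product \<open>*\<close>. It sends \<open>b\<close> to the value at \<open>\<Delta> b\<close> of the map induced by the bilinear form
  \<open>cform\<close>; the sign arises from moving \<open>\<sigma>\<close> past \<open>x\<close>. The case \<open>n = -1\<close> is needed for homotopies.\<close>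

definition cform :: "int \<Rightarrow> ('b \<Rightarrow> 'a) \<Rightarrow> ('b \<Rightarrow> 'a) \<Rightarrow> 'b \<Rightarrow> 'b \<Rightarrow> 'a" where
  "cform n \<upsilon> \<sigma> x y = \<upsilon> (ksgn B n x) \<otimes>\<^bsub>A\<^esub> \<sigma> y \<ominus>\<^bsub>A\<^esub> \<sigma> x \<otimes>\<^bsub>A\<^esub> \<upsilon> y"

definition cbr :: "int \<Rightarrow> ('b \<Rightarrow> 'a) \<Rightarrow> ('b \<Rightarrow> 'a) \<Rightarrow> 'b \<Rightarrow> 'a" where
  "cbr n \<upsilon> \<sigma> = compose (carrier B) (tlift B B A (cform n \<upsilon> \<sigma>)) (comult B)"

lemma bilinear_prod:
  assumes "f \<in> linear_maps B A" "g \<in> linear_maps B A"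
  shows "bilinear B B A (\<lambda>x y. f (ksgn B n x) \<otimes>\<^bsub>A\<^esub> g y)"
    and "bilinear B B A (\<lambda>x y. f x \<otimes>\<^bsub>A\<^esub> g y)"
  using assms
  by (auto intro!: bilinearI simp: linear_closed linear_add linear_smult B.ksgn_add B.ksgn_smult
      A.l_distr A.r_distr A.mult_smult)

lemma bilinear_cform:
  assumes "\<upsilon> \<in> linear_maps B A" "\<sigma> \<in> linear_maps B A"
  shows "bilinear B B A (cform n \<upsilon> \<sigma>)"
  unfolding cform_def[abs_def]
  by (intro bilinear_diff A.kspace_axioms bilinear_prod assms)

lemma linear_tlift_cform:
  assumes "\<upsilon> \<in> linear_maps B A" "\<sigma> \<in> linear_maps B A"
  shows "tlift B B A (cform n \<upsilon> \<sigma>) \<in> linear_maps (tspace B B) A"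
  by (intro B.AA.linear_tlift A.kspace_axioms bilinear_cform assms)

lemma tlift_cform_tens:
  assumes "\<upsilon> \<in> linear_maps B A" "\<sigma> \<in> linear_maps B A" "x \<in> carrier B" "y \<in> carrier B"
  shows "tlift B B A (cform n \<upsilon> \<sigma>) (tens B B x y) = cform n \<upsilon> \<sigma> x y"
  by (intro B.AA.tlift_tens A.kspace_axioms bilinear_cform assms)

lemma cbr_apply: "b \<in> carrier B \<Longrightarrow> cbr n \<upsilon> \<sigma> b = tlift B B A (cform n \<upsilon> \<sigma>) (comult B b)"
  by (simp add: cbr_def compose_def)

lemma linear_cbr:
  assumes "\<upsilon> \<in> linear_maps B A" "\<sigma> \<in> linear_maps B A"
  shows "cbr n \<upsilon> \<sigma> \<in> linear_maps B A"
  unfolding cbr_def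
  by (rule linear_compose[OF B.kspace_axioms B.comult_linear linear_tlift_cform[OF assms]])

lemma cbr_Hom:
  assumes "\<upsilon> \<in> Hom B A 0" "\<sigma> \<in> Hom B A n"
  shows "cbr n \<upsilon> \<sigma> \<in> Hom B A n"
proof (rule HomI[OF linear_cbr])
  fix i b assume b: "b \<in> gr B i"
  note lin = linear_tlift_cform[OF assms[THEN Hom_linear], of n]
  have "t \<in> gr (tspace B B) i \<Longrightarrow> tlift B B A (cform n \<upsilon> \<sigma>) t \<in> gr A (i + n)" for t
  proof (induction rule: B.AA.tens_gr_induct)
    case zero
    then show ?case by (simp add: linear_zero[OF B.AA.kspace_tspace A.kspace_axioms lin])
  next
    case (add s t)
    then show ?case by (simp add: linear_add[OF lin] A.gr_add)
  next
    case (tens j x y)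
    have "\<upsilon> (ksgn B n x) \<otimes>\<^bsub>A\<^esub> \<sigma> y \<in> gr A (i + n)" "\<sigma> x \<otimes>\<^bsub>A\<^esub> \<upsilon> y \<in> gr A (i + n)"
      using A.mult_gr[OF Hom_gr[OF assms(1) B.ksgn_gr[OF tens(1)]] Hom_gr[OF assms(2) tens(2)]]
        A.mult_gr[OF Hom_gr[OF assms(2) tens(1)] Hom_gr[OF assms(1) tens(2)]]
      by (simp_all add: algebra_simps)
    then show ?case using tens
      by (simp add: tlift_cform_tens assms[THEN Hom_linear] B.gr_subset)
        (simp add: cform_def a_minus_def A.minus_eq_smult A.gr_subset A.gr_add A.gr_smult)
  qed
  from this[OF B.comult_gr[OF b]] show "cbr n \<upsilon> \<sigma> b \<in> gr A (i + n)"
    using B.gr_subset[OF b] by (simp add: cbr_apply)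
qed (use assms Hom_linear in auto)

text \<open>The counit values are \<open>0\<close> outside degree \<open>0\<close>. So in each term of the expansion either the coefficient
  vanishes or the sign simplifies, and only the products \<open>\<upsilon> x' \<otimes> \<sigma> y\<close> and \<open>\<sigma> x' \<otimes> \<upsilon> y\<close> are in the wrong order;
  \<open>c1\<close> and \<open>c2\<close> reorder them.\<close>

lemma cform_mult_homogeneous:
  assumes \<upsilon>: "\<upsilon> \<in> eder B A 0" and \<sigma>: "\<sigma> \<in> eder B A n"
    and x: "x \<in> gr B i" and y: "y \<in> gr B j" and x': "x' \<in> gr B k" and y': "y' \<in> gr B l"
  shows "cform n \<upsilon> \<sigma> (x \<otimes>\<^bsub>B\<^esub> ksgn B j x') (y \<otimes>\<^bsub>B\<^esub> y')
    = (counit B x * counit B y) \<odot>\<^bsub>A\<^esub> cform n \<upsilon> \<sigma> x' y'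
      \<oplus>\<^bsub>A\<^esub> (counit B x' * counit B y') \<odot>\<^bsub>A\<^esub> cform n \<upsilon> \<sigma> x y
      \<oplus>\<^bsub>A\<^esub> (cform n \<upsilon> \<sigma> (counit B y \<odot>\<^bsub>B\<^esub> x) (counit B x' \<odot>\<^bsub>B\<^esub> y')
          \<ominus>\<^bsub>A\<^esub> cform n \<upsilon> \<sigma> (counit B x \<odot>\<^bsub>B\<^esub> y) (counit B y' \<odot>\<^bsub>B\<^esub> x'))"
proof -
  note [simp] = B.gr_subset[OF x] B.gr_subset[OF y] B.gr_subset[OF x'] B.gr_subset[OF y']
  note [simp] = eder_closed[OF \<upsilon>] eder_closed[OF \<sigma>]
  have deg: "counit B x = 0 \<or> i = 0" "counit B y = 0 \<or> j = 0"
    "counit B x' = 0 \<or> k = 0" "counit B y' = 0 \<or> l = 0"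
    using B.counit_gr x y x' y' by blast+
  have c1: "\<upsilon> x' \<otimes>\<^bsub>A\<^esub> \<sigma> y = (sgn_pow (k * j) * sgn_pow (k * n)) \<odot>\<^bsub>A\<^esub> (\<sigma> y \<otimes>\<^bsub>A\<^esub> \<upsilon> x')"
    using A.graded_comm[OF eder_gr[OF \<upsilon> x'] eder_gr[OF \<sigma> y]] by (simp add: distrib_left sgn_pow_add)
  have c2: "\<sigma> x' \<otimes>\<^bsub>A\<^esub> \<upsilon> y = (sgn_pow (k * j) * sgn_pow (n * j)) \<odot>\<^bsub>A\<^esub> (\<upsilon> y \<otimes>\<^bsub>A\<^esub> \<sigma> x')"
    using A.graded_comm[OF eder_gr[OF \<sigma> x'] eder_gr[OF \<upsilon> y]] by (simp add: distrib_right sgn_pow_add)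
  have K: "ksgn B n (x \<otimes>\<^bsub>B\<^esub> ksgn B j x') = (sgn_pow (n * i) * sgn_pow (n * k) * sgn_pow (j * k)) \<odot>\<^bsub>B\<^esub> (x \<otimes>\<^bsub>B\<^esub> x')"
    using B.mult_gr[OF x x']
    by (simp add: B.ksgn_homogeneous[OF x'] B.mult_smult B.ksgn_smult B.ksgn_homogeneous distrib_left
        sgn_pow_add B.smult_smult mult.commute)
  show ?thesis
    unfolding cform_def K
    unfolding B.ksgn_homogeneous[OF x] B.ksgn_homogeneous[OF x'] B.ksgn_smult[OF B.gr_subset[OF x]]
      B.ksgn_smult[OF B.gr_subset[OF y]] B.ksgn_homogeneous[OF y]
    using deg
    apply (simp add: linear_smult[OF eder_linear[OF \<upsilon>]] linear_smult[OF eder_linear[OF \<sigma>]]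
        eder_mult[OF \<upsilon>] eder_mult[OF \<sigma>] B.mult_smult a_minus_def A.minus_eq_smult A.l_distr A.r_distr
        A.mult_smult A.smult_add_right A.smult_smult c1 c2)
    apply (elim disjE; simp add: mult_ac A.a_ac)
    done
qed

text \<open>Why the commutator of derivations is a derivation. In the expansion of the left-hand side for
  pure tensors, the terms in which both arguments of \<open>cform\<close> come from the same factor give the
  first two summands. The mixed terms contract \<open>s\<close> on one side and \<open>t\<close> on the other; graded
  commutativity of \<open>A\<close> turns them into the difference at the end, which vanishes for
  \<open>s = \<Delta> b\<close>, \<open>t = \<Delta> b'\<close> because both contractions of \<open>\<Delta> b\<close> are \<open>b\<close>.\<close>

lemma tlift_cform_mult:
  assumes \<upsilon>: "\<upsilon> \<in> eder B A 0" and \<sigma>: "\<sigma> \<in> eder B A n"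
    and st: "s \<in> carrier (tspace B B)" "t \<in> carrier (tspace B B)"
  defines "\<Phi> \<equiv> tlift B B A (cform n \<upsilon> \<sigma>)"
  shows "\<Phi> (s \<otimes>\<^bsub>tensor B B\<^esub> t)
    = counit B (B.contract_left s) \<odot>\<^bsub>A\<^esub> \<Phi> t \<oplus>\<^bsub>A\<^esub> counit B (B.contract_left t) \<odot>\<^bsub>A\<^esub> \<Phi> s
      \<oplus>\<^bsub>A\<^esub> (cform n \<upsilon> \<sigma> (B.contract_right s) (B.contract_left t)
          \<ominus>\<^bsub>A\<^esub> cform n \<upsilon> \<sigma> (B.contract_left s) (B.contract_right t))"
proof -
  note lin = eder_linear[OF \<upsilon>] eder_linear[OF \<sigma>]
  note K = A.kspace_axioms and T = B.AA.kspace_tspace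
  have \<Phi>: "\<Phi> \<in> linear_maps (tspace B B) A"
    unfolding \<Phi>_def by (rule linear_tlift_cform[OF lin])
  have \<Phi>_tens: "\<Phi> (tens B B x y) = cform n \<upsilon> \<sigma> x y" if "x \<in> carrier B" "y \<in> carrier B" for x y
    unfolding \<Phi>_def using that by (rule tlift_cform_tens[OF lin])
  note L = B.contract_linear(1) and R = B.contract_linear(2)
  have b1: "bilinear (tspace B B) (tspace B B) A (\<lambda>s t. counit B (B.contract_left s) \<odot>\<^bsub>A\<^esub> \<Phi> t)"
    by (rule bilinearI)
      (simp_all add: linear_add[OF L] linear_add[OF \<Phi>] linear_smult[OF L] linear_smult[OF \<Phi>]
        linear_closed[OF L] linear_closed[OF \<Phi>] B.counit_add B.counit_smult A.smult_add_left
        A.smult_add_right A.smult_smult mult.commute)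
  have b2: "bilinear (tspace B B) (tspace B B) A (\<lambda>s t. counit B (B.contract_left t) \<odot>\<^bsub>A\<^esub> \<Phi> s)"
    using b1 by (auto simp: bilinear_def)
  have b3: "bilinear (tspace B B) (tspace B B) A (\<lambda>s t. \<Phi> (s \<otimes>\<^bsub>tensor B B\<^esub> t))"
    by (rule linear_o_bilinear[OF B.bilinear_mult_tensor \<Phi>])
  note b4 = bilinear_compose[OF bilinear_cform[OF lin] R L]
  note b5 = bilinear_compose[OF bilinear_cform[OF lin] L R]
  show ?thesis
  proof (rule B.AA.bilinear_eq_on_homogeneous_tens[OF K b3 _ _ st])
    show "bilinear (tspace B B) (tspace B B) A (\<lambda>s t. counit B (B.contract_left s) \<odot>\<^bsub>A\<^esub> \<Phi> t \<oplus>\<^bsub>A\<^esub> counit B (B.contract_left t) \<odot>\<^bsub>A\<^esub> \<Phi> s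
      \<oplus>\<^bsub>A\<^esub> (cform n \<upsilon> \<sigma> (B.contract_right s) (B.contract_left t)
          \<ominus>\<^bsub>A\<^esub> cform n \<upsilon> \<sigma> (B.contract_left s) (B.contract_right t)))"
      by (intro bilinear_add bilinear_diff K b1 b2 b4 b5)
    fix i j k l x y x' y'
    assume *: "x \<in> gr B i" "y \<in> gr B j" "x' \<in> gr B k" "y' \<in> gr B l"
    then show "\<Phi> (tens B B x y \<otimes>\<^bsub>tensor B B\<^esub> tens B B x' y')
      = counit B (B.contract_left (tens B B x y)) \<odot>\<^bsub>A\<^esub> \<Phi> (tens B B x' y')
        \<oplus>\<^bsub>A\<^esub> counit B (B.contract_left (tens B B x' y')) \<odot>\<^bsub>A\<^esub> \<Phi> (tens B B x y)
        \<oplus>\<^bsub>A\<^esub> (cform n \<upsilon> \<sigma> (B.contract_right (tens B B x y)) (B.contract_left (tens B B x' y'))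
          \<ominus>\<^bsub>A\<^esub> cform n \<upsilon> \<sigma> (B.contract_left (tens B B x y)) (B.contract_right (tens B B x' y')))"
      using cform_mult_homogeneous[OF \<upsilon> \<sigma> *]
      by (simp add: B.gr_subset B.mult_tensor_tens[OF _ *(2)] \<Phi>_tens B.counit_smult)
  qed
qed

lemma cbr_eder:
  assumes \<upsilon>: "\<upsilon> \<in> eder B A 0" and \<sigma>: "\<sigma> \<in> eder B A n"
  shows "cbr n \<upsilon> \<sigma> \<in> eder B A n"
proof (rule ederI)
  note lin = eder_linear[OF \<upsilon>] eder_linear[OF \<sigma>]
  note cl = linear_closed[OF linear_cbr[OF lin]] bilinearD(1)[OF bilinear_cform[OF lin]]
  show "cbr n \<upsilon> \<sigma> \<in> Hom B A n" using \<upsilon> \<sigma> by (intro cbr_Hom eder_Hom)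
  show mult: "cbr n \<upsilon> \<sigma> (x \<otimes>\<^bsub>B\<^esub> y)
      = counit B x \<odot>\<^bsub>A\<^esub> cbr n \<upsilon> \<sigma> y \<oplus>\<^bsub>A\<^esub> counit B y \<odot>\<^bsub>A\<^esub> cbr n \<upsilon> \<sigma> x"
    if "x \<in> carrier B" "y \<in> carrier B" for x y
    using that tlift_cform_mult[OF \<upsilon> \<sigma>, of "comult B x" "comult B y"]
    by (simp add: cbr_apply[symmetric] B.comult_mult a_minus_def A.r_neg cl)
      (simp add: cbr_apply B.comult_mult)
  have "cbr n \<upsilon> \<sigma> \<one>\<^bsub>B\<^esub> \<oplus>\<^bsub>A\<^esub> cbr n \<upsilon> \<sigma> \<one>\<^bsub>B\<^esub> = cbr n \<upsilon> \<sigma> \<one>\<^bsub>B\<^esub>"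
    using mult[of "\<one>\<^bsub>B\<^esub>" "\<one>\<^bsub>B\<^esub>"] by (simp add: cl)
  then show "cbr n \<upsilon> \<sigma> \<one>\<^bsub>B\<^esub> = \<zero>\<^bsub>A\<^esub>" by (simp add: cl)
qed

lemma dd_cform_homogeneous:
  assumes \<upsilon>: "\<upsilon> \<in> THom B A" and \<sigma>: "\<sigma> \<in> Hom B A n" and x: "x \<in> gr B i" and y: "y \<in> gr B j"
  shows "dd A (cform n \<upsilon> \<sigma> x y)
    = cform (n + 1) \<upsilon> (hom_diff B A n \<sigma>) x y
      \<oplus>\<^bsub>A\<^esub> sgn_pow n \<odot>\<^bsub>A\<^esub> (cform n \<upsilon> \<sigma> (dd B x) y \<oplus>\<^bsub>A\<^esub> cform n \<upsilon> \<sigma> (ksgn B 1 x) (dd B y))"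
proof -
  note [simp] = B.gr_subset[OF x] B.gr_subset[OF y] THom_closed[OF \<upsilon>] Hom_closed[OF \<sigma>] THom_dd[OF \<upsilon>]
  note \<upsilon>x = eder_gr[OF THom_eder[OF \<upsilon>] x] and \<upsilon>y = eder_gr[OF THom_eder[OF \<upsilon>] y]
  have *: "sgn_pow n = (1 :: 'k) \<or> sgn_pow n = (- 1 :: 'k)" "sgn_pow i = (1 :: 'k) \<or> sgn_pow i = (- 1 :: 'k)"
    "sgn_pow (n * i) = (1 :: 'k) \<or> sgn_pow (n * i) = (- 1 :: 'k)" by (auto simp: sgn_pow_def)
  \<comment> \<open>Writing \<open>d \<circ> \<sigma>\<close> as \<open>D \<sigma> \<plusminus> \<sigma> \<circ> d\<close> makes both sides agree term by term, without cancellation.\<close>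
  have D: "dd A (\<sigma> z) = hom_diff B A n \<sigma> z \<oplus>\<^bsub>A\<^esub> sgn_pow n \<odot>\<^bsub>A\<^esub> \<sigma> (dd B z)" if "z \<in> carrier B" for z
    using that \<sigma>
    by (simp add: BA.hom_diff_apply Hom_closed A.minus_eq A.a_assoc A.l_neg)
  have [simp]: "hom_diff B A n \<sigma> x \<in> carrier A" "hom_diff B A n \<sigma> y \<in> carrier A"
    using linear_closed[OF BA.linear_hom_diff[OF Hom_linear[OF \<sigma>]]] by simp_all
  show ?thesis
    unfolding cform_def
    unfolding B.ksgn_homogeneous[OF x] B.ksgn_homogeneous[OF B.dd_gr[OF x]]
      B.ksgn_smult[OF B.gr_subset[OF x]]
    apply (simp add: linear_smult[OF THom_linear[OF \<upsilon>]] linear_smult[OF Hom_linear[OF \<sigma>]]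
        A.dd_add A.dd_smult D A.leibniz[OF \<upsilon>x Hom_gr[OF \<sigma> y]] A.leibniz[OF Hom_gr[OF \<sigma> x] \<upsilon>y]
        a_minus_def A.minus_eq_smult A.l_distr A.r_distr
        A.mult_smult A.smult_add_right A.smult_smult sgn_pow_add distrib_left distrib_right)
    using * apply (elim disjE; simp add: A.a_ac)
    done
qed

end

context hopf_cdga
begin

lemma dd_tlift_cform:
  assumes \<upsilon>: "\<upsilon> \<in> THom B A" and \<sigma>: "\<sigma> \<in> Hom B A n" and t: "t \<in> carrier (tspace B B)"
  shows "dd A (tlift B B A (cform n \<upsilon> \<sigma>) t)
    = tlift B B A (cform (n + 1) \<upsilon> (hom_diff B A n \<sigma>)) t
      \<oplus>\<^bsub>A\<^esub> sgn_pow n \<odot>\<^bsub>A\<^esub> tlift B B A (cform n \<upsilon> \<sigma>) (dd (tensor B B) t)"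
proof -
  note lin = THom_linear[OF \<upsilon>] Hom_linear[OF \<sigma>]
  note lin' = lin(1) BA.linear_hom_diff[OF lin(2), of n]
  note L = linear_tlift_cform[OF lin, of n] and L' = linear_tlift_cform[OF lin', of "n + 1"]
  note D = B.linear_dd_tensor
  note Z = linear_zero[OF B.AA.kspace_tspace A.kspace_axioms] linear_zero[OF B.AA.kspace_tspace B.AA.kspace_tspace]
  show ?thesis using t
  proof (induction rule: B.AA.tens_homogeneous_induct)
    case zero
    then show ?case by (simp add: Z(1)[OF L] Z(1)[OF L'] Z(2)[OF D])
  next
    case (add s t)
    then show ?case
      by (simp add: linear_add[OF L] linear_add[OF L'] linear_add[OF D] linear_closed[OF L]
          linear_closed[OF L'] linear_closed[OF D] A.dd_add A.smult_add_right A.a_ac)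
  next
    case (tens i j x y)
    then show ?case
      using dd_cform_homogeneous[OF \<upsilon> \<sigma> tens]
      by (simp add: B.gr_subset tlift_cform_tens[OF lin] tlift_cform_tens[OF lin'] B.dd_tensor_tens
          linear_add[OF L])
  qed
qed

text \<open>This makes the boundaries an ideal in the cocycles. It holds because the product of \<open>A\<close> and \<open>\<Delta>\<close> are
  cochain maps.\<close>

lemma hom_diff_cbr:
  assumes \<upsilon>: "\<upsilon> \<in> THom B A" and \<sigma>: "\<sigma> \<in> Hom B A n"
  shows "hom_diff B A n (cbr n \<upsilon> \<sigma>) = cbr (n + 1) \<upsilon> (hom_diff B A n \<sigma>)"
proof -
  note lin = THom_linear[OF \<upsilon>] Hom_linear[OF \<sigma>]
  note lin' = lin(1) BA.linear_hom_diff[OF lin(2), of n]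
  note cl = linear_closed[OF linear_tlift_cform[OF lin, of n]]
    linear_closed[OF linear_tlift_cform[OF lin', of "n + 1"]]
  show ?thesis
  proof (rule linear_eqI[OF BA.linear_hom_diff[OF linear_cbr[OF lin]] linear_cbr[OF lin'] refl])
    fix b assume b: "b \<in> carrier B"
    have "dd (tensor B B) (comult B b) \<in> carrier (tspace B B)"
      using b by (simp add: linear_closed[OF B.linear_dd_tensor])
    then show "hom_diff B A n (cbr n \<upsilon> \<sigma>) b = cbr (n + 1) \<upsilon> (hom_diff B A n \<sigma>) b"
      using b
      by (simp add: BA.hom_diff_apply[of _ n "cbr n \<upsilon> \<sigma>"] cbr_apply dd_tlift_cform[OF \<upsilon> \<sigma>] B.comult_dd cl
          a_minus_def A.a_assoc A.r_neg)
  qed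
qed

subsection \<open>Associativity and the Jacobi identity\<close>

text \<open>The convolution product of maps of degree \<open>0\<close>, for which no Koszul signs appear.\<close>

definition conv :: "('b \<Rightarrow> 'a) \<Rightarrow> ('b \<Rightarrow> 'a) \<Rightarrow> 'b \<Rightarrow> 'a" where
  "conv f g = compose (carrier B) (tlift B B A (\<lambda>x y. f x \<otimes>\<^bsub>A\<^esub> g y)) (comult B)"

lemma linear_conv:
  assumes "f \<in> linear_maps B A" "g \<in> linear_maps B A"
  shows "conv f g \<in> linear_maps B A"
  unfolding conv_def
  by (rule linear_compose[OF B.kspace_axioms B.comult_linear B.AA.linear_tlift[OF A.kspace_axioms bilinear_prod(2)[OF assms]]])

lemma conv_apply: "b \<in> carrier B \<Longrightarrow> conv f g b = tlift B B A (\<lambda>x y. f x \<otimes>\<^bsub>A\<^esub> g y) (comult B b)"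
  by (simp add: conv_def compose_def)

text \<open>Both sides are the map \<open>\<Psi> : x \<otimes> (y \<otimes> z) \<mapsto> f(x) g(y) h(z)\<close> applied to an iterated
  coproduct, \<open>(\<Delta> \<otimes> id) \<circ> \<Delta>\<close> on the left and \<open>(id \<otimes> \<Delta>) \<circ> \<Delta>\<close> on the right. Coassociativity identifies
  the two.\<close>

lemma conv_assoc:
  assumes f: "f \<in> linear_maps B A" and g: "g \<in> linear_maps B A" and h: "h \<in> linear_maps B A"
  shows "conv (conv f g) h = conv f (conv g h)"
proof -
  let ?BB = "tensor B B"
  let ?T = "tensor B ?BB"
  note KB = B.kspace_axioms and KA = A.kspace_axioms and KT2 = B.AA.kspace_tspace
  have KBB: "kspace ?BB" by (rule kspace_tensor[OF KB KB])
  interpret P1: kspace_pair ?BB B using KBB KB by (simp add: kspace_pair_def)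
  interpret P2: kspace_pair B ?BB using KBB KB by (simp add: kspace_pair_def)
  have KT: "kspace ?T" by (rule kspace_tensor[OF KB KBB])
  note fc = linear_closed[OF f] and gc = linear_closed[OF g] and hc = linear_closed[OF h]
  define G where "G = tlift B B A (\<lambda>x y. g x \<otimes>\<^bsub>A\<^esub> h y)"
  have G: "G \<in> linear_maps ?BB A" and G_tens: "G (tens B B x y) = g x \<otimes>\<^bsub>A\<^esub> h y"
    if "x \<in> carrier B" "y \<in> carrier B" for x y
    unfolding G_def using that B.AA.linear_tlift[OF KA bilinear_prod(2)[OF g h]]
      B.AA.tlift_tens[OF KA bilinear_prod(2)[OF g h]] by auto
  have G: "G \<in> linear_maps ?BB A" using G[OF B.zero_closed B.zero_closed] .
  have \<Psi>b: "bilinear B ?BB A (\<lambda>x u. f x \<otimes>\<^bsub>A\<^esub> G u)"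
    by (rule bilinear_compose[OF A.bilinear_mult f G])
  define \<Psi> where "\<Psi> = tlift B ?BB A (\<lambda>x u. f x \<otimes>\<^bsub>A\<^esub> G u)"
  have \<Psi>: "\<Psi> \<in> linear_maps ?T A"
    unfolding \<Psi>_def using P2.linear_tlift[OF KA \<Psi>b] by simp
  have \<Psi>_tens: "\<Psi> (tens B ?BB x u) = f x \<otimes>\<^bsub>A\<^esub> G u" if "x \<in> carrier B" "u \<in> carrier (tspace B B)" for x u
    unfolding \<Psi>_def using that by (simp add: P2.tlift_tens[OF KA \<Psi>b])
  have right: "\<Psi> (tmap B B B ?BB 0 (id_map B) (comult B) t) = tlift B B A (\<lambda>x y. f x \<otimes>\<^bsub>A\<^esub> conv g h y) t"
    if t: "t \<in> carrier (tspace B B)" for t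
  proof -
    have cm: "comult B \<in> linear_maps B ?BB" using B.comult_linear by simp
    have lin: "tmap B B B ?BB 0 (id_map B) (comult B) \<in> linear_maps (tspace B B) (tspace B ?BB)"
      by (rule B.AA.linear_tmap[OF KB KBB linear_id_map[OF KB] cm])
    have \<Psi>': "\<Psi> \<in> linear_maps (tspace B ?BB) A" using \<Psi> by simp
    have "compose (carrier (tspace B B)) \<Psi> (tmap B B B ?BB 0 (id_map B) (comult B)) t
        = tlift B B A (\<lambda>x y. f x \<otimes>\<^bsub>A\<^esub> conv g h y) t"
      by (rule B.AA.linear_eq_on_tens[OF KA linear_compose[OF KT2 lin \<Psi>']
            B.AA.linear_tlift[OF KA bilinear_prod(2)[OF f linear_conv[OF g h]]] _ t])
        (simp add: compose_def B.AA.tmap_tens[OF KB KBB linear_id_map[OF KB] cm] \<Psi>_tens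
          B.AA.tlift_tens[OF KA bilinear_prod(2)[OF f linear_conv[OF g h]]] conv_apply G_def[symmetric])
    then show ?thesis using t by (simp add: compose_def)
  qed
  \<comment> \<open>The two bilinear maps that define the associator.\<close>
  have inner: "bilinear B B ?T (\<lambda>u v. tens B ?BB u (tens B B v w))" if w: "w \<in> carrier B" for w
    using w bilinearD[OF B.AA.bilinear_tens] bilinearD[OF P2.bilinear_tens]
    by (intro bilinearI) simp_all
  have outer: "bilinear ?BB B ?T (\<lambda>t w. tlift B B ?T (\<lambda>u v. tens B ?BB u (tens B B v w)) t)"
  proof (rule bilinearI)
    fix t w assume "t \<in> carrier ?BB" and w: "w \<in> carrier B"
    then have t: "t \<in> carrier (tspace B B)" by simp
    note L = B.AA.linear_tlift[OF KT inner[OF w]]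
    show "tlift B B ?T (\<lambda>u v. tens B ?BB u (tens B B v w)) t \<in> carrier ?T"
      by (rule linear_closed[OF L t])
    show "tlift B B ?T (\<lambda>u v. tens B ?BB u (tens B B v w)) (c \<odot>\<^bsub>?BB\<^esub> t)
        = c \<odot>\<^bsub>?T\<^esub> tlift B B ?T (\<lambda>u v. tens B ?BB u (tens B B v w)) t" for c
      using linear_smult[OF L t] by simp
    show "tlift B B ?T (\<lambda>u v. tens B ?BB u (tens B B v (c \<odot>\<^bsub>B\<^esub> w))) t
        = c \<odot>\<^bsub>?T\<^esub> tlift B B ?T (\<lambda>u v. tens B ?BB u (tens B B v w)) t" for c
      using w bilinearD[OF B.AA.bilinear_tens] bilinearD[OF P2.bilinear_tens]
      by (intro B.AA.tlift_smult[OF KT inner inner _ t]) simp_all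
    fix s assume "s \<in> carrier ?BB"
    then show "tlift B B ?T (\<lambda>u v. tens B ?BB u (tens B B v w)) (t \<oplus>\<^bsub>?BB\<^esub> s)
        = tlift B B ?T (\<lambda>u v. tens B ?BB u (tens B B v w)) t
          \<oplus>\<^bsub>?T\<^esub> tlift B B ?T (\<lambda>u v. tens B ?BB u (tens B B v w)) s"
      using linear_add[OF L t, of s] by simp
  next
    fix t w w' assume "t \<in> carrier ?BB" and w: "w \<in> carrier B" "w' \<in> carrier B"
    then have t: "t \<in> carrier (tspace B B)" by simp
    show "tlift B B ?T (\<lambda>u v. tens B ?BB u (tens B B v (w \<oplus>\<^bsub>B\<^esub> w'))) t
        = tlift B B ?T (\<lambda>u v. tens B ?BB u (tens B B v w)) t
          \<oplus>\<^bsub>?T\<^esub> tlift B B ?T (\<lambda>u v. tens B ?BB u (tens B B v w')) t"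
      using w bilinearD[OF B.AA.bilinear_tens] bilinearD[OF P2.bilinear_tens]
      by (intro B.AA.tlift_add[OF KT inner inner inner _ t]) simp_all
  qed
  have left: "\<Psi> (tassoc B B B (tmap B B ?BB B 0 (comult B) (id_map B) t))
      = tlift B B A (\<lambda>x y. conv f g x \<otimes>\<^bsub>A\<^esub> h y) t"
    if t: "t \<in> carrier (tspace B B)" for t
  proof -
    have cm: "comult B \<in> linear_maps B ?BB" using B.comult_linear by simp
    have lin: "tmap B B ?BB B 0 (comult B) (id_map B) \<in> linear_maps (tspace B B) (tspace ?BB B)"
      by (rule B.AA.linear_tmap[OF KBB KB cm linear_id_map[OF KB]])
    have as: "tassoc B B B \<in> linear_maps (tspace ?BB B) ?T"
      unfolding tassoc_def by (rule P1.linear_tlift[OF KT outer])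
    have "compose (carrier (tspace B B)) \<Psi> (compose (carrier (tspace B B)) (tassoc B B B)
          (tmap B B ?BB B 0 (comult B) (id_map B))) t
        = tlift B B A (\<lambda>x y. conv f g x \<otimes>\<^bsub>A\<^esub> h y) t"
    proof (rule B.AA.linear_eq_on_tens[OF KA linear_compose[OF KT2 linear_compose[OF KT2 lin as] \<Psi>]
          B.AA.linear_tlift[OF KA bilinear_prod(2)[OF linear_conv[OF f g] h]] _ t])
      fix x y assume x: "x \<in> carrier B" and y: "y \<in> carrier B"
      have "tassoc B B B (tmap B B ?BB B 0 (comult B) (id_map B) (tens B B x y))
          = tlift B B ?T (\<lambda>u v. tens B ?BB u (tens B B v y)) (comult B x)"
        using x y
        by (simp add: B.AA.tmap_tens[OF KBB KB cm linear_id_map[OF KB]] tassoc_def P1.tlift_tens[OF KT outer])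
      also have "\<Psi> \<dots> = tlift B B A (\<lambda>u v. \<Psi> (tens B ?BB u (tens B B v y))) (comult B x)"
        using x by (intro B.AA.linear_tlift_apply[OF KT KA inner[OF y] \<Psi>]) simp
      also have "\<dots> = tlift B B A (\<lambda>u v. (\<lambda>z\<in>carrier A. z \<otimes>\<^bsub>A\<^esub> h y) (f u \<otimes>\<^bsub>A\<^esub> g v)) (comult B x)"
      proof (rule B.AA.tlift_cong[OF KA])
        show "bilinear B B A (\<lambda>u v. \<Psi> (tens B ?BB u (tens B B v y)))"
          by (rule linear_o_bilinear[OF inner[OF y] \<Psi>])
        show "bilinear B B A (\<lambda>u v. (\<lambda>z\<in>carrier A. z \<otimes>\<^bsub>A\<^esub> h y) (f u \<otimes>\<^bsub>A\<^esub> g v))"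
          by (rule linear_o_bilinear[OF bilinear_prod(2)[OF f g]])
            (auto intro!: linear_mapsI simp: A.l_distr A.mult_smult y hc)
      qed (use x y in \<open>simp_all add: \<Psi>_tens B.AA.tens_closed G_tens fc gc hc A.m_assoc\<close>)
      also have "\<dots> = (\<lambda>z\<in>carrier A. z \<otimes>\<^bsub>A\<^esub> h y) (conv f g x)"
        using x
        by (simp only: conv_apply)
          (intro B.AA.linear_tlift_apply[symmetric, OF KA KA bilinear_prod(2)[OF f g]],
            auto intro!: linear_mapsI simp: A.l_distr A.mult_smult y hc)
      finally show "compose (carrier (tspace B B)) \<Psi> (compose (carrier (tspace B B)) (tassoc B B B)
          (tmap B B ?BB B 0 (comult B) (id_map B))) (tens B B x y)
          = tlift B B A (\<lambda>x y. conv f g x \<otimes>\<^bsub>A\<^esub> h y) (tens B B x y)"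
        using x y by (simp add: compose_def linear_closed[OF linear_conv[OF f g]]
            B.AA.tlift_tens[OF KA bilinear_prod(2)[OF linear_conv[OF f g] h]])
    qed
    then show ?thesis using t by (simp add: compose_def)
  qed
  show ?thesis
  proof (rule linear_eqI[OF linear_conv[OF linear_conv[OF f g] h] linear_conv[OF f linear_conv[OF g h]] refl])
    fix b assume b: "b \<in> carrier B"
    then show "conv (conv f g) h b = conv f (conv g h) b"
      using left[of "comult B b"] right[of "comult B b"] B.coassoc[OF b] by (simp add: conv_apply)
  qed
qed

lemma cbr_eq_conv:
  assumes "\<upsilon> \<in> linear_maps B A" "\<sigma> \<in> linear_maps B A"
  shows "cbr 0 \<upsilon> \<sigma> = msub B A (conv \<upsilon> \<sigma>) (conv \<sigma> \<upsilon>)"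
proof (rule linear_eqI[OF linear_cbr[OF assms] linear_msub refl])
  fix b assume b: "b \<in> carrier B"
  note P = bilinear_prod(2)[OF assms] bilinear_prod(2)[OF assms(2,1)]
  have "tlift B B A (cform 0 \<upsilon> \<sigma>) (comult B b)
      = tlift B B A (\<lambda>x y. \<upsilon> x \<otimes>\<^bsub>A\<^esub> \<sigma> y) (comult B b) \<ominus>\<^bsub>A\<^esub> tlift B B A (\<lambda>x y. \<sigma> x \<otimes>\<^bsub>A\<^esub> \<upsilon> y) (comult B b)"
    using b by (intro B.AA.tlift_diff[OF A.kspace_axioms bilinear_cform[OF assms] P]) (simp_all add: cform_def)
  then show "cbr 0 \<upsilon> \<sigma> b = msub B A (conv \<upsilon> \<sigma>) (conv \<sigma> \<upsilon>) b"
    using b by (simp add: msub_def cbr_apply conv_apply)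
qed (intro linear_conv assms B.kspace_axioms A.kspace_axioms)+

lemma conv_msub:
  assumes f: "f \<in> linear_maps B A" and g: "g \<in> linear_maps B A" and h: "h \<in> linear_maps B A"
  shows "conv f (msub B A g h) = msub B A (conv f g) (conv f h)"
    and "conv (msub B A g h) f = msub B A (conv g f) (conv h f)"
proof -
  note K = A.kspace_axioms
  note S = linear_msub[OF B.kspace_axioms K]
  note gh = S[OF g h]
  note cl = linear_closed[OF f] linear_closed[OF g] linear_closed[OF h]
  show "conv f (msub B A g h) = msub B A (conv f g) (conv f h)"
  proof (rule linear_eqI[OF linear_conv[OF f gh] S[OF linear_conv[OF f g] linear_conv[OF f h]] refl])
    fix b assume b: "b \<in> carrier B"
    have "tlift B B A (\<lambda>x y. f x \<otimes>\<^bsub>A\<^esub> msub B A g h y) (comult B b)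
        = tlift B B A (\<lambda>x y. f x \<otimes>\<^bsub>A\<^esub> g y) (comult B b) \<ominus>\<^bsub>A\<^esub> tlift B B A (\<lambda>x y. f x \<otimes>\<^bsub>A\<^esub> h y) (comult B b)"
      using b
      by (intro B.AA.tlift_diff[OF K bilinear_prod(2)[OF f gh] bilinear_prod(2)[OF f g] bilinear_prod(2)[OF f h]])
        (simp_all add: msub_def a_minus_def A.r_distr A.r_minus cl)
    then show "conv f (msub B A g h) b = msub B A (conv f g) (conv f h) b"
      using b by (simp add: conv_apply) (simp add: msub_def conv_apply)
  qed
  show "conv (msub B A g h) f = msub B A (conv g f) (conv h f)"
  proof (rule linear_eqI[OF linear_conv[OF gh f] S[OF linear_conv[OF g f] linear_conv[OF h f]] refl])
    fix b assume b: "b \<in> carrier B"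
    have "tlift B B A (\<lambda>x y. msub B A g h x \<otimes>\<^bsub>A\<^esub> f y) (comult B b)
        = tlift B B A (\<lambda>x y. g x \<otimes>\<^bsub>A\<^esub> f y) (comult B b) \<ominus>\<^bsub>A\<^esub> tlift B B A (\<lambda>x y. h x \<otimes>\<^bsub>A\<^esub> f y) (comult B b)"
      using b
      by (intro B.AA.tlift_diff[OF K bilinear_prod(2)[OF gh f] bilinear_prod(2)[OF g f] bilinear_prod(2)[OF h f]])
        (simp_all add: msub_def a_minus_def A.l_distr A.l_minus cl)
    then show "conv (msub B A g h) f b = msub B A (conv g f) (conv h f) b"
      using b by (simp add: conv_apply) (simp add: msub_def conv_apply)
  qed
qed

lemma cbr_jacobi:
  assumes x: "x \<in> linear_maps B A" and y: "y \<in> linear_maps B A" and z: "z \<in> linear_maps B A"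
    and b: "b \<in> carrier B"
  shows "cbr 0 x (cbr 0 y z) b \<oplus>\<^bsub>A\<^esub> cbr 0 y (cbr 0 z x) b \<oplus>\<^bsub>A\<^esub> cbr 0 z (cbr 0 x y) b = \<zero>\<^bsub>A\<^esub>"
proof -
  note S = linear_msub[OF B.kspace_axioms A.kspace_axioms]
  have expand: "cbr 0 u (cbr 0 v w) b = (conv u (conv v w) b \<ominus>\<^bsub>A\<^esub> conv u (conv w v) b)
      \<ominus>\<^bsub>A\<^esub> (conv v (conv w u) b \<ominus>\<^bsub>A\<^esub> conv w (conv v u) b)"
    if u: "u \<in> linear_maps B A" and v: "v \<in> linear_maps B A" and w: "w \<in> linear_maps B A" for u v w
    using b
    by (simp add: cbr_eq_conv u v w S linear_conv conv_msub conv_assoc) (simp add: msub_def)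
  have cancel: "((p \<ominus>\<^bsub>A\<^esub> q) \<ominus>\<^bsub>A\<^esub> (r \<ominus>\<^bsub>A\<^esub> s)) \<oplus>\<^bsub>A\<^esub> ((r \<ominus>\<^bsub>A\<^esub> t) \<ominus>\<^bsub>A\<^esub> (u \<ominus>\<^bsub>A\<^esub> q)) \<oplus>\<^bsub>A\<^esub> ((u \<ominus>\<^bsub>A\<^esub> s) \<ominus>\<^bsub>A\<^esub> (p \<ominus>\<^bsub>A\<^esub> t)) = \<zero>\<^bsub>A\<^esub>"
    if "p \<in> carrier A" "q \<in> carrier A" "r \<in> carrier A" "s \<in> carrier A" "t \<in> carrier A" "u \<in> carrier A" for p q r s t u
    using that by algebra
  show ?thesis
    unfolding expand[OF x y z] expand[OF y z x] expand[OF z x y]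
    using b x y z by (intro cancel) (simp_all add: linear_closed[OF linear_conv] linear_conv)
qed

lemma conv_commutator_eq_cbr:
  assumes f: "f \<in> linear_maps B A" and g: "g \<in> linear_maps B A"
  shows "conv_commutator B A f g = cbr 0 f g"
proof
  note K = A.kspace_axioms
  note tm = B.AA.linear_tmap[OF K K f g, of 0] B.AA.linear_tmap[OF K K g f, of 0]
  have eq: "mult_map A (tmap B B A A 0 u v t) = tlift B B A (\<lambda>x y. u x \<otimes>\<^bsub>A\<^esub> v y) t"
    if u: "u \<in> linear_maps B A" and v: "v \<in> linear_maps B A" and t: "t \<in> carrier (tspace B B)" for u v t
  proof -
    have "compose (carrier (tspace B B)) (mult_map A) (tmap B B A A 0 u v) t = tlift B B A (\<lambda>x y. u x \<otimes>\<^bsub>A\<^esub> v y) t"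
      by (rule B.AA.linear_eq_on_tens[OF K linear_compose[OF B.AA.kspace_tspace
              B.AA.linear_tmap[OF K K u v] A.linear_mult_map] B.AA.linear_tlift[OF K bilinear_prod(2)[OF u v]] _ t])
        (simp add: compose_def B.AA.tmap_tens[OF K K u v] linear_closed[OF u] linear_closed[OF v]
          B.AA.tlift_tens[OF K bilinear_prod(2)[OF u v]])
    then show ?thesis using t by (simp add: compose_def)
  qed
  fix b
  show "conv_commutator B A f g b = cbr 0 f g b"
  proof (cases "b \<in> carrier B")
    case True
    then show ?thesis
      by (simp add: conv_commutator_def compose_def msub_def cbr_eq_conv[OF f g] conv_apply
          linear_diff[OF A.AA.kspace_tspace K A.linear_mult_map] linear_closed[OF tm(1)] linear_closed[OF tm(2)]
          eq[OF f g] eq[OF g f])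
  next
    case False
    then show ?thesis by (simp add: conv_commutator_def cbr_def compose_def)
  qed
qed

end

section \<open>Polynomial homotopies\<close>

context dg_pair
begin

lemma Hom_polyD: "f \<in> Hom_poly V W n \<Longrightarrow> f k \<in> Hom V W n"
  by (simp add: Hom_poly_def)

lemma Hom_polyI: "(\<And>k. f k \<in> Hom V W n) \<Longrightarrow> (\<And>k. k > N \<Longrightarrow> f k = zmap V W) \<Longrightarrow> f \<in> Hom_poly V W n"
proof -
  assume "\<And>k. f k \<in> Hom V W n" "\<And>k. k > N \<Longrightarrow> f k = zmap V W"
  moreover from this(2) have "{k. f k \<noteq> zmap V W} \<subseteq> {..N}" by (auto simp: not_less[symmetric])
  ultimately show "f \<in> Hom_poly V W n" by (auto simp: Hom_poly_def finite_subset)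
qed

lemma Hom_poly_bound: "f \<in> Hom_poly V W n \<Longrightarrow> \<exists>N. \<forall>k>N. f k = zmap V W"
  using finite_nat_set_iff_bounded_le[of "{k. f k \<noteq> zmap V W}"]
  by (auto simp: Hom_poly_def not_le[symmetric])

lemma teval_eq_finsum:
  assumes "\<And>k. f k \<in> Hom V W n" "\<And>k. k > N \<Longrightarrow> f k = zmap V W" "x \<in> carrier V"
  shows "teval V W f c x = finsum W (\<lambda>k. c ^ k \<odot>\<^bsub>W\<^esub> f k x) {..N}"
proof -
  have "{k. f k \<noteq> zmap V W} \<subseteq> {..N}" using assms(2) by (auto simp: not_less[symmetric])
  then have "finsum W (\<lambda>k. c ^ k \<odot>\<^bsub>W\<^esub> f k x) {k. f k \<noteq> zmap V W} = finsum W (\<lambda>k. c ^ k \<odot>\<^bsub>W\<^esub> f k x) {..N}"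
    using assms(1,3) by (intro W.finsum_superset) (auto simp: Hom_closed[OF assms(1)], simp add: zmap_def)
  then show ?thesis using assms(3) by (simp add: teval_def)
qed

lemma teval_zero:
  assumes f: "f \<in> Hom_poly V W n"
  shows "teval V W f 0 = f 0"
proof
  fix x
  obtain N where N: "\<And>k. k > N \<Longrightarrow> f k = zmap V W" using Hom_poly_bound[OF f] by blast
  show "teval V W f 0 x = f 0 x"
  proof (cases "x \<in> carrier V")
    case True
    have "finsum W (\<lambda>k. 0 ^ k \<odot>\<^bsub>W\<^esub> f k x) {0} = finsum W (\<lambda>k. 0 ^ k \<odot>\<^bsub>W\<^esub> f k x) {..N}"
      using True Hom_closed[OF Hom_polyD[OF f]]
      by (intro W.finsum_superset) (auto simp: power_0_left)
    then show ?thesis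
      using True teval_eq_finsum[where f = f and c = 0 and N = N, OF Hom_polyD[OF f] N True] Hom_closed[OF Hom_polyD[OF f]] by simp
  next
    case False
    then show ?thesis using linear_undefined[OF Hom_linear[OF Hom_polyD[OF f]]] by (simp add: teval_def)
  qed
qed

end

text \<open>Integrating a homotopy pair from \<open>0\<close> to \<open>1\<close>: the endpoints differ by the boundary of
  \<open>\<integral> \<xi>(t) dt\<close>. The set \<open>S\<close> records linear conditions that pass from the coefficients of \<open>\<xi>\<close> to the integral.\<close>

lemma homotopy_integral:
  fixes V :: "('k::field_char_0, 'a, 'm) dgmod_scheme" and W :: "('k, 'b, 'n) dgmod_scheme"
  assumes "dg_pair V W"
    and f: "f \<in> Hom_poly V W 0" and \<xi>: "\<xi> \<in> Hom_poly V W (- 1)"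
    and deriv: "\<And>k. tderiv V W f k = hom_diff V W (- 1) (\<xi> k)"
    and S: "zmap V W \<in> S" "\<And>\<sigma> \<tau>. \<sigma> \<in> S \<Longrightarrow> \<tau> \<in> S \<Longrightarrow> madd V W \<sigma> \<tau> \<in> S"
      "\<And>c \<sigma>. \<sigma> \<in> S \<Longrightarrow> mscale V W c \<sigma> \<in> S" "\<And>\<sigma>. \<sigma> \<in> S \<Longrightarrow> \<sigma> \<in> linear_maps V W"
    and \<xi>S: "\<And>k. \<xi> k \<in> S"
  shows "\<exists>\<eta>\<in>S. teval V W f 1 = madd V W (f 0) (hom_diff V W (- 1) \<eta>)"
proof -
  interpret dg_pair V W by fact
  note lin = Hom_linear[OF Hom_polyD[OF f]]
  note cl = linear_closed[OF lin]
  have step: "f (Suc k) x = (1 / of_nat (Suc k)) \<odot>\<^bsub>W\<^esub> hom_diff V W (- 1) (\<xi> k) x" if "x \<in> carrier V" for k x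
  proof -
    have eq: "hom_diff V W (- 1) (\<xi> k) x = of_nat (Suc k) \<odot>\<^bsub>W\<^esub> f (Suc k) x"
      using fun_cong[OF deriv[of k], of x] that by (simp add: tderiv_def mscale_def)
    show ?thesis
      unfolding eq W.smult_smult[OF cl[OF that]] using cl[OF that] by (simp del: of_nat_Suc)
  qed
  \<comment> \<open>By induction \<open>\<eta> = \<Sum>k<N. \<xi>\<^sub>k / (k + 1)\<close>, since \<open>f\<^sub>k\<^sub>+\<^sub>1 = D \<xi>\<^sub>k / (k + 1)\<close>.\<close>
  have partial: "\<exists>\<eta>\<in>S. \<forall>x\<in>carrier V. finsum W (\<lambda>k. f k x) {..N} = f 0 x \<oplus>\<^bsub>W\<^esub> hom_diff V W (- 1) \<eta> x" for N
  proof (induction N)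
    case 0
    show ?case by (intro bexI[OF _ S(1)]) (simp add: hom_diff_zmap cl, simp add: zmap_def cl)
  next
    case (Suc N)
    then obtain \<eta> where \<eta>: "\<eta> \<in> S"
      "\<And>x. x \<in> carrier V \<Longrightarrow> finsum W (\<lambda>k. f k x) {..N} = f 0 x \<oplus>\<^bsub>W\<^esub> hom_diff V W (- 1) \<eta> x" by blast
    let ?\<xi> = "mscale V W (1 / of_nat (Suc N)) (\<xi> N)"
    have \<eta>\<xi>: "\<eta> \<in> linear_maps V W" "\<xi> N \<in> linear_maps V W" "?\<xi> \<in> linear_maps V W"
      using \<eta>(1) \<xi>S S by blast+
    have "finsum W (\<lambda>k. f k x) {..Suc N} = f 0 x \<oplus>\<^bsub>W\<^esub> hom_diff V W (- 1) (madd V W \<eta> ?\<xi>) x"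
      if x: "x \<in> carrier V" for x
    proof -
      have "finsum W (\<lambda>k. f k x) {..Suc N} = f (Suc N) x \<oplus>\<^bsub>W\<^esub> (f 0 x \<oplus>\<^bsub>W\<^esub> hom_diff V W (- 1) \<eta> x)"
        using x cl \<eta>(2)[OF x] by (simp add: W.finsum_Suc)
      also have "\<dots> = f 0 x \<oplus>\<^bsub>W\<^esub> (hom_diff V W (- 1) \<eta> x \<oplus>\<^bsub>W\<^esub> hom_diff V W (- 1) ?\<xi> x)"
        using x cl linear_closed[OF linear_hom_diff] \<eta>\<xi>
        by (simp add: step hom_diff_mscale W.a_ac) (simp add: mscale_def)
      finally show ?thesis using x \<eta>\<xi> by (simp add: hom_diff_madd) (simp add: madd_def)
    qed
    moreover have "madd V W \<eta> ?\<xi> \<in> S" using \<eta>(1) \<xi>S S by blast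
    ultimately show ?case by blast
  qed
  obtain N where N: "\<And>k. k > N \<Longrightarrow> f k = zmap V W" using Hom_poly_bound[OF f] by blast
  from partial[of N] obtain \<eta> where \<eta>: "\<eta> \<in> S"
    "\<And>x. x \<in> carrier V \<Longrightarrow> finsum W (\<lambda>k. f k x) {..N} = f 0 x \<oplus>\<^bsub>W\<^esub> hom_diff V W (- 1) \<eta> x" by blast
  have "teval V W f 1 = madd V W (f 0) (hom_diff V W (- 1) \<eta>)"
  proof
    fix x
    show "teval V W f 1 x = madd V W (f 0) (hom_diff V W (- 1) \<eta>) x"
    proof (cases "x \<in> carrier V")
      case True
      have "teval V W f 1 x = finsum W (\<lambda>k. f k x) {..N}"
        using teval_eq_finsum[where f = f and c = 1 and N = N, OF Hom_polyD[OF f] N True] True cl by (simp cong: W.finsum_cong)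
      then show ?thesis using \<eta>(2)[OF True] True by (simp add: madd_def)
    qed (simp add: teval_def madd_def)
  qed
  with \<eta>(1) show ?thesis by blast
qed

section \<open>Homotopy of tangential morphisms is homology\<close>

text \<open>Since the conditions on a homotopy pair of tangential morphisms are linear, such a pair can be
  integrated, and conversely \<open>\<upsilon> + t D \<sigma>\<close> joins \<open>\<upsilon>\<close> to \<open>\<upsilon> + D \<sigma>\<close>. So homotopy types are
  homology classes; in particular the elementary homotopies already form an equivalence relation.\<close>

lemma thom_homotopic_iff:
  fixes B :: "('k::field_char_0, 'b) hopf" and A :: "('k, 'a, 'm) dgmod_scheme"
  assumes "hopf_cdga B A"
  shows "thom_homotopic B A g h \<longleftrightarrow> g \<in> THom B A \<and> h \<in> THom B A \<and>
    (\<exists>\<sigma>\<in>eder B A (- 1). h = madd B A g (hom_diff B A (- 1) \<sigma>))"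
proof -
  interpret hopf_cdga B A by fact
  show ?thesis
  proof (intro iffI; (elim conjE)?)
    assume "thom_homotopic B A g h"
    then obtain \<upsilon> \<sigma> where gh: "g \<in> THom B A" "h \<in> THom B A" and pair: "thom_hpair B A \<upsilon> \<sigma>"
      and ev: "teval B A \<upsilon> 0 = g" "teval B A \<upsilon> 1 = h"
      by (auto simp: thom_homotopic_def)
    have \<upsilon>: "\<upsilon> \<in> Hom_poly B A 0" and \<sigma>: "\<sigma> \<in> Hom_poly B A (- 1)"
      and deriv: "\<And>k. tderiv B A \<upsilon> k = hom_diff B A (- 1) (\<sigma> k)"
      and \<sigma>e: "\<And>k. \<sigma> k \<in> eder B A (- 1)"
      using pair by (auto simp: thom_hpair_def eder_iff BA.Hom_polyD)
    have "\<exists>\<eta>\<in>eder B A (- 1). teval B A \<upsilon> 1 = madd B A (\<upsilon> 0) (hom_diff B A (- 1) \<eta>)"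
      by (rule homotopy_integral[OF BA.dg_pair_axioms \<upsilon> \<sigma> deriv eder_zmap])
        (erule (1) eder_madd, erule eder_mscale, erule eder_linear, rule \<sigma>e)
    then show "g \<in> THom B A \<and> h \<in> THom B A \<and> (\<exists>\<sigma>\<in>eder B A (- 1). h = madd B A g (hom_diff B A (- 1) \<sigma>))"
      using gh ev BA.teval_zero[OF \<upsilon>] by simp
  next
    assume g: "g \<in> THom B A" and h: "h \<in> THom B A"
      and "\<exists>\<sigma>\<in>eder B A (- 1). h = madd B A g (hom_diff B A (- 1) \<sigma>)"
    then obtain \<sigma> where \<sigma>: "\<sigma> \<in> eder B A (- 1)" and eq: "h = madd B A g (hom_diff B A (- 1) \<sigma>)" by blast
    \<comment> \<open>The coefficients of the path \<open>g + t D \<sigma>\<close> and of the constant \<open>\<sigma>\<close>.\<close>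
    define u where "u k = (if k = 0 then g else if k = 1 then hom_diff B A (- 1) \<sigma> else zmap B A)" for k :: nat
    define s where "s k = (if k = 0 then \<sigma> else zmap B A)" for k :: nat
    have uH: "u k \<in> Hom B A 0" for k
      using eder_Hom[OF THom_eder[OF g]] BA.hom_diff_Hom[OF eder_Hom[OF \<sigma>]] BA.zmap_Hom by (simp add: u_def)
    have u: "u \<in> Hom_poly B A 0" by (rule BA.Hom_polyI[OF uH, of 1]) (simp add: u_def)
    have s: "s \<in> Hom_poly B A (- 1)"
      by (rule BA.Hom_polyI[of _ _ 0]) (use \<sigma> eder_Hom BA.zmap_Hom in \<open>auto simp: s_def\<close>)
    have se: "s k \<in> eder B A (- 1)" for k using \<sigma> eder_zmap by (simp add: s_def)
    have "tderiv B A u k = hom_diff B A (- 1) (s k)" for k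
    proof (cases k)
      case 0
      have D: "hom_diff B A (- 1) \<sigma> \<in> linear_maps B A" by (rule BA.linear_hom_diff[OF eder_linear[OF \<sigma>]])
      then show ?thesis using 0
        by (auto simp: tderiv_def u_def s_def mscale_def fun_eq_iff linear_closed[OF D] linear_undefined[OF D])
    next
      case (Suc m)
      then show ?thesis by (simp add: tderiv_def u_def s_def BA.hom_diff_zmap)
        (auto simp: mscale_def zmap_def fun_eq_iff)
    qed
    moreover have ev0: "teval B A u 0 = g" by (simp add: BA.teval_zero[OF u]) (simp add: u_def)
    moreover have "teval B A u 1 = h"
    proof
      fix x
      show "teval B A u 1 x = h x"
      proof (cases "x \<in> carrier B")
        case True
        have "teval B A u 1 x = finsum A (\<lambda>k. 1 ^ k \<odot>\<^bsub>A\<^esub> u k x) {..Suc 0}"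
          using True by (intro BA.teval_eq_finsum[OF uH]) (auto simp: u_def)
        also have "\<dots> = u 1 x \<oplus>\<^bsub>A\<^esub> u 0 x"
          using True Hom_closed[OF uH] by (subst A.finsum_Suc) auto
        also have "\<dots> = h x"
          using True Hom_closed[OF uH, of x] Hom_closed[OF uH, of x 0] Hom_closed[OF uH, of x 1]
          by (simp add: eq madd_def u_def A.a_comm)
        finally show ?thesis .
      next
        case False
        then show ?thesis by (simp add: teval_def eq madd_def)
      qed
    qed
    moreover have "thom_hpair B A u s"
      unfolding thom_hpair_def using u s calculation g se by (simp add: eder_iff)
    ultimately show "thom_homotopic B A g h" using g h unfolding thom_homotopic_def by blast
  qed
qed

lemma thom_class_eq_iff:
  fixes B :: "('k::field_char_0, 'b) hopf" and A :: "('k, 'a, 'm) dgmod_scheme"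
  assumes "hopf_cdga B A" and g: "g \<in> THom B A" and h: "h \<in> THom B A"
  shows "thom_class B A g = thom_class B A h \<longleftrightarrow> thom_homotopic B A g h"
proof -
  interpret hopf_cdga B A by fact
  note iff = thom_homotopic_iff[OF assms(1)]
  have homotopicI: "thom_homotopic B A u v" if "u \<in> THom B A" "v \<in> THom B A" "\<sigma> \<in> eder B A (- 1)"
    "v = madd B A u (hom_diff B A (- 1) \<sigma>)" for u v \<sigma> using that by (auto simp: iff)
  have refl: "thom_homotopic B A u u" if u: "u \<in> THom B A" for u
  proof -
    have "u = madd B A u (hom_diff B A (- 1) (zmap B A))"
      unfolding BA.hom_diff_zmap
      by (auto simp: madd_def zmap_def fun_eq_iff THom_closed[OF u] linear_undefined[OF THom_linear[OF u]])
    then show ?thesis using homotopicI[OF u u eder_zmap] by metis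
  qed
  have sym: "thom_homotopic B A v u" if uv: "thom_homotopic B A u v" for u v
  proof -
    from uv obtain \<sigma> where \<sigma>: "u \<in> THom B A" "v \<in> THom B A" "\<sigma> \<in> eder B A (- 1)"
      "v = madd B A u (hom_diff B A (- 1) \<sigma>)" unfolding iff by blast
    have "u = madd B A v (hom_diff B A (- 1) (mscale B A (- 1) \<sigma>))"
    proof
      fix x
      have "p = p \<oplus>\<^bsub>A\<^esub> q \<oplus>\<^bsub>A\<^esub> (- 1) \<odot>\<^bsub>A\<^esub> q" if "p \<in> carrier A" "q \<in> carrier A" for p q
        using that by (simp add: A.minus_eq_smult[symmetric] A.a_assoc A.r_neg)
      then show "u x = madd B A v (hom_diff B A (- 1) (mscale B A (- 1) \<sigma>)) x"
        unfolding BA.hom_diff_mscale[OF eder_linear[OF \<sigma>(3)]]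
        by (cases "x \<in> carrier B")
          (simp_all add: \<sigma>(4) madd_def mscale_def
            THom_closed[OF \<sigma>(1)] linear_undefined[OF THom_linear[OF \<sigma>(1)]]
            linear_closed[OF BA.linear_hom_diff[OF eder_linear[OF \<sigma>(3)]]])
    qed
    then show ?thesis by (rule homotopicI[OF \<sigma>(2,1) eder_mscale[OF \<sigma>(3)]])
  qed
  have trans: "thom_homotopic B A u w" if uv: "thom_homotopic B A u v" and vw: "thom_homotopic B A v w" for u v w
  proof -
    from uv obtain \<sigma> where \<sigma>: "u \<in> THom B A" "\<sigma> \<in> eder B A (- 1)"
      "v = madd B A u (hom_diff B A (- 1) \<sigma>)" unfolding iff by blast
    from vw obtain \<tau> where \<tau>: "w \<in> THom B A" "\<tau> \<in> eder B A (- 1)"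
      "w = madd B A v (hom_diff B A (- 1) \<tau>)" unfolding iff by blast
    have "w = madd B A u (hom_diff B A (- 1) (madd B A \<sigma> \<tau>))"
    proof
      fix x
      show "w x = madd B A u (hom_diff B A (- 1) (madd B A \<sigma> \<tau>)) x"
        using linear_closed[OF THom_linear[OF \<sigma>(1)]]
          linear_closed[OF BA.linear_hom_diff[OF eder_linear[OF \<sigma>(2)]], of x "- 1"]
          linear_closed[OF BA.linear_hom_diff[OF eder_linear[OF \<tau>(2)]], of x "- 1"]
        by (simp only: \<tau>(3) \<sigma>(3) BA.hom_diff_madd[OF eder_linear[OF \<sigma>(2)] eder_linear[OF \<tau>(2)]])
          (simp add: madd_def A.a_assoc)
    qed
    then show ?thesis by (rule homotopicI[OF \<sigma>(1) \<tau>(1) eder_madd[OF \<sigma>(2) \<tau>(2)]])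
  qed
  show ?thesis
  proof
    assume "thom_class B A g = thom_class B A h"
    moreover have "h \<in> thom_class B A h" using refl[OF h] h by (simp add: thom_class_def)
    ultimately have "h \<in> thom_class B A g" by simp
    then show "thom_homotopic B A g h" by (simp add: thom_class_def)
  next
    assume "thom_homotopic B A g h"
    then show "thom_class B A g = thom_class B A h"
      using sym trans unfolding thom_class_def by blast
  qed
qed

section \<open>Algebra maps and their homotopies\<close>

lemma cdga_homD:
  assumes "f \<in> cdga_hom A A'"
  shows cdga_hom_Hom: "f \<in> Hom A A' 0" and cdga_hom_linear: "f \<in> linear_maps A A'"
    and cdga_hom_one: "f \<one>\<^bsub>A\<^esub> = \<one>\<^bsub>A'\<^esub>"
    and cdga_hom_mult: "\<And>x y. x \<in> carrier A \<Longrightarrow> y \<in> carrier A \<Longrightarrow> f (x \<otimes>\<^bsub>A\<^esub> y) = f x \<otimes>\<^bsub>A'\<^esub> f y"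
    and cdga_hom_dd: "\<And>x. x \<in> carrier A \<Longrightarrow> f (dd A x) = dd A' (f x)"
proof -
  show "f (dd A x) = dd A' (f x)" if "x \<in> carrier A" for x
  proof -
    have "compose (carrier A) f (dd A) x = compose (carrier A) (dd A') f x"
      using assms by (simp add: cdga_hom_def)
    then show ?thesis using that by (simp add: compose_def)
  qed
qed (use assms in \<open>auto simp: cdga_hom_def dest: Hom_linear\<close>)

lemma cdga_homI:
  assumes "f \<in> Hom A A' 0" "f \<one>\<^bsub>A\<^esub> = \<one>\<^bsub>A'\<^esub>"
    "\<And>x y. x \<in> carrier A \<Longrightarrow> y \<in> carrier A \<Longrightarrow> f (x \<otimes>\<^bsub>A\<^esub> y) = f x \<otimes>\<^bsub>A'\<^esub> f y"
    "\<And>x. x \<in> carrier A \<Longrightarrow> f (dd A x) = dd A' (f x)"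
  shows "f \<in> cdga_hom A A'"
  using assms by (auto simp: cdga_hom_def compose_def fun_eq_iff)

lemma Hom_compose:
  assumes "graded_space U" "f \<in> Hom U V m" "g \<in> Hom V W n"
  shows "compose (carrier U) g f \<in> Hom U W (m + n)"
proof -
  interpret graded U using assms(1) by (simp add: graded_iff)
  show ?thesis
  proof (rule HomI[OF linear_compose[OF kspace_axioms Hom_linear[OF assms(2)] Hom_linear[OF assms(3)]]])
    fix i x assume x: "x \<in> gr U i"
    then show "compose (carrier U) g f x \<in> gr W (i + (m + n))"
      using Hom_gr[OF assms(3) Hom_gr[OF assms(2) x]] gr_subset[OF x] by (simp add: compose_def add.assoc)
  qed
qed

lemma cdga_hom_compose:
  assumes "graded_space A" "f \<in> cdga_hom A A'" "g \<in> cdga_hom A' A''"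
    "\<one>\<^bsub>A\<^esub> \<in> carrier A" "\<And>x y. x \<in> carrier A \<Longrightarrow> y \<in> carrier A \<Longrightarrow> x \<otimes>\<^bsub>A\<^esub> y \<in> carrier A"
    "\<And>x. x \<in> carrier A \<Longrightarrow> dd A x \<in> carrier A"
  shows "compose (carrier A) g f \<in> cdga_hom A A''"
proof (rule cdga_homI)
  show "compose (carrier A) g f \<in> Hom A A'' 0"
    using Hom_compose[OF assms(1) cdga_hom_Hom[OF assms(2)] cdga_hom_Hom[OF assms(3)]] by simp
  note cl = linear_closed[OF cdga_hom_linear[OF assms(2)]]
qed (use assms in \<open>simp_all add: compose_def cdga_hom_one cdga_hom_mult cdga_hom_dd
      linear_closed[OF cdga_hom_linear[OF assms(2)]]\<close>)

locale cdga_pair = A: cdga A + A': cdga A'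
  for A :: "('k::field, 'a, 'm) dgmod_scheme" and A' :: "('k, 'b, 'n) dgmod_scheme"
begin

sublocale AA': dg_pair A A' ..

lemma finsum_tensor [simp]: "finsum (tensor A' A') = finsum (tspace A' A')"
  by (simp add: finsum_def fun_eq_iff)

lemma linear_tmap_poly:
  assumes "\<And>i. f i \<in> linear_maps A A'" "\<And>i. g i \<in> linear_maps A A'"
  shows "tmap_poly A A A' A' n f g k \<in> linear_maps (tspace A A) (tspace A' A')"
proof -
  interpret T: kspace "tspace A A" by (rule A.AA.kspace_tspace)
  interpret T': kspace "tspace A' A'" by (rule A'.AA.kspace_tspace)
  have lin: "tmap A A A' A' n (f i) (g j) \<in> linear_maps (tspace A A) (tspace A' A')" for i j
    by (intro A.AA.linear_tmap A'.kspace_axioms assms)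
  note cl = linear_closed[OF lin]
  show ?thesis
    unfolding tmap_poly_def
    by (rule linear_mapsI)
      (use cl in \<open>simp_all add: Pi_def linear_add[OF lin] linear_smult[OF lin] T'.finsum_add T'.finsum_smult\<close>)
qed

lemma linear_tderivation:
  assumes "\<And>i. f i \<in> linear_maps A A'" "\<And>i. g i \<in> linear_maps A A'"
  shows "tderivation A A' f g k \<in> linear_maps (tspace A A) (tspace A' A')"
proof -
  have "madd (tensor A A) (tensor A' A') u v = madd (tspace A A) (tspace A' A') u v" for u v
    by (simp add: madd_def)
  then show ?thesis
    unfolding tderivation_def using assms
    by (auto intro!: linear_madd linear_tmap_poly A.AA.kspace_tspace A'.AA.kspace_tspace)
qed

lemma tderivation_tens:
  assumes f: "\<And>i. f i \<in> linear_maps A A'" and g: "\<And>i. g i \<in> linear_maps A A'"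
    and xy: "x \<in> carrier A" "y \<in> carrier A"
  shows "mult_map A' (tderivation A A' f g k (tens A A x y))
    = finsum A' (\<lambda>i. f i (ksgn A (- 1) x) \<otimes>\<^bsub>A'\<^esub> g (k - i) y) {..k}
      \<oplus>\<^bsub>A'\<^esub> finsum A' (\<lambda>i. g i x \<otimes>\<^bsub>A'\<^esub> f (k - i) y) {..k}"
proof -
  note K' = A'.kspace_axioms
  interpret T': kspace "tspace A' A'" by (rule A'.AA.kspace_tspace)
  note cl = linear_closed[OF f] linear_closed[OF g]
  have tm: "tmap_poly A A A' A' n u v k (tens A A x y)
      = finsum (tspace A' A') (\<lambda>i. tens A' A' (u i (ksgn A n x)) (v (k - i) y)) {..k}"
    if "\<And>i. u i \<in> linear_maps A A'" "\<And>i. v i \<in> linear_maps A A'" for n u v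
    using xy that
    by (auto simp: tmap_poly_def A.AA.tmap_tens[OF K' K'] linear_closed[OF that(1)] linear_closed[OF that(2)]
        intro!: T'.finsum_cong')
  show ?thesis
    using xy
    by (simp add: tderivation_def madd_def tm f g cl Pi_def linear_add[OF A'.linear_mult_map]
        linear_finsum[OF T'.kspace_axioms K' A'.linear_mult_map])
qed

lemma derivation_condition_iff:
  assumes f: "\<And>i. f i \<in> linear_maps A A'" and \<xi>: "\<And>i. \<xi> i \<in> linear_maps A A'"
  shows "compose (carrier (tensor A A)) (\<xi> k) (mult_map A)
      = compose (carrier (tensor A A)) (mult_map A') (tderivation A A' f \<xi> k) \<longleftrightarrow>
    (\<forall>x\<in>carrier A. \<forall>y\<in>carrier A. \<xi> k (x \<otimes>\<^bsub>A\<^esub> y)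
      = finsum A' (\<lambda>i. f i (ksgn A (- 1) x) \<otimes>\<^bsub>A'\<^esub> \<xi> (k - i) y) {..k}
        \<oplus>\<^bsub>A'\<^esub> finsum A' (\<lambda>i. \<xi> i x \<otimes>\<^bsub>A'\<^esub> f (k - i) y) {..k})"
proof -
  note td = tderivation_tens[where f = f and g = \<xi>, OF f \<xi>]
  have "compose (carrier (tensor A A)) (mult_map A') (tderivation A A' f \<xi> k) \<in> linear_maps (tspace A A) A'"
    using linear_compose[OF A.AA.kspace_tspace linear_tderivation[where f = f and g = \<xi>, OF f \<xi>] A'.linear_mult_map]
    by simp
  from A.mult_map_eq_iff[OF A'.kspace_axioms \<xi> this, of k] show ?thesis
    by (simp add: compose_eq A.AA.tens_closed td)
qed

lemma cdga_hpair_iff: "cdga_hpair A A' f \<xi> \<longleftrightarrow>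
    f \<in> Hom_poly A A' 0 \<and> \<xi> \<in> Hom_poly A A' (- 1) \<and>
    (\<forall>k. tderiv A A' f k = hom_diff A A' (- 1) (\<xi> k)) \<and> f 0 \<in> cdga_hom A A' \<and>
    (\<forall>k. \<xi> k \<one>\<^bsub>A\<^esub> = \<zero>\<^bsub>A'\<^esub>) \<and>
    (\<forall>k. \<forall>x\<in>carrier A. \<forall>y\<in>carrier A. \<xi> k (x \<otimes>\<^bsub>A\<^esub> y)
      = finsum A' (\<lambda>i. f i (ksgn A (- 1) x) \<otimes>\<^bsub>A'\<^esub> \<xi> (k - i) y) {..k}
        \<oplus>\<^bsub>A'\<^esub> finsum A' (\<lambda>i. \<xi> i x \<otimes>\<^bsub>A'\<^esub> f (k - i) y) {..k})"
proof (cases "f \<in> Hom_poly A A' 0 \<and> \<xi> \<in> Hom_poly A A' (- 1)")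
  case True
  then have f: "\<And>i. f i \<in> linear_maps A A'" and \<xi>: "\<And>i. \<xi> i \<in> linear_maps A A'"
    using Hom_linear[OF AA'.Hom_polyD] by blast+
  show ?thesis
    using True AA'.teval_zero[of f 0]
    unfolding cdga_hpair_def A.unit_zero_iff[OF A'.kspace_axioms \<xi>] derivation_condition_iff[where f = f and \<xi> = \<xi>, OF f \<xi>]
    by simp
qed (auto simp: cdga_hpair_def)

end

lemma cdga_pairI: "cdg_algebra A \<Longrightarrow> cdg_algebra A' \<Longrightarrow> cdga_pair A A'"
  by (simp add: cdga_pair_def cdga_iff)

lemma hopf_cdgaI: "cdg_hopf B \<Longrightarrow> cdg_algebra A \<Longrightarrow> hopf_cdga B A"
  by (simp add: hopf_cdga_def cdga_iff cdg_hopf_algebra_iff)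

lemma hopf_cdgaD: "hopf_cdga B A \<Longrightarrow> cdg_hopf B" "hopf_cdga B A \<Longrightarrow> cdg_algebra A"
  by (simp_all add: hopf_cdga_def cdga_iff cdg_hopf_algebra_iff)

section \<open>Composition with algebra maps\<close>

context
  fixes B :: "('k::field, 'b) hopf" and A :: "('k, 'a, 'm) dgmod_scheme" and A' :: "('k, 'c, 'n) dgmod_scheme"
  assumes BA: "hopf_cdga B A" and BA': "hopf_cdga B A'"
begin

interpretation BA: hopf_cdga B A by (rule BA)
interpretation BA': hopf_cdga B A' by (rule BA')
interpretation AA': cdga_pair A A' by (rule cdga_pairI[OF hopf_cdgaD(2)[OF BA] hopf_cdgaD(2)[OF BA']])

text \<open>The product rule of \<open>\<sigma>\<close> has scalar coefficients, which any linear \<open>h\<close> passes.\<close>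

lemma compose_eder:
  assumes h: "h \<in> Hom A A' m" and \<sigma>: "\<sigma> \<in> eder B A n"
  shows "compose (carrier B) h \<sigma> \<in> eder B A' (n + m)"
proof (rule ederI)
  show "compose (carrier B) h \<sigma> \<in> Hom B A' (n + m)"
    by (rule Hom_compose[OF BA.B.graded_space eder_Hom[OF \<sigma>] h])
  note lin = Hom_linear[OF h]
  show "compose (carrier B) h \<sigma> \<one>\<^bsub>B\<^esub> = \<zero>\<^bsub>A'\<^esub>"
    by (simp add: compose_def eder_one[OF \<sigma>] linear_zero[OF BA.A.kspace_axioms BA'.A.kspace_axioms lin])
  show "compose (carrier B) h \<sigma> (x \<otimes>\<^bsub>B\<^esub> y) = counit B x \<odot>\<^bsub>A'\<^esub> compose (carrier B) h \<sigma> y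
      \<oplus>\<^bsub>A'\<^esub> counit B y \<odot>\<^bsub>A'\<^esub> compose (carrier B) h \<sigma> x" if "x \<in> carrier B" "y \<in> carrier B" for x y
    using that
    by (simp add: compose_def eder_mult[OF \<sigma>] linear_add[OF lin] linear_smult[OF lin] eder_closed[OF \<sigma>])
qed

lemma compose_THom:
  assumes f: "f \<in> cdga_hom A A'" and \<upsilon>: "\<upsilon> \<in> THom B A"
  shows "compose (carrier B) f \<upsilon> \<in> THom B A'"
  using compose_eder[OF cdga_hom_Hom[OF f] BA.THom_eder[OF \<upsilon>]]
  by (simp add: BA'.THom_iff)
    (simp add: compose_def BA.THom_closed[OF \<upsilon>] cdga_hom_dd[OF f, symmetric] BA.THom_dd[OF \<upsilon>])

lemma compose_hom_diff:
  assumes f: "f \<in> cdga_hom A A'" and \<sigma>: "\<sigma> \<in> linear_maps B A"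
  shows "compose (carrier B) f (hom_diff B A n \<sigma>) = hom_diff B A' n (compose (carrier B) f \<sigma>)"
proof -
  note lin = cdga_hom_linear[OF f]
  note K = BA.A.kspace_axioms BA'.A.kspace_axioms
  have "compose (carrier B) f \<sigma> \<in> linear_maps B A'" by (rule linear_compose[OF BA.B.kspace_axioms \<sigma> lin])
  then show ?thesis
    by (intro linear_eqI[OF linear_compose[OF BA.B.kspace_axioms BA.BA.linear_hom_diff[OF \<sigma>] lin]
          BA'.BA.linear_hom_diff refl])
      (simp_all add: compose_def BA.BA.hom_diff_apply BA'.BA.hom_diff_apply linear_diff[OF K lin]
        linear_smult[OF lin] cdga_hom_dd[OF f] linear_closed[OF \<sigma>])
qed

lemma compose_conv_commutator:
  assumes f: "f \<in> cdga_hom A A'" and \<upsilon>: "\<upsilon> \<in> linear_maps B A" and \<tau>: "\<tau> \<in> linear_maps B A"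
  shows "compose (carrier B) f (conv_commutator B A \<upsilon> \<tau>)
    = conv_commutator B A' (compose (carrier B) f \<upsilon>) (compose (carrier B) f \<tau>)"
proof -
  note lin = cdga_hom_linear[OF f]
  note K = BA.A.kspace_axioms BA'.A.kspace_axioms
  note f\<upsilon> = linear_compose[OF BA.B.kspace_axioms \<upsilon> lin] and f\<tau> = linear_compose[OF BA.B.kspace_axioms \<tau> lin]
  show ?thesis
    unfolding BA.conv_commutator_eq_cbr[OF \<upsilon> \<tau>] BA'.conv_commutator_eq_cbr[OF f\<upsilon> f\<tau>]
  proof (rule linear_eqI[OF linear_compose[OF BA.B.kspace_axioms BA.linear_cbr[OF \<upsilon> \<tau>] lin]
        BA'.linear_cbr[OF f\<upsilon> f\<tau>] refl])
    fix b assume b: "b \<in> carrier B"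
    have "f (tlift B B A (BA.cform 0 \<upsilon> \<tau>) (comult B b)) = tlift B B A' (\<lambda>x y. f (BA.cform 0 \<upsilon> \<tau> x y)) (comult B b)"
      using b by (intro BA.B.AA.linear_tlift_apply[OF K BA.bilinear_cform[OF \<upsilon> \<tau>] lin]) simp
    also have "\<dots> = tlift B B A' (BA'.cform 0 (compose (carrier B) f \<upsilon>) (compose (carrier B) f \<tau>)) (comult B b)"
      using b
      by (intro BA.B.AA.tlift_cong[OF K(2) linear_o_bilinear[OF BA.bilinear_cform[OF \<upsilon> \<tau>] lin]
            BA'.bilinear_cform[OF f\<upsilon> f\<tau>]])
        (simp_all add: BA.cform_def BA'.cform_def compose_def linear_closed[OF \<upsilon>] linear_closed[OF \<tau>]
          linear_diff[OF K lin] cdga_hom_mult[OF f])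
    finally show "compose (carrier B) f (BA.cbr 0 \<upsilon> \<tau>) b
        = BA'.cbr 0 (compose (carrier B) f \<upsilon>) (compose (carrier B) f \<tau>) b"
      using b by (simp add: compose_eq BA.cbr_apply BA'.cbr_apply)
  qed
qed

end

lemma thom_homotopicI:
  fixes B :: "('k::field_char_0, 'b) hopf"
  assumes "hopf_cdga B A" "g \<in> THom B A" "h \<in> THom B A" "\<sigma> \<in> eder B A (- 1)"
    "h = madd B A g (hom_diff B A (- 1) \<sigma>)"
  shows "thom_homotopic B A g h"
  using assms by (auto simp: thom_homotopic_iff)

text \<open>For the integral \<open>\<eta>\<close> of the homotopy, \<open>f' - f = D \<eta>\<close>. As \<open>\<upsilon>\<close> is a cocycle, \<open>D \<eta> \<circ> \<upsilon> = D (\<eta> \<circ> \<upsilon>)\<close>, and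
  \<open>\<eta> \<circ> \<upsilon>\<close> is an \<open>\<epsilon>\<close>-derivation by \<open>compose_eder\<close>.\<close>

lemma compose_cdga_homotopic:
  fixes B :: "('k::field_char_0, 'b) hopf" and A :: "('k, 'a, 'm) dgmod_scheme" and A' :: "('k, 'c, 'n) dgmod_scheme"
  assumes BA: "hopf_cdga B A" and BA': "hopf_cdga B A'"
    and hom: "cdga_homotopic A A' f f'" and \<upsilon>: "\<upsilon> \<in> THom B A"
  shows "thom_homotopic B A' (compose (carrier B) f \<upsilon>) (compose (carrier B) f' \<upsilon>)"
proof -
  interpret BA: hopf_cdga B A by (rule BA)
  interpret BA': hopf_cdga B A' by (rule BA')
  interpret AA': cdga_pair A A' by (rule cdga_pairI[OF hopf_cdgaD(2)[OF BA] hopf_cdgaD(2)[OF BA']])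
  from hom obtain p \<xi> where ff': "f \<in> cdga_hom A A'" "f' \<in> cdga_hom A A'"
    and pair: "cdga_hpair A A' p \<xi>" and ev: "teval A A' p 0 = f" "teval A A' p 1 = f'"
    by (auto simp: cdga_homotopic_def)
  have p: "p \<in> Hom_poly A A' 0" and \<xi>: "\<xi> \<in> Hom_poly A A' (- 1)"
    and deriv: "\<And>k. tderiv A A' p k = hom_diff A A' (- 1) (\<xi> k)"
    using pair by (auto simp: cdga_hpair_def)
  have "\<exists>\<eta>\<in>Hom A A' (- 1). teval A A' p 1 = madd A A' (p 0) (hom_diff A A' (- 1) \<eta>)"
    by (rule homotopy_integral[OF AA'.AA'.dg_pair_axioms p \<xi> deriv AA'.AA'.zmap_Hom])
      (erule (1) AA'.AA'.madd_Hom, erule AA'.AA'.mscale_Hom, erule Hom_linear, rule AA'.AA'.Hom_polyD[OF \<xi>])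
  then obtain \<eta> where \<eta>: "\<eta> \<in> Hom A A' (- 1)" and f': "f' = madd A A' f (hom_diff A A' (- 1) \<eta>)"
    using ev AA'.AA'.teval_zero[OF p] by auto
  have \<eta>\<upsilon>: "compose (carrier B) \<eta> \<upsilon> \<in> eder B A' (- 1)"
    using compose_eder[OF BA BA' \<eta> BA.THom_eder[OF \<upsilon>]] by simp
  have "compose (carrier B) f' \<upsilon>
      = madd B A' (compose (carrier B) f \<upsilon>) (hom_diff B A' (- 1) (compose (carrier B) \<eta> \<upsilon>))"
  proof
    fix x
    show "compose (carrier B) f' \<upsilon> x
        = madd B A' (compose (carrier B) f \<upsilon>) (hom_diff B A' (- 1) (compose (carrier B) \<eta> \<upsilon>)) x"
      by (cases "x \<in> carrier B")
        (simp_all add: f' compose_def madd_def BA.THom_closed[OF \<upsilon>] BA'.BA.hom_diff_apply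
          AA'.AA'.hom_diff_apply BA.THom_dd[OF \<upsilon>])
  qed
  then show ?thesis
    using compose_THom[OF BA BA' ff'(1) \<upsilon>] compose_THom[OF BA BA' ff'(2) \<upsilon>] \<eta>\<upsilon>
    by (auto simp: thom_homotopic_iff[OF BA'])
qed

lemma compose_thom_homotopic:
  fixes B :: "('k::field_char_0, 'b) hopf" and A :: "('k, 'a, 'm) dgmod_scheme" and A' :: "('k, 'c, 'n) dgmod_scheme"
  assumes BA: "hopf_cdga B A" and BA': "hopf_cdga B A'"
    and f: "f \<in> cdga_hom A A'" and hom: "thom_homotopic B A \<upsilon> \<upsilon>'"
  shows "thom_homotopic B A' (compose (carrier B) f \<upsilon>) (compose (carrier B) f \<upsilon>')"
proof -
  interpret BA: hopf_cdga B A by (rule BA)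
  interpret BA': hopf_cdga B A' by (rule BA')
  from hom obtain \<sigma> where \<upsilon>: "\<upsilon> \<in> THom B A" "\<upsilon>' \<in> THom B A" and \<sigma>: "\<sigma> \<in> eder B A (- 1)"
    and eq: "\<upsilon>' = madd B A \<upsilon> (hom_diff B A (- 1) \<sigma>)"
    by (auto simp: thom_homotopic_iff[OF BA])
  note D = BA.BA.linear_hom_diff[OF eder_linear[OF \<sigma>]]
  have "compose (carrier B) f \<upsilon>' = madd B A' (compose (carrier B) f \<upsilon>) (compose (carrier B) f (hom_diff B A (- 1) \<sigma>))"
    by (auto simp: eq compose_def madd_def fun_eq_iff linear_add[OF cdga_hom_linear[OF f]]
        BA.THom_closed[OF \<upsilon>(1)] linear_closed[OF D])
  then show ?thesis
    unfolding compose_hom_diff[OF BA BA' f eder_linear[OF \<sigma>]]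
    using compose_eder[OF BA BA' cdga_hom_Hom[OF f] \<sigma>]
    by (intro thom_homotopicI[OF BA' compose_THom[OF BA BA' f \<upsilon>(1)] compose_THom[OF BA BA' f \<upsilon>(2)]])
      simp_all
qed

section \<open>Composition with Hopf algebra maps\<close>

lemma cdgh_homD:
  assumes "\<psi> \<in> cdgh_hom B B'"
  shows cdgh_hom_cdga_hom: "\<psi> \<in> cdga_hom B B'"
    and cdgh_hom_counit: "\<And>x. x \<in> carrier B \<Longrightarrow> counit B' (\<psi> x) = counit B x"
    and cdgh_hom_comult: "\<And>x. x \<in> carrier B \<Longrightarrow> comult B' (\<psi> x) = tmap B B B' B' 0 \<psi> \<psi> (comult B x)"
proof -
  have cm: "coalg_map B B' \<psi>" and \<psi>: "\<psi> \<in> cdga_hom B B'" using assms by (auto simp: cdgh_hom_def)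
  show "\<psi> \<in> cdga_hom B B'" by (rule \<psi>)
  fix x assume x: "x \<in> carrier B"
  have "compose (carrier B) (counit B') \<psi> x = counit B x"
    "compose (carrier B) (comult B') \<psi> x = compose (carrier B) (tmap B B B' B' 0 \<psi> \<psi>) (comult B) x"
    using cm by (simp_all add: coalg_map_def)
  then show "counit B' (\<psi> x) = counit B x" "comult B' (\<psi> x) = tmap B B B' B' 0 \<psi> \<psi> (comult B x)"
    using x by (simp_all add: compose_def)
qed

context
  fixes B :: "('k::field, 'b) hopf" and B' :: "('k, 'c) hopf" and A :: "('k, 'a, 'm) dgmod_scheme" and \<psi>
  assumes BA: "hopf_cdga B A" and B'A: "hopf_cdga B' A" and \<psi>: "\<psi> \<in> cdgh_hom B B'"
begin

interpretation BA: hopf_cdga B A by (rule BA)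
interpretation B'A: hopf_cdga B' A by (rule B'A)

private lemmas \<psi>hom = cdgh_hom_cdga_hom[OF \<psi>]
private lemmas \<psi>lin = cdga_hom_linear[OF \<psi>hom]
private lemmas \<psi>cl = linear_closed[OF \<psi>lin]

lemma precompose_eder:
  assumes \<sigma>: "\<sigma> \<in> eder B' A n"
  shows "compose (carrier B) \<sigma> \<psi> \<in> eder B A n"
proof (rule ederI)
  show "compose (carrier B) \<sigma> \<psi> \<in> Hom B A n"
    using Hom_compose[OF BA.B.graded_space cdga_hom_Hom[OF \<psi>hom] eder_Hom[OF \<sigma>]] by simp
  show "compose (carrier B) \<sigma> \<psi> \<one>\<^bsub>B\<^esub> = \<zero>\<^bsub>A\<^esub>"
    by (simp add: compose_def eder_one[OF \<sigma>] cdga_hom_one[OF \<psi>hom])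
  show "compose (carrier B) \<sigma> \<psi> (x \<otimes>\<^bsub>B\<^esub> y) = counit B x \<odot>\<^bsub>A\<^esub> compose (carrier B) \<sigma> \<psi> y
      \<oplus>\<^bsub>A\<^esub> counit B y \<odot>\<^bsub>A\<^esub> compose (carrier B) \<sigma> \<psi> x" if "x \<in> carrier B" "y \<in> carrier B" for x y
    using that by (simp add: compose_def eder_mult[OF \<sigma>] cdga_hom_mult[OF \<psi>hom] \<psi>cl cdgh_hom_counit[OF \<psi>])
qed

lemma precompose_THom:
  assumes \<upsilon>: "\<upsilon> \<in> THom B' A"
  shows "compose (carrier B) \<upsilon> \<psi> \<in> THom B A"
  using precompose_eder[OF B'A.THom_eder[OF \<upsilon>]]
  by (simp add: BA.THom_iff)
    (simp add: compose_def \<psi>cl cdga_hom_dd[OF \<psi>hom] B'A.THom_dd[OF \<upsilon>])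

lemma precompose_hom_diff:
  assumes \<sigma>: "\<sigma> \<in> linear_maps B' A"
  shows "compose (carrier B) (hom_diff B' A n \<sigma>) \<psi> = hom_diff B A n (compose (carrier B) \<sigma> \<psi>)"
  by (rule linear_eqI[OF linear_compose[OF BA.B.kspace_axioms \<psi>lin B'A.BA.linear_hom_diff[OF \<sigma>]]
        BA.BA.linear_hom_diff[OF linear_compose[OF BA.B.kspace_axioms \<psi>lin \<sigma>]] refl])
    (simp add: compose_def BA.BA.hom_diff_apply B'A.BA.hom_diff_apply \<psi>cl cdga_hom_dd[OF \<psi>hom])

lemma precompose_conv_commutator:
  assumes \<upsilon>: "\<upsilon> \<in> linear_maps B' A" and \<tau>: "\<tau> \<in> linear_maps B' A"
  shows "compose (carrier B) (conv_commutator B' A \<upsilon> \<tau>) \<psi>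
    = conv_commutator B A (compose (carrier B) \<upsilon> \<psi>) (compose (carrier B) \<tau> \<psi>)"
proof -
  note K = BA.B.kspace_axioms B'A.B.kspace_axioms BA.A.kspace_axioms
  note \<upsilon>\<psi> = linear_compose[OF K(1) \<psi>lin \<upsilon>] and \<tau>\<psi> = linear_compose[OF K(1) \<psi>lin \<tau>]
  note tm = BA.B.AA.linear_tmap[OF K(2) K(2) \<psi>lin \<psi>lin]
  have eq: "tlift B' B' A (B'A.cform 0 \<upsilon> \<tau>) (tmap B B B' B' 0 \<psi> \<psi> t)
      = tlift B B A (BA.cform 0 (compose (carrier B) \<upsilon> \<psi>) (compose (carrier B) \<tau> \<psi>)) t"
    if t: "t \<in> carrier (tspace B B)" for t
  proof -
    have "compose (carrier (tspace B B)) (tlift B' B' A (B'A.cform 0 \<upsilon> \<tau>)) (tmap B B B' B' 0 \<psi> \<psi>) t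
        = tlift B B A (BA.cform 0 (compose (carrier B) \<upsilon> \<psi>) (compose (carrier B) \<tau> \<psi>)) t"
    proof (rule BA.B.AA.linear_eq_on_tens[OF K(3)
          linear_compose[OF BA.B.AA.kspace_tspace tm B'A.linear_tlift_cform[OF \<upsilon> \<tau>]]
          BA.linear_tlift_cform[OF \<upsilon>\<psi> \<tau>\<psi>] _ t])
      fix x y assume xy: "x \<in> carrier B" "y \<in> carrier B"
      then show "compose (carrier (tspace B B)) (tlift B' B' A (B'A.cform 0 \<upsilon> \<tau>)) (tmap B B B' B' 0 \<psi> \<psi>) (tens B B x y)
          = tlift B B A (BA.cform 0 (compose (carrier B) \<upsilon> \<psi>) (compose (carrier B) \<tau> \<psi>)) (tens B B x y)"
        by (simp add: BA.tlift_cform_tens[OF \<upsilon>\<psi> \<tau>\<psi>] compose_eq BA.B.AA.tens_closed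
            BA.B.AA.tmap_tens[OF K(2) K(2) \<psi>lin \<psi>lin] B'A.tlift_cform_tens[OF \<upsilon> \<tau>] \<psi>cl
            BA.cform_def B'A.cform_def)
    qed
    then show ?thesis using t by (simp add: compose_def)
  qed
  show ?thesis
    unfolding B'A.conv_commutator_eq_cbr[OF \<upsilon> \<tau>] BA.conv_commutator_eq_cbr[OF \<upsilon>\<psi> \<tau>\<psi>]
  proof (rule linear_eqI[OF linear_compose[OF K(1) \<psi>lin B'A.linear_cbr[OF \<upsilon> \<tau>]] BA.linear_cbr[OF \<upsilon>\<psi> \<tau>\<psi>] refl])
    fix b assume b: "b \<in> carrier B"
    then show "compose (carrier B) (B'A.cbr 0 \<upsilon> \<tau>) \<psi> b
        = BA.cbr 0 (compose (carrier B) \<upsilon> \<psi>) (compose (carrier B) \<tau> \<psi>) b"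
      by (simp add: compose_eq B'A.cbr_apply BA.cbr_apply \<psi>cl cdgh_hom_comult[OF \<psi>] eq)
  qed
qed

end

lemma precompose_thom_homotopic:
  fixes B :: "('k::field_char_0, 'b) hopf" and B' :: "('k, 'c) hopf" and A :: "('k, 'a, 'm) dgmod_scheme"
  assumes BA: "hopf_cdga B A" and B'A: "hopf_cdga B' A"
    and \<psi>: "\<psi> \<in> cdgh_hom B B'" and hom: "thom_homotopic B' A \<upsilon> \<upsilon>'"
  shows "thom_homotopic B A (compose (carrier B) \<upsilon> \<psi>) (compose (carrier B) \<upsilon>' \<psi>)"
proof -
  interpret BA: hopf_cdga B A by (rule BA)
  interpret B'A: hopf_cdga B' A by (rule B'A)
  from hom obtain \<sigma> where \<upsilon>: "\<upsilon> \<in> THom B' A" "\<upsilon>' \<in> THom B' A" and \<sigma>: "\<sigma> \<in> eder B' A (- 1)"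
    and eq: "\<upsilon>' = madd B' A \<upsilon> (hom_diff B' A (- 1) \<sigma>)"
    by (auto simp: thom_homotopic_iff[OF B'A])
  note cl = linear_closed[OF cdga_hom_linear[OF cdgh_hom_cdga_hom[OF \<psi>]]]
  have "compose (carrier B) \<upsilon>' \<psi> = madd B A (compose (carrier B) \<upsilon> \<psi>) (compose (carrier B) (hom_diff B' A (- 1) \<sigma>) \<psi>)"
    by (auto simp: eq compose_def madd_def fun_eq_iff cl)
  then show ?thesis
    unfolding precompose_hom_diff[OF BA B'A \<psi> eder_linear[OF \<sigma>]]
    by (rule thom_homotopicI[OF BA precompose_THom[OF BA B'A \<psi> \<upsilon>(1)] precompose_THom[OF BA B'A \<psi> \<upsilon>(2)]
          precompose_eder[OF BA B'A \<psi> \<sigma>]])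
qed

text \<open>Along a homotopy of Hopf algebra maps the counit is preserved: \<open>\<epsilon> \<circ> f(t)\<close> has derivative
  \<open>\<epsilon> \<circ> D \<xi>(t) = 0\<close>.\<close>

lemma cdgh_hpair_counit:
  fixes B :: "('k::field_char_0, 'b) hopf" and B' :: "('k, 'c) hopf"
  assumes B: "cdg_hopf B" and B': "cdg_hopf B'" and pair: "cdgh_hpair B B' f \<xi>" and x: "x \<in> carrier B"
  shows "counit B' (\<xi> k x) = 0" and "counit B' (f k x) = (if k = 0 then counit B x else 0)"
proof -
  interpret B: cdg_hopf_algebra B using B by (simp add: cdg_hopf_algebra_iff)
  interpret B': cdg_hopf_algebra B' using B' by (simp add: cdg_hopf_algebra_iff)
  interpret BB': cdga_pair B B' ..
  have f: "f \<in> Hom_poly B B' 0" and \<xi>: "\<xi> \<in> Hom_poly B B' (- 1)"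
    and deriv: "\<And>k. tderiv B B' f k = hom_diff B B' (- 1) (\<xi> k)"
    and counit_\<xi>: "\<And>k. compose (carrier B) (counit B') (\<xi> k) = zmap B (ground :: ('k, 'k) dgmod)"
    using pair by (auto simp: cdgh_hpair_def cdga_hpair_def)
  have cm: "coalg_map B B' (f 0)"
    using pair BB'.AA'.teval_zero[OF f] by (simp add: cdgh_hpair_def)
  note fcl = Hom_closed[OF BB'.AA'.Hom_polyD[OF f]] and \<xi>cl = Hom_closed[OF BB'.AA'.Hom_polyD[OF \<xi>]]
  have \<xi>0: "counit B' (\<xi> k y) = 0" if "y \<in> carrier B" for k y
    using fun_cong[OF counit_\<xi>[of k], of y] that by (simp add: compose_def zmap_def)
  show "counit B' (\<xi> k x) = 0" by (rule \<xi>0[OF x])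
  show "counit B' (f k x) = (if k = 0 then counit B x else 0)"
  proof (cases k)
    case 0
    have "compose (carrier B) (counit B') (f 0) x = counit B x" using cm by (simp add: coalg_map_def)
    then show ?thesis using x 0 by (simp add: compose_def)
  next
    case (Suc m)
    have "of_nat (Suc m) \<odot>\<^bsub>B'\<^esub> f (Suc m) x = dd B' (\<xi> m x) \<oplus>\<^bsub>B'\<^esub> \<xi> m (dd B x)"
      using fun_cong[OF deriv[of m], of x] x \<xi>cl
      by (simp add: tderiv_def mscale_def BB'.AA'.hom_diff_apply a_minus_def B'.minus_eq_smult B'.smult_smult)
    then have "of_nat (Suc m) * counit B' (f (Suc m) x) = counit B' (dd B' (\<xi> m x) \<oplus>\<^bsub>B'\<^esub> \<xi> m (dd B x))"
      using B'.counit_smult[OF fcl[OF x], of "of_nat (Suc m)" "Suc m"] by simp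
    then have "of_nat (Suc m) * counit B' (f (Suc m) x) = (0 :: 'k)"
      using x \<xi>cl by (simp add: B'.counit_add B'.counit_dd \<xi>0)
    then show ?thesis using Suc by (simp del: of_nat_Suc)
  qed
qed

text \<open>Applying \<open>\<upsilon>\<close> to the product rule of \<open>\<xi>(t)\<close> replaces the factors \<open>p(t)\<close> by \<open>\<epsilon> \<circ> p(t) = \<epsilon>\<close> and kills the
  terms with \<open>\<epsilon> \<circ> \<xi>(t) = 0\<close>.\<close>

lemma precompose_hpair_eder:
  fixes B :: "('k::field_char_0, 'b) hopf" and B' :: "('k, 'c) hopf" and A :: "('k, 'a, 'm) dgmod_scheme"
  assumes BA: "hopf_cdga B A" and B'A: "hopf_cdga B' A"
    and pair: "cdgh_hpair B B' p \<xi>" and \<upsilon>: "\<upsilon> \<in> THom B' A"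
  shows "compose (carrier B) \<upsilon> (\<xi> k) \<in> eder B A (- 1)"
proof -
  interpret BA: hopf_cdga B A by (rule BA)
  interpret B'A: hopf_cdga B' A by (rule B'A)
  interpret BB': cdga_pair B B' ..
  have p: "p \<in> Hom_poly B B' 0" and \<xi>: "\<xi> \<in> Hom_poly B B' (- 1)"
    and \<xi>1: "\<And>k. \<xi> k \<one>\<^bsub>B\<^esub> = \<zero>\<^bsub>B'\<^esub>"
    and \<xi>mult: "\<And>k x y. x \<in> carrier B \<Longrightarrow> y \<in> carrier B \<Longrightarrow> \<xi> k (x \<otimes>\<^bsub>B\<^esub> y)
      = finsum B' (\<lambda>i. p i (ksgn B (- 1) x) \<otimes>\<^bsub>B'\<^esub> \<xi> (k - i) y) {..k}
        \<oplus>\<^bsub>B'\<^esub> finsum B' (\<lambda>i. \<xi> i x \<otimes>\<^bsub>B'\<^esub> p (k - i) y) {..k}"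
    using pair unfolding cdgh_hpair_def BB'.cdga_hpair_iff by blast+
  note counit = cdgh_hpair_counit[OF hopf_cdgaD(1)[OF BA] hopf_cdgaD(1)[OF B'A] pair]
  note pH = BB'.AA'.Hom_polyD[OF p] and \<xi>H = BB'.AA'.Hom_polyD[OF \<xi>]
  note pcl = Hom_closed[OF pH] and \<xi>cl = Hom_closed[OF \<xi>H]
  note \<upsilon>lin = B'A.THom_linear[OF \<upsilon>] and \<upsilon>cl = B'A.THom_closed[OF \<upsilon>]
  show ?thesis
  proof (rule ederI)
    show "compose (carrier B) \<upsilon> (\<xi> k) \<in> Hom B A (- 1)"
      using Hom_compose[OF BA.B.graded_space \<xi>H eder_Hom[OF B'A.THom_eder[OF \<upsilon>]]] by simp
    show "compose (carrier B) \<upsilon> (\<xi> k) \<one>\<^bsub>B\<^esub> = \<zero>\<^bsub>A\<^esub>"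
      by (simp add: compose_def \<xi>1 linear_zero[OF B'A.B.kspace_axioms BA.A.kspace_axioms \<upsilon>lin])
    fix x y assume xy: "x \<in> carrier B" "y \<in> carrier B"
    have left: "\<upsilon> (p i (ksgn B (- 1) x) \<otimes>\<^bsub>B'\<^esub> \<xi> (k - i) y) = (if i = 0 then counit B x \<odot>\<^bsub>A\<^esub> \<upsilon> (\<xi> k y) else \<zero>\<^bsub>A\<^esub>)" for i
      using xy by (simp add: eder_mult[OF B'A.THom_eder[OF \<upsilon>]] pcl \<xi>cl counit \<upsilon>cl BA.B.counit_ksgn)
    have right: "\<upsilon> (\<xi> i x \<otimes>\<^bsub>B'\<^esub> p (k - i) y) = (if i = k then counit B y \<odot>\<^bsub>A\<^esub> \<upsilon> (\<xi> k x) else \<zero>\<^bsub>A\<^esub>)"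
      if "i \<le> k" for i
      using xy that by (simp add: eder_mult[OF B'A.THom_eder[OF \<upsilon>]] pcl \<xi>cl counit \<upsilon>cl)
    have "\<upsilon> (finsum B' (\<lambda>i. p i (ksgn B (- 1) x) \<otimes>\<^bsub>B'\<^esub> \<xi> (k - i) y) {..k})
        = finsum A (\<lambda>i. if i = 0 then counit B x \<odot>\<^bsub>A\<^esub> \<upsilon> (\<xi> k y) else \<zero>\<^bsub>A\<^esub>) {..k}"
      using xy by (subst linear_finsum[OF B'A.B.kspace_axioms BA.A.kspace_axioms \<upsilon>lin]) (auto simp: left pcl \<xi>cl)
    also have "\<dots> = counit B x \<odot>\<^bsub>A\<^esub> \<upsilon> (\<xi> k y)"
      using xy BA.A.finsum_superset[of "{..k}" "{0}" "\<lambda>i. if i = 0 then counit B x \<odot>\<^bsub>A\<^esub> \<upsilon> (\<xi> k y) else \<zero>\<^bsub>A\<^esub>"]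
      by (simp add: \<upsilon>cl \<xi>cl Pi_def)
    finally have L: "\<upsilon> (finsum B' (\<lambda>i. p i (ksgn B (- 1) x) \<otimes>\<^bsub>B'\<^esub> \<xi> (k - i) y) {..k}) = counit B x \<odot>\<^bsub>A\<^esub> \<upsilon> (\<xi> k y)" .
    have "\<upsilon> (finsum B' (\<lambda>i. \<xi> i x \<otimes>\<^bsub>B'\<^esub> p (k - i) y) {..k})
        = finsum A (\<lambda>i. if i = k then counit B y \<odot>\<^bsub>A\<^esub> \<upsilon> (\<xi> k x) else \<zero>\<^bsub>A\<^esub>) {..k}"
      using xy
      by (subst linear_finsum[OF B'A.B.kspace_axioms BA.A.kspace_axioms \<upsilon>lin])
        (auto simp: right pcl \<xi>cl \<upsilon>cl intro!: BA.A.finsum_cong')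
    also have "\<dots> = counit B y \<odot>\<^bsub>A\<^esub> \<upsilon> (\<xi> k x)"
      using xy BA.A.finsum_superset[of "{..k}" "{k}" "\<lambda>i. if i = k then counit B y \<odot>\<^bsub>A\<^esub> \<upsilon> (\<xi> k x) else \<zero>\<^bsub>A\<^esub>"]
      by (simp add: \<upsilon>cl \<xi>cl Pi_def)
    finally have R: "\<upsilon> (finsum B' (\<lambda>i. \<xi> i x \<otimes>\<^bsub>B'\<^esub> p (k - i) y) {..k}) = counit B y \<odot>\<^bsub>A\<^esub> \<upsilon> (\<xi> k x)" .
    show "compose (carrier B) \<upsilon> (\<xi> k) (x \<otimes>\<^bsub>B\<^esub> y) = counit B x \<odot>\<^bsub>A\<^esub> compose (carrier B) \<upsilon> (\<xi> k) y
        \<oplus>\<^bsub>A\<^esub> counit B y \<odot>\<^bsub>A\<^esub> compose (carrier B) \<upsilon> (\<xi> k) x"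
      using xy by (simp add: compose_def \<xi>mult linear_add[OF \<upsilon>lin] pcl \<xi>cl Pi_def L R)
  qed
qed

text \<open>Again \<open>\<psi>' - \<psi> = D \<eta>\<close> with \<open>\<eta>\<close> the integral of \<open>\<xi>(t)\<close>, and \<open>\<upsilon> \<circ> D \<eta> = D (\<upsilon> \<circ> \<eta>)\<close>. That
  \<open>\<upsilon> \<circ> \<eta>\<close> is an \<open>\<epsilon>\<close>-derivation is a linear condition on \<open>\<eta>\<close>, so it passes from the coefficients of
  \<open>\<xi>(t)\<close> to the integral.\<close>

lemma precompose_cdgh_homotopic:
  fixes B :: "('k::field_char_0, 'b) hopf" and B' :: "('k, 'c) hopf" and A :: "('k, 'a, 'm) dgmod_scheme"
  assumes BA: "hopf_cdga B A" and B'A: "hopf_cdga B' A"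
    and hom: "cdgh_homotopic B B' \<psi> \<psi>'" and \<upsilon>: "\<upsilon> \<in> THom B' A"
  shows "thom_homotopic B A (compose (carrier B) \<upsilon> \<psi>) (compose (carrier B) \<upsilon> \<psi>')"
proof -
  interpret BA: hopf_cdga B A by (rule BA)
  interpret B'A: hopf_cdga B' A by (rule B'A)
  interpret BB': cdga_pair B B' ..
  from hom obtain p \<xi> where \<psi>: "\<psi> \<in> cdgh_hom B B'" "\<psi>' \<in> cdgh_hom B B'"
    and pair: "cdgh_hpair B B' p \<xi>" and ev: "teval B B' p 0 = \<psi>" "teval B B' p 1 = \<psi>'"
    by (auto simp: cdgh_homotopic_def)
  have p: "p \<in> Hom_poly B B' 0" and \<xi>: "\<xi> \<in> Hom_poly B B' (- 1)"
    and deriv: "\<And>k. tderiv B B' p k = hom_diff B B' (- 1) (\<xi> k)"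
    using pair by (auto simp: cdgh_hpair_def cdga_hpair_def)
  note \<xi>H = BB'.AA'.Hom_polyD[OF \<xi>] and \<upsilon>lin = B'A.THom_linear[OF \<upsilon>]
  note \<xi>e = precompose_hpair_eder[OF BA B'A pair \<upsilon>]
  define S where "S = {\<eta> \<in> Hom B B' (- 1). compose (carrier B) \<upsilon> \<eta> \<in> eder B A (- 1)}"
  have "\<exists>\<eta>\<in>S. teval B B' p 1 = madd B B' (p 0) (hom_diff B B' (- 1) \<eta>)"
  proof (rule homotopy_integral[OF BB'.AA'.dg_pair_axioms p \<xi> deriv])
    have "compose (carrier B) \<upsilon> (zmap B B') = zmap B A"
      by (auto simp: compose_def zmap_def fun_eq_iff linear_zero[OF B'A.B.kspace_axioms BA.A.kspace_axioms \<upsilon>lin])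
    then show "zmap B B' \<in> S" by (simp add: S_def BB'.AA'.zmap_Hom BA.eder_zmap)
    show "madd B B' \<sigma> \<tau> \<in> S" if "\<sigma> \<in> S" "\<tau> \<in> S" for \<sigma> \<tau>
    proof -
      have H: "\<sigma> \<in> Hom B B' (- 1)" "\<tau> \<in> Hom B B' (- 1)" using that by (auto simp: S_def)
      have "compose (carrier B) \<upsilon> (madd B B' \<sigma> \<tau>) = madd B A (compose (carrier B) \<upsilon> \<sigma>) (compose (carrier B) \<upsilon> \<tau>)"
        by (auto simp: compose_def madd_def fun_eq_iff linear_add[OF \<upsilon>lin] Hom_closed[OF H(1)] Hom_closed[OF H(2)])
      then show ?thesis using that by (simp add: S_def BB'.AA'.madd_Hom BA.eder_madd)
    qed
    show "mscale B B' c \<sigma> \<in> S" if "\<sigma> \<in> S" for c \<sigma>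
    proof -
      have H: "\<sigma> \<in> Hom B B' (- 1)" using that by (auto simp: S_def)
      have "compose (carrier B) \<upsilon> (mscale B B' c \<sigma>) = mscale B A c (compose (carrier B) \<upsilon> \<sigma>)"
        by (auto simp: compose_def mscale_def fun_eq_iff linear_smult[OF \<upsilon>lin] Hom_closed[OF H])
      then show ?thesis using that by (simp add: S_def BB'.AA'.mscale_Hom BA.eder_mscale)
    qed
  qed (use \<xi>e \<xi>H in \<open>auto simp: S_def dest: Hom_linear\<close>)
  then obtain \<eta> where \<eta>: "\<eta> \<in> Hom B B' (- 1)" "compose (carrier B) \<upsilon> \<eta> \<in> eder B A (- 1)"
    and \<psi>': "\<psi>' = madd B B' \<psi> (hom_diff B B' (- 1) \<eta>)"
    using ev BB'.AA'.teval_zero[OF p] by (auto simp: S_def)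
  note \<psi>cl = linear_closed[OF cdga_hom_linear[OF cdgh_hom_cdga_hom[OF \<psi>(1)]]]
  have "compose (carrier B) \<upsilon> \<psi>'
      = madd B A (compose (carrier B) \<upsilon> \<psi>) (hom_diff B A (- 1) (compose (carrier B) \<upsilon> \<eta>))"
  proof
    fix x
    show "compose (carrier B) \<upsilon> \<psi>' x
        = madd B A (compose (carrier B) \<upsilon> \<psi>) (hom_diff B A (- 1) (compose (carrier B) \<upsilon> \<eta>)) x"
      by (cases "x \<in> carrier B")
        (simp_all add: \<psi>' compose_def madd_def \<psi>cl BA.BA.hom_diff_apply BB'.AA'.hom_diff_apply
          linear_add[OF \<upsilon>lin] linear_smult[OF \<upsilon>lin] linear_diff[OF B'A.B.kspace_axioms BA.A.kspace_axioms \<upsilon>lin]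
          Hom_closed[OF \<eta>(1)] B'A.THom_dd[OF \<upsilon>])
  qed
  then show ?thesis
    using precompose_THom[OF BA B'A \<psi>(1) \<upsilon>] precompose_THom[OF BA B'A \<psi>(2) \<upsilon>] \<eta>(2)
    by (auto simp: thom_homotopic_iff[OF BA])
qed

section \<open>The homotopy category of algebras\<close>

lemma Hom_ksgn:
  assumes "graded_space V" "graded_space W" "f \<in> Hom V W 0" "x \<in> carrier V"
  shows "f (ksgn V n x) = ksgn W n (f x)"
proof -
  interpret V: graded V using assms(1) by (simp add: graded_iff)
  interpret W: graded W using assms(2) by (simp add: graded_iff)
  note lin = Hom_linear[OF assms(3)]
  have f0: "f \<zero>\<^bsub>V\<^esub> = \<zero>\<^bsub>W\<^esub>" by (rule linear_zero[OF V.kspace_axioms W.kspace_axioms lin])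
  show ?thesis using assms(4)
  proof (induction rule: V.homogeneous_induct)
    case zero
    show ?case
      by (simp add: f0 V.ksgn_homogeneous[OF V.gr_zero[of 0]] W.ksgn_homogeneous[OF W.gr_zero[of 0]])
  next
    case (add x y)
    then show ?case by (simp add: V.ksgn_add W.ksgn_add linear_add[OF lin] linear_closed[OF lin])
  next
    case (homogeneous i x)
    then show ?case
      using W.ksgn_homogeneous[of "f x" i] Hom_gr[OF assms(3) homogeneous]
      by (simp add: V.ksgn_homogeneous linear_smult[OF lin] V.gr_subset)
  qed
qed

text \<open>Homotopy pairs can be composed with algebra maps on either side; hence composition of homotopy types
  is well defined, by changing one factor at a time.\<close>

lemma compose_hpair_left:
  assumes AA': "cdga_pair A A'" and A'A'': "cdga_pair A' A''"
    and g: "g \<in> cdga_hom A' A''" and pair: "cdga_hpair A A' f \<xi>"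
  shows "cdga_hpair A A'' (\<lambda>k. compose (carrier A) g (f k)) (\<lambda>k. compose (carrier A) g (\<xi> k))"
    and "teval A A'' (\<lambda>k. compose (carrier A) g (f k)) c = compose (carrier A) g (teval A A' f c)"
proof -
  interpret AA': cdga_pair A A' by (rule AA')
  interpret A'A'': cdga_pair A' A'' by (rule A'A'')
  interpret AA'': cdga_pair A A'' ..
  note K' = AA'.A'.kspace_axioms and K'' = A'A''.A'.kspace_axioms
  note H = pair[unfolded AA'.cdga_hpair_iff]
  have f: "f \<in> Hom_poly A A' 0" and \<xi>: "\<xi> \<in> Hom_poly A A' (- 1)" using H by auto
  note fH = AA'.AA'.Hom_polyD[OF f] and \<xi>H = AA'.AA'.Hom_polyD[OF \<xi>]
  note fcl = Hom_closed[OF fH] and \<xi>cl = Hom_closed[OF \<xi>H]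
  note glin = cdga_hom_linear[OF g]
  have zmap: "compose (carrier A) g (zmap A A') = zmap A A''"
    by (auto simp: compose_def zmap_def fun_eq_iff linear_zero[OF K' K'' glin])
  have poly: "(\<lambda>k. compose (carrier A) g (u k)) \<in> Hom_poly A A'' n" if u: "u \<in> Hom_poly A A' n" for u n
  proof -
    obtain N where "\<And>k. k > N \<Longrightarrow> u k = zmap A A'" using AA'.AA'.Hom_poly_bound[OF u] by blast
    then show ?thesis
      using Hom_compose[OF AA'.A.graded_space AA'.AA'.Hom_polyD[OF u] cdga_hom_Hom[OF g]]
      by (intro AA''.AA'.Hom_polyI[of _ _ N]) (simp_all add: zmap)
  qed
  obtain N where N: "\<And>k. k > N \<Longrightarrow> f k = zmap A A'" using AA'.AA'.Hom_poly_bound[OF f] by blast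
  show "teval A A'' (\<lambda>k. compose (carrier A) g (f k)) c = compose (carrier A) g (teval A A' f c)"
  proof
    fix x
    show "teval A A'' (\<lambda>k. compose (carrier A) g (f k)) c x = compose (carrier A) g (teval A A' f c) x"
    proof (cases "x \<in> carrier A")
      case True
      have "teval A A'' (\<lambda>k. compose (carrier A) g (f k)) c x
          = finsum A'' (\<lambda>k. c ^ k \<odot>\<^bsub>A''\<^esub> compose (carrier A) g (f k) x) {..N}"
        using True N by (intro AA''.AA'.teval_eq_finsum[OF AA''.AA'.Hom_polyD[OF poly[OF f]]]) (simp_all add: zmap)
      also have "\<dots> = g (finsum A' (\<lambda>k. c ^ k \<odot>\<^bsub>A'\<^esub> f k x) {..N})"
        using True fcl by (subst linear_finsum[OF K' K'' glin]) (auto simp: compose_eq linear_smult[OF glin])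
      also have "\<dots> = g (teval A A' f c x)"
        using AA'.AA'.teval_eq_finsum[where f = f and c = c and N = N, OF fH N True] by simp
      finally show ?thesis using True by (simp add: compose_eq)
    qed (simp add: teval_def compose_def)
  qed
  show "cdga_hpair A A'' (\<lambda>k. compose (carrier A) g (f k)) (\<lambda>k. compose (carrier A) g (\<xi> k))"
    unfolding AA''.cdga_hpair_iff
  proof (intro conjI allI ballI poly f \<xi>)
    show "compose (carrier A) g (f 0) \<in> cdga_hom A A''"
      using H g by (intro cdga_hom_compose[OF AA'.A.graded_space]) auto
    show "compose (carrier A) g (\<xi> k) \<one>\<^bsub>A\<^esub> = \<zero>\<^bsub>A''\<^esub>" for k
      using H by (simp add: compose_eq linear_zero[OF K' K'' glin])
    fix k
    have D: "tderiv A A' f k = hom_diff A A' (- 1) (\<xi> k)" using H by blast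
    show "tderiv A A'' (\<lambda>k. compose (carrier A) g (f k)) k = hom_diff A A'' (- 1) (compose (carrier A) g (\<xi> k))"
    proof
      fix x
      show "tderiv A A'' (\<lambda>k. compose (carrier A) g (f k)) k x = hom_diff A A'' (- 1) (compose (carrier A) g (\<xi> k)) x"
      proof (cases "x \<in> carrier A")
        case True
        have "tderiv A A'' (\<lambda>k. compose (carrier A) g (f k)) k x = g (tderiv A A' f k x)"
          using True by (simp add: tderiv_def mscale_def compose_eq linear_smult[OF glin] fcl del: of_nat_Suc)
        then show ?thesis
          using True
          by (simp add: D AA'.AA'.hom_diff_apply AA''.AA'.hom_diff_apply compose_eq linear_diff[OF K' K'' glin]
              linear_smult[OF glin] \<xi>cl cdga_hom_dd[OF g])
      qed (simp add: tderiv_def mscale_def hom_diff_def msub_def)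
    qed
    fix x y assume xy: "x \<in> carrier A" "y \<in> carrier A"
    have "\<xi> k (x \<otimes>\<^bsub>A\<^esub> y) = finsum A' (\<lambda>i. f i (ksgn A (- 1) x) \<otimes>\<^bsub>A'\<^esub> \<xi> (k - i) y) {..k}
        \<oplus>\<^bsub>A'\<^esub> finsum A' (\<lambda>i. \<xi> i x \<otimes>\<^bsub>A'\<^esub> f (k - i) y) {..k}" using H xy by blast
    then show "compose (carrier A) g (\<xi> k) (x \<otimes>\<^bsub>A\<^esub> y)
        = finsum A'' (\<lambda>i. compose (carrier A) g (f i) (ksgn A (- 1) x) \<otimes>\<^bsub>A''\<^esub> compose (carrier A) g (\<xi> (k - i)) y) {..k}
        \<oplus>\<^bsub>A''\<^esub> finsum A'' (\<lambda>i. compose (carrier A) g (\<xi> i) x \<otimes>\<^bsub>A''\<^esub> compose (carrier A) g (f (k - i)) y) {..k}"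
      using xy
      by (simp add: compose_eq linear_add[OF glin] linear_finsum[OF K' K'' glin] Pi_def fcl \<xi>cl cdga_hom_mult[OF g])
  qed
qed

lemma compose_hpair_right:
  assumes AA': "cdga_pair A A'" and A'A'': "cdga_pair A' A''"
    and h: "h \<in> cdga_hom A A'" and pair: "cdga_hpair A' A'' f \<xi>"
  shows "cdga_hpair A A'' (\<lambda>k. compose (carrier A) (f k) h) (\<lambda>k. compose (carrier A) (\<xi> k) h)"
    and "teval A A'' (\<lambda>k. compose (carrier A) (f k) h) c = compose (carrier A) (teval A' A'' f c) h"
proof -
  interpret AA': cdga_pair A A' by (rule AA')
  interpret A'A'': cdga_pair A' A'' by (rule A'A'')
  interpret AA'': cdga_pair A A'' ..
  note H = pair[unfolded A'A''.cdga_hpair_iff]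
  have f: "f \<in> Hom_poly A' A'' 0" and \<xi>: "\<xi> \<in> Hom_poly A' A'' (- 1)" using H by auto
  note fH = A'A''.AA'.Hom_polyD[OF f] and \<xi>H = A'A''.AA'.Hom_polyD[OF \<xi>]
  note hcl = linear_closed[OF cdga_hom_linear[OF h]]
  have zmap: "compose (carrier A) (zmap A' A'') h = zmap A A''"
    by (auto simp: compose_def zmap_def fun_eq_iff hcl)
  have poly: "(\<lambda>k. compose (carrier A) (u k) h) \<in> Hom_poly A A'' n" if u: "u \<in> Hom_poly A' A'' n" for u n
  proof -
    obtain N where "\<And>k. k > N \<Longrightarrow> u k = zmap A' A''" using A'A''.AA'.Hom_poly_bound[OF u] by blast
    then show ?thesis
      using Hom_compose[OF AA'.A.graded_space cdga_hom_Hom[OF h] A'A''.AA'.Hom_polyD[OF u]]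
      by (intro AA''.AA'.Hom_polyI[of _ _ N]) (simp_all add: zmap)
  qed
  obtain N where N: "\<And>k. k > N \<Longrightarrow> f k = zmap A' A''" using A'A''.AA'.Hom_poly_bound[OF f] by blast
  show "teval A A'' (\<lambda>k. compose (carrier A) (f k) h) c = compose (carrier A) (teval A' A'' f c) h"
  proof
    fix x
    show "teval A A'' (\<lambda>k. compose (carrier A) (f k) h) c x = compose (carrier A) (teval A' A'' f c) h x"
    proof (cases "x \<in> carrier A")
      case True
      have "teval A A'' (\<lambda>k. compose (carrier A) (f k) h) c x
          = finsum A'' (\<lambda>k. c ^ k \<odot>\<^bsub>A''\<^esub> compose (carrier A) (f k) h x) {..N}"
        using True N by (intro AA''.AA'.teval_eq_finsum[OF AA''.AA'.Hom_polyD[OF poly[OF f]]]) (simp_all add: zmap)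
      also have "\<dots> = teval A' A'' f c (h x)"
        using A'A''.AA'.teval_eq_finsum[where f = f and c = c and N = N, OF fH N hcl[OF True]] True
        by (simp add: compose_eq)
      finally show ?thesis using True by (simp add: compose_eq)
    qed (simp add: teval_def compose_def)
  qed
  show "cdga_hpair A A'' (\<lambda>k. compose (carrier A) (f k) h) (\<lambda>k. compose (carrier A) (\<xi> k) h)"
    unfolding AA''.cdga_hpair_iff
  proof (intro conjI allI ballI poly f \<xi>)
    show "compose (carrier A) (f 0) h \<in> cdga_hom A A''"
      using H h by (intro cdga_hom_compose[OF AA'.A.graded_space]) auto
    show "compose (carrier A) (\<xi> k) h \<one>\<^bsub>A\<^esub> = \<zero>\<^bsub>A''\<^esub>" for k
      using H by (simp add: compose_eq cdga_hom_one[OF h])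
    fix k
    have D: "tderiv A' A'' f k = hom_diff A' A'' (- 1) (\<xi> k)" using H by blast
    show "tderiv A A'' (\<lambda>k. compose (carrier A) (f k) h) k = hom_diff A A'' (- 1) (compose (carrier A) (\<xi> k) h)"
    proof
      fix x
      show "tderiv A A'' (\<lambda>k. compose (carrier A) (f k) h) k x = hom_diff A A'' (- 1) (compose (carrier A) (\<xi> k) h) x"
      proof (cases "x \<in> carrier A")
        case True
        have "tderiv A A'' (\<lambda>k. compose (carrier A) (f k) h) k x = tderiv A' A'' f k (h x)"
          using True by (simp add: tderiv_def mscale_def compose_eq hcl del: of_nat_Suc)
        then show ?thesis
          using True
          by (simp add: D A'A''.AA'.hom_diff_apply AA''.AA'.hom_diff_apply compose_eq hcl cdga_hom_dd[OF h])
      qed (simp add: tderiv_def mscale_def hom_diff_def msub_def)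
    qed
    fix x y assume xy: "x \<in> carrier A" "y \<in> carrier A"
    have "\<xi> k (h x \<otimes>\<^bsub>A'\<^esub> h y) = finsum A'' (\<lambda>i. f i (ksgn A' (- 1) (h x)) \<otimes>\<^bsub>A''\<^esub> \<xi> (k - i) (h y)) {..k}
        \<oplus>\<^bsub>A''\<^esub> finsum A'' (\<lambda>i. \<xi> i (h x) \<otimes>\<^bsub>A''\<^esub> f (k - i) (h y)) {..k}" using H hcl xy by blast
    then show "compose (carrier A) (\<xi> k) h (x \<otimes>\<^bsub>A\<^esub> y)
        = finsum A'' (\<lambda>i. compose (carrier A) (f i) h (ksgn A (- 1) x) \<otimes>\<^bsub>A''\<^esub> compose (carrier A) (\<xi> (k - i)) h y) {..k}
        \<oplus>\<^bsub>A''\<^esub> finsum A'' (\<lambda>i. compose (carrier A) (\<xi> i) h x \<otimes>\<^bsub>A''\<^esub> compose (carrier A) (f (k - i)) h y) {..k}"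
      using xy
      by (simp add: compose_eq cdga_hom_mult[OF h]
          Hom_ksgn[OF AA'.A.graded_space AA'.A'.graded_space cdga_hom_Hom[OF h]])
  qed
qed

lemma equivclp_map:
  assumes "equivclp r a b" "\<And>x y. r x y \<Longrightarrow> equivclp s (F x) (F y)"
  shows "equivclp s (F a) (F b)"
  using assms(1)
proof (induction rule: equivclp_induct)
  case (step y z)
  then show ?case using assms(2) equivclp_trans equivclp_sym by metis
qed simp

lemma equivclp_invariant:
  assumes "equivclp r a b" "\<And>x y. r x y \<Longrightarrow> F x = F y"
  shows "F a = F b"
  using assms(1) by (induction rule: equivclp_induct) (auto dest: assms(2))

lemma compose_cdga_hom:
  assumes "cdg_algebra A" "f \<in> cdga_hom A A'" "g \<in> cdga_hom A' A''"
  shows "compose (carrier A) g f \<in> cdga_hom A A''"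
proof -
  interpret A: cdga A using assms(1) by (simp add: cdga_iff)
  show ?thesis by (intro cdga_hom_compose[OF A.graded_space assms(2,3)]) auto
qed

lemma compose_cdga_equivclp:
  assumes alg: "cdg_algebra A" "cdg_algebra A'" "cdg_algebra A''"
    and hom: "f \<in> cdga_hom A A'" "g' \<in> cdga_hom A' A''"
    and f: "equivclp (cdga_homotopic A A') f f'" and g: "equivclp (cdga_homotopic A' A'') g g'"
  shows "equivclp (cdga_homotopic A A'') (compose (carrier A) g f) (compose (carrier A) g' f')"
proof -
  note P = cdga_pairI[OF alg(1,2)] cdga_pairI[OF alg(2,3)]
  have "cdga_homotopic A A'' (compose (carrier A) u f) (compose (carrier A) v f)" if "cdga_homotopic A' A'' u v" for u v
    using that compose_hpair_right[OF P hom(1)] compose_cdga_hom[OF alg(1) hom(1)]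
    unfolding cdga_homotopic_def by metis
  then have "equivclp (cdga_homotopic A A'') (compose (carrier A) g f) (compose (carrier A) g' f)"
    by (intro equivclp_map[OF g, of _ "\<lambda>u. compose (carrier A) u f"]) blast
  moreover have "cdga_homotopic A A'' (compose (carrier A) g' u) (compose (carrier A) g' v)" if "cdga_homotopic A A' u v" for u v
    using that compose_hpair_left[OF P hom(2)] compose_cdga_hom[OF alg(1) _ hom(2)]
    unfolding cdga_homotopic_def by metis
  then have "equivclp (cdga_homotopic A A'') (compose (carrier A) g' f) (compose (carrier A) g' f')"
    by (intro equivclp_map[OF f, of _ "\<lambda>u. compose (carrier A) g' u"]) blast
  ultimately show ?thesis by (rule equivclp_trans)
qed

lemma cdga_class_eqI:
  "equivclp (cdga_homotopic A A') f g \<Longrightarrow> cdga_class A A' f = cdga_class A A' g"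
  unfolding cdga_class_def using equivclp_trans equivclp_sym by metis

lemma cdga_class_self: "f \<in> cdga_hom A A' \<Longrightarrow> f \<in> cdga_class A A' f"
  by (simp add: cdga_class_def)

lemma Mor_ho_cdgA_D:
  assumes "F \<in> Mor ho_cdgA A A'" "f \<in> F"
  shows "f \<in> cdga_hom A A'" "F = cdga_class A A' f"
proof -
  obtain f0 where F: "F = cdga_class A A' f0" using assms(1) by (auto simp: ho_cdgA_def)
  with assms(2) have f: "f \<in> cdga_hom A A'" "equivclp (cdga_homotopic A A') f0 f"
    by (simp_all add: cdga_class_def)
  show "f \<in> cdga_hom A A'" by (rule f(1))
  show "F = cdga_class A A' f" unfolding F using f(2) by (rule cdga_class_eqI)
qed

lemma Mor_ho_cdgA_E:
  assumes "F \<in> Mor ho_cdgA A A'"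
  obtains f where "f \<in> F" "f \<in> cdga_hom A A'" "F = cdga_class A A' f"
proof -
  obtain f where "f \<in> cdga_hom A A'" "F = cdga_class A A' f" using assms by (auto simp: ho_cdgA_def)
  with cdga_class_self that show ?thesis by metis
qed

lemma Comp_ho_cdgA:
  assumes alg: "cdg_algebra A" "cdg_algebra A'" "cdg_algebra A''"
    and f: "f \<in> cdga_hom A A'" and g: "g \<in> cdga_hom A' A''"
  shows "Comp ho_cdgA A A' A'' (cdga_class A' A'' g) (cdga_class A A' f) = cdga_class A A'' (compose (carrier A) g f)"
proof -
  have "cdga_class A A'' (compose (carrier A) v u) = cdga_class A A'' (compose (carrier A) g f)"
    if u: "u \<in> cdga_class A A' f" and v: "v \<in> cdga_class A' A'' g" for u v
  proof -
    have "equivclp (cdga_homotopic A A'') (compose (carrier A) g f) (compose (carrier A) v u)"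
      using u v by (intro compose_cdga_equivclp[OF alg f]) (auto simp: cdga_class_def)
    then show ?thesis by (rule cdga_class_eqI[symmetric])
  qed
  then have "(\<Union>v\<in>cdga_class A' A'' g. \<Union>u\<in>cdga_class A A' f. cdga_class A A'' (compose (carrier A) v u))
      = cdga_class A A'' (compose (carrier A) g f)"
    by (intro UN_eq_const[OF cdga_class_self[OF g]] UN_eq_const[OF cdga_class_self[OF f]])
  then show ?thesis by (simp add: ho_cdgA_def)
qed

lemma id_map_cdga_hom: "cdg_algebra A \<Longrightarrow> id_map A \<in> cdga_hom A A"
proof -
  assume "cdg_algebra A"
  then interpret A: cdga A by (simp add: cdga_iff)
  show ?thesis
    by (intro cdga_homI HomI linear_id_map A.kspace_axioms) (simp_all add: A.gr_subset)
qed

lemma compose_id_map: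
  assumes "f \<in> linear_maps V W"
  shows "compose (carrier V) f (id_map V) = f" "compose (carrier V) (id_map W) f = f"
  using linear_undefined[OF assms] linear_closed[OF assms] by (auto simp: compose_def fun_eq_iff)

lemma compose_assoc_linear:
  assumes "f \<in> linear_maps U V"
  shows "compose (carrier U) (compose (carrier V) h g) f = compose (carrier U) h (compose (carrier U) g f)"
  using linear_closed[OF assms] by (auto simp: compose_def fun_eq_iff)

lemma category_ho_cdgA: "category (ho_cdgA :: (('k::field, 'a) dgmod, ('a \<Rightarrow> 'a) set) cat)"
proof -
  let ?C = "ho_cdgA :: (('k, 'a) dgmod, ('a \<Rightarrow> 'a) set) cat"
  have obj: "A \<in> Obj ?C \<longleftrightarrow> cdg_algebra A" for A by (simp add: ho_cdgA_def)
  have mor: "f \<in> cdga_hom A A' \<Longrightarrow> cdga_class A A' f \<in> Mor ?C A A'" for f A A' by (simp add: ho_cdgA_def)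
  have ident: "Ident ?C A = cdga_class A A (id_map A)" for A by (simp add: ho_cdgA_def)
  note [simp] = Comp_ho_cdgA compose_cdga_hom id_map_cdga_hom
  show ?thesis
    unfolding category_def ident
  proof (intro conjI ballI)
    fix A :: "('k, 'a) dgmod" assume "A \<in> Obj ?C"
    then show "cdga_class A A (id_map A) \<in> Mor ?C A A" by (intro mor) (simp add: obj)
  next
    fix A A' A'' :: "('k, 'a) dgmod" and F G
    assume "A \<in> Obj ?C" "A' \<in> Obj ?C" "A'' \<in> Obj ?C" "F \<in> Mor ?C A A'" "G \<in> Mor ?C A' A''"
    then show "Comp ?C A A' A'' G F \<in> Mor ?C A A''"
      by (auto simp: obj elim!: Mor_ho_cdgA_E intro!: mor)
  next
    fix A A' :: "('k, 'a) dgmod" and F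
    assume *: "A \<in> Obj ?C" "A' \<in> Obj ?C" "F \<in> Mor ?C A A'"
    from *(3) obtain f where f: "f \<in> cdga_hom A A'" "F = cdga_class A A' f" by (rule Mor_ho_cdgA_E)
    then show "Comp ?C A A A' F (cdga_class A A (id_map A)) = F"
      "Comp ?C A A' A' (cdga_class A' A' (id_map A')) F = F"
      using * f by (simp_all add: obj compose_id_map[OF cdga_hom_linear[OF f(1)]])
  next
    fix A A' A'' A''' :: "('k, 'a) dgmod" and F G H
    assume *: "A \<in> Obj ?C" "A' \<in> Obj ?C" "A'' \<in> Obj ?C" "A''' \<in> Obj ?C"
      "F \<in> Mor ?C A A'" "G \<in> Mor ?C A' A''" "H \<in> Mor ?C A'' A'''"
    obtain f where "f \<in> cdga_hom A A'" "F = cdga_class A A' f" using *(5) by (rule Mor_ho_cdgA_E)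
    moreover obtain g where "g \<in> cdga_hom A' A''" "G = cdga_class A' A'' g" using *(6) by (rule Mor_ho_cdgA_E)
    moreover obtain h where "h \<in> cdga_hom A'' A'''" "H = cdga_class A'' A''' h" using *(7) by (rule Mor_ho_cdgA_E)
    ultimately show "Comp ?C A A' A''' (Comp ?C A' A'' A''' H G) F = Comp ?C A A'' A''' H (Comp ?C A A' A'' G F)"
      using * by (simp add: obj compose_assoc_linear[OF cdga_hom_linear])
  qed
qed

section \<open>The Lie algebra of cocycles\<close>

lemma kspace_image:
  assumes "kspace V" and cl: "carrier W = cl ` carrier V" "\<zero>\<^bsub>W\<^esub> = cl \<zero>\<^bsub>V\<^esub>"
    and add: "\<And>x y. x \<in> carrier V \<Longrightarrow> y \<in> carrier V \<Longrightarrow> cl x \<oplus>\<^bsub>W\<^esub> cl y = cl (x \<oplus>\<^bsub>V\<^esub> y)"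
    and smult: "\<And>c x. x \<in> carrier V \<Longrightarrow> c \<odot>\<^bsub>W\<^esub> cl x = cl (c \<odot>\<^bsub>V\<^esub> x)"
  shows "kspace W"
proof -
  interpret V: kspace V by fact
  show ?thesis
  proof (intro kspace.intro kspace_axioms.intro abelian_groupI)
    fix x assume "x \<in> carrier W"
    then obtain u where "u \<in> carrier V" "x = cl u" using cl by auto
    then show "\<exists>y\<in>carrier W. y \<oplus>\<^bsub>W\<^esub> x = \<zero>\<^bsub>W\<^esub>"
      by (intro bexI[of _ "cl (\<ominus>\<^bsub>V\<^esub> u)"]) (simp_all add: cl add V.l_neg)
  qed (auto simp: cl add smult V.a_ac V.smult_add_left V.smult_add_right V.smult_smult)
qed

text \<open>The Lie axioms are equations, so they pass to a quotient.\<close>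

lemma lie_algebra_image:
  assumes L: "lie_algebra L" and cl: "carrier Q = cl ` carrier L" "\<zero>\<^bsub>Q\<^esub> = cl \<zero>\<^bsub>L\<^esub>"
    and add: "\<And>x y. x \<in> carrier L \<Longrightarrow> y \<in> carrier L \<Longrightarrow> cl x \<oplus>\<^bsub>Q\<^esub> cl y = cl (x \<oplus>\<^bsub>L\<^esub> y)"
    and smult: "\<And>c x. x \<in> carrier L \<Longrightarrow> c \<odot>\<^bsub>Q\<^esub> cl x = cl (c \<odot>\<^bsub>L\<^esub> x)"
    and lbr: "\<And>x y. x \<in> carrier L \<Longrightarrow> y \<in> carrier L \<Longrightarrow> lbr Q (cl x) (cl y) = cl (lbr L x y)"
  shows "lie_algebra Q"
proof -
  have "kspace L" using L by (simp add: lie_algebra_def kspace_iff_module)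
  then interpret kspace L .
  have "kspace Q" by (rule kspace_image[OF kspace_axioms cl add smult])
  then show ?thesis
    using L unfolding lie_algebra_def kspace_iff_module[symmetric] by (simp add: cl add smult lbr)
qed

context hopf_cdga
begin

lemma cbr_madd_right:
  assumes "u \<in> linear_maps B A" "v \<in> linear_maps B A" "w \<in> linear_maps B A"
  shows "cbr n u (madd B A v w) = madd B A (cbr n u v) (cbr n u w)"
proof -
  note lin = linear_madd[OF B.kspace_axioms A.kspace_axioms]
  note vw = lin[OF assms(2,3)]
  note cl = assms[THEN linear_closed]
  show ?thesis
  proof (rule linear_eqI[OF linear_cbr[OF assms(1) vw] lin[OF linear_cbr[OF assms(1,2)] linear_cbr[OF assms(1,3)]] refl])
    fix b assume b: "b \<in> carrier B"
    have "tlift B B A (cform n u (madd B A v w)) (comult B b)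
        = tlift B B A (cform n u v) (comult B b) \<oplus>\<^bsub>A\<^esub> tlift B B A (cform n u w) (comult B b)"
      using b
      by (intro B.AA.tlift_add[OF A.kspace_axioms bilinear_cform[OF assms(1) vw] bilinear_cform[OF assms(1,2)]
            bilinear_cform[OF assms(1,3)]])
        (simp_all add: cform_def madd_def cl a_minus_def A.l_distr A.r_distr A.minus_add A.a_ac)
    then show "cbr n u (madd B A v w) b = madd B A (cbr n u v) (cbr n u w) b"
      using b by (simp add: cbr_apply) (simp add: madd_def cbr_apply)
  qed
qed

lemma cbr_mscale_right:
  assumes "u \<in> linear_maps B A" "v \<in> linear_maps B A"
  shows "cbr n u (mscale B A c v) = mscale B A c (cbr n u v)"
proof -
  note lin = linear_mscale[OF B.kspace_axioms A.kspace_axioms]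
  note cl = assms[THEN linear_closed]
  show ?thesis
  proof (rule linear_eqI[OF linear_cbr[OF assms(1) lin[OF assms(2)]] lin[OF linear_cbr[OF assms]] refl])
    fix b assume b: "b \<in> carrier B"
    have "tlift B B A (cform n u (mscale B A c v)) (comult B b) = c \<odot>\<^bsub>A\<^esub> tlift B B A (cform n u v) (comult B b)"
      using b
      by (intro B.AA.tlift_smult[OF A.kspace_axioms bilinear_cform[OF assms(1) lin[OF assms(2)]] bilinear_cform[OF assms]])
        (simp_all add: cform_def mscale_def cl A.mult_smult A.smult_diff_right)
    then show "cbr n u (mscale B A c v) b = mscale B A c (cbr n u v) b"
      using b by (simp add: cbr_apply) (simp add: mscale_def cbr_apply)
  qed
qed

lemma cbr_antisym:
  assumes "u \<in> linear_maps B A" "v \<in> linear_maps B A"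
  shows "cbr 0 u v = mscale B A (- 1) (cbr 0 v u)"
  unfolding cbr_eq_conv[OF assms] cbr_eq_conv[OF assms(2,1)]
  using linear_closed[OF linear_conv[OF assms]] linear_closed[OF linear_conv[OF assms(2,1)]]
  by (auto simp: msub_def mscale_def fun_eq_iff A.minus_eq_smult[symmetric] a_minus_def A.minus_add A.a_comm)

lemma cbr_self:
  assumes "u \<in> linear_maps B A"
  shows "cbr 0 u u = zmap B A"
  unfolding cbr_eq_conv[OF assms assms] using linear_closed[OF linear_conv[OF assms assms]]
  by (auto simp: msub_def zmap_def fun_eq_iff a_minus_def A.r_neg)

lemma cbr_zmap_right:
  assumes "u \<in> linear_maps B A"
  shows "cbr n u (zmap B A) = zmap B A"
proof -
  have Z: "zmap B A \<in> linear_maps B A" by (rule linear_zmap[OF B.kspace_axioms A.kspace_axioms])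
  have z: "mscale B A 0 f = zmap B A" if "f \<in> linear_maps B A" for f
    using linear_closed[OF that] by (auto simp: mscale_def zmap_def fun_eq_iff)
  show ?thesis
    using cbr_mscale_right[OF assms Z, of n 0] z[OF Z] z[OF linear_cbr[OF assms Z]] by simp
qed

lemma conv_commutator_THom:
  assumes u: "u \<in> THom B A" and v: "v \<in> THom B A"
  shows "conv_commutator B A u v \<in> THom B A"
proof -
  note lin = THom_linear[OF u] THom_linear[OF v]
  have "hom_diff B A 0 v = zmap B A" using v by (simp add: THom_def)
  then have "hom_diff B A 0 (cbr 0 u v) = zmap B A"
    using hom_diff_cbr[OF u eder_Hom[OF THom_eder[OF v]]] cbr_zmap_right[OF lin(1)] by simp
  moreover have "cbr 0 u v \<in> eder B A 0" by (rule cbr_eder[OF THom_eder[OF u] THom_eder[OF v]])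
  ultimately show ?thesis
    unfolding conv_commutator_eq_cbr[OF lin] by (simp add: THom_def eder_iff)
qed

definition cocycle_lie :: "('k, 'b \<Rightarrow> 'a) lie" where
  "cocycle_lie = \<lparr>carrier = THom B A, mult = undefined, one = undefined, zero = zmap B A,
     add = madd B A, smult = mscale B A, lbr = conv_commutator B A\<rparr>"

lemma cocycle_lie_simps [simp]:
  "carrier cocycle_lie = THom B A" "\<zero>\<^bsub>cocycle_lie\<^esub> = zmap B A" "u \<oplus>\<^bsub>cocycle_lie\<^esub> v = madd B A u v"
  "c \<odot>\<^bsub>cocycle_lie\<^esub> u = mscale B A c u" "lbr cocycle_lie u v = conv_commutator B A u v"
  by (simp_all add: cocycle_lie_def)

lemma kspace_cocycle_lie: "kspace cocycle_lie"
proof (intro kspace.intro kspace_axioms.intro abelian_groupI)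
  fix u assume "u \<in> carrier cocycle_lie"
  then have u: "u \<in> THom B A" by simp
  note ext = linear_undefined[OF THom_linear[OF u]] and cl = THom_closed[OF u]
  have "madd B A (mscale B A (- 1) u) u = zmap B A"
    using cl by (auto simp: madd_def mscale_def zmap_def fun_eq_iff A.minus_eq_smult[symmetric] A.l_neg)
  then show "\<exists>y\<in>carrier cocycle_lie. y \<oplus>\<^bsub>cocycle_lie\<^esub> u = \<zero>\<^bsub>cocycle_lie\<^esub>"
    using THom_mscale[OF u] by (intro bexI[of _ "mscale B A (- 1) u"]) simp_all
  show "\<zero>\<^bsub>cocycle_lie\<^esub> \<oplus>\<^bsub>cocycle_lie\<^esub> u = u" "1 \<odot>\<^bsub>cocycle_lie\<^esub> u = u"
    using cl ext by (auto simp: madd_def mscale_def zmap_def fun_eq_iff)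
  show "(c + d) \<odot>\<^bsub>cocycle_lie\<^esub> u = c \<odot>\<^bsub>cocycle_lie\<^esub> u \<oplus>\<^bsub>cocycle_lie\<^esub> d \<odot>\<^bsub>cocycle_lie\<^esub> u"
    "c \<odot>\<^bsub>cocycle_lie\<^esub> (d \<odot>\<^bsub>cocycle_lie\<^esub> u) = (c * d) \<odot>\<^bsub>cocycle_lie\<^esub> u" for c d
    using cl by (auto simp: madd_def mscale_def fun_eq_iff A.smult_add_left A.smult_smult)
next
  fix u v assume "u \<in> carrier cocycle_lie" "v \<in> carrier cocycle_lie"
  then have uv: "u \<in> THom B A" "v \<in> THom B A" by simp_all
  show "u \<oplus>\<^bsub>cocycle_lie\<^esub> v = v \<oplus>\<^bsub>cocycle_lie\<^esub> u"
    "c \<odot>\<^bsub>cocycle_lie\<^esub> (u \<oplus>\<^bsub>cocycle_lie\<^esub> v) = c \<odot>\<^bsub>cocycle_lie\<^esub> u \<oplus>\<^bsub>cocycle_lie\<^esub> c \<odot>\<^bsub>cocycle_lie\<^esub> v" for c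
    using uv[THEN THom_closed] by (auto simp: madd_def mscale_def fun_eq_iff A.smult_add_right A.a_comm)
  fix w assume "w \<in> carrier cocycle_lie"
  then have w: "w \<in> THom B A" by simp
  show "u \<oplus>\<^bsub>cocycle_lie\<^esub> v \<oplus>\<^bsub>cocycle_lie\<^esub> w = u \<oplus>\<^bsub>cocycle_lie\<^esub> (v \<oplus>\<^bsub>cocycle_lie\<^esub> w)"
    using uv[THEN THom_closed] THom_closed[OF w] by (auto simp: madd_def fun_eq_iff A.a_assoc)
qed (simp_all add: THom_madd THom_mscale THom_zmap)

text \<open>By antisymmetry from the second argument.\<close>

lemma cbr_left:
  assumes u: "u \<in> linear_maps B A" and v: "v \<in> linear_maps B A" and w: "w \<in> linear_maps B A"
  shows "cbr 0 (madd B A u v) w = madd B A (cbr 0 u w) (cbr 0 v w)"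
    and "cbr 0 (mscale B A c u) w = mscale B A c (cbr 0 u w)"
proof -
  note add = linear_madd[OF B.kspace_axioms A.kspace_axioms u v]
  note sm = linear_mscale[OF B.kspace_axioms A.kspace_axioms u, of c]
  note cl = linear_closed[OF linear_cbr[OF w u, of 0]] linear_closed[OF linear_cbr[OF w v, of 0]]
  show "cbr 0 (madd B A u v) w = madd B A (cbr 0 u w) (cbr 0 v w)"
    unfolding cbr_antisym[OF add w] cbr_antisym[OF u w] cbr_antisym[OF v w] cbr_madd_right[OF w u v]
    using cl by (auto simp: madd_def mscale_def fun_eq_iff A.smult_add_right)
  show "cbr 0 (mscale B A c u) w = mscale B A c (cbr 0 u w)"
    unfolding cbr_antisym[OF sm w] cbr_antisym[OF u w] cbr_mscale_right[OF w u]
    using cl by (auto simp: mscale_def fun_eq_iff A.smult_smult mult.commute)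
qed

lemma lie_algebra_cocycle_lie: "lie_algebra cocycle_lie"
  unfolding lie_algebra_def kspace_iff_module[symmetric]
proof (intro conjI ballI allI kspace_cocycle_lie)
  note eq = conv_commutator_eq_cbr
  fix u v assume "u \<in> carrier cocycle_lie" "v \<in> carrier cocycle_lie"
  then have uv: "u \<in> THom B A" "v \<in> THom B A" by simp_all
  note lin = uv[THEN THom_linear]
  show "lbr cocycle_lie u v \<in> carrier cocycle_lie" using uv by (simp add: conv_commutator_THom)
  fix c
  show "lbr cocycle_lie (c \<odot>\<^bsub>cocycle_lie\<^esub> u) v = c \<odot>\<^bsub>cocycle_lie\<^esub> lbr cocycle_lie u v"
    "lbr cocycle_lie u (c \<odot>\<^bsub>cocycle_lie\<^esub> v) = c \<odot>\<^bsub>cocycle_lie\<^esub> lbr cocycle_lie u v"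
    using uv by (simp_all add: eq THom_linear THom_mscale cbr_left(2)[OF lin(1) lin(1) lin(2)] cbr_mscale_right[OF lin])
next
  fix u assume "u \<in> carrier cocycle_lie"
  then show "lbr cocycle_lie u u = \<zero>\<^bsub>cocycle_lie\<^esub>"
    by (simp add: conv_commutator_eq_cbr THom_linear cbr_self)
next
  note eq = conv_commutator_eq_cbr
  fix u v w assume "u \<in> carrier cocycle_lie" "v \<in> carrier cocycle_lie" "w \<in> carrier cocycle_lie"
  then have uvw: "u \<in> THom B A" "v \<in> THom B A" "w \<in> THom B A" by simp_all
  note lin = uvw[THEN THom_linear]
  show "lbr cocycle_lie (u \<oplus>\<^bsub>cocycle_lie\<^esub> v) w = lbr cocycle_lie u w \<oplus>\<^bsub>cocycle_lie\<^esub> lbr cocycle_lie v w"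
    "lbr cocycle_lie w (u \<oplus>\<^bsub>cocycle_lie\<^esub> v) = lbr cocycle_lie w u \<oplus>\<^bsub>cocycle_lie\<^esub> lbr cocycle_lie w v"
    using uvw by (simp_all add: eq THom_linear THom_madd cbr_left(1)[OF lin] cbr_madd_right[OF lin(3,1,2)])
  have "conv_commutator B A x (conv_commutator B A y z) = cbr 0 x (cbr 0 y z)"
    if "x \<in> THom B A" "y \<in> THom B A" "z \<in> THom B A" for x y z
    using that by (simp add: eq THom_linear linear_cbr)
  then show "lbr cocycle_lie u (lbr cocycle_lie v w) \<oplus>\<^bsub>cocycle_lie\<^esub> lbr cocycle_lie v (lbr cocycle_lie w u)
      \<oplus>\<^bsub>cocycle_lie\<^esub> lbr cocycle_lie w (lbr cocycle_lie u v) = \<zero>\<^bsub>cocycle_lie\<^esub>"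
    using cbr_jacobi[OF lin] uvw by (simp, simp add: madd_def zmap_def fun_eq_iff)
qed

end

section \<open>The Lie algebra of homotopy types\<close>

text \<open>The operations on classes below are defined through this choice; the congruence lemmas for
  \<open>thom_homotopic\<close> show that they do not depend on it.\<close>

definition class_rep :: "'c set \<Rightarrow> 'c" where
  "class_rep C = (SOME u. u \<in> C)"

definition tangent_lie :: "('k::field, 'b) hopf \<Rightarrow> ('k, 'a) dgmod \<Rightarrow> ('k, ('b \<Rightarrow> 'a) set) lie" where
  "tangent_lie B A = \<lparr>carrier = THom_ho B A, mult = undefined, one = undefined,
     zero = thom_class B A (zmap B A),
     add = (\<lambda>C D. thom_class B A (madd B A (class_rep C) (class_rep D))),
     smult = (\<lambda>c C. thom_class B A (mscale B A c (class_rep C))),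
     lbr = (\<lambda>C D. thom_class B A (conv_commutator B A (class_rep C) (class_rep D)))\<rparr>"

context
  fixes B :: "('k::field_char_0, 'b) hopf" and A :: "('k, 'a) dgmod"
  assumes BA: "hopf_cdga B A"
begin

interpretation hopf_cdga B A by (rule BA)

lemma class_rep_THom:
  assumes u: "u \<in> THom B A"
  shows "class_rep (thom_class B A u) \<in> THom B A" "thom_homotopic B A u (class_rep (thom_class B A u))"
proof -
  have "u \<in> thom_class B A u"
    using thom_class_eq_iff[OF BA u u] u by (simp add: thom_class_def)
  then have "class_rep (thom_class B A u) \<in> thom_class B A u"
    unfolding class_rep_def by (rule someI[where P = "\<lambda>v. v \<in> thom_class B A u"])
  then show "class_rep (thom_class B A u) \<in> THom B A" "thom_homotopic B A u (class_rep (thom_class B A u))"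
    by (simp_all add: thom_class_def)
qed

lemma thom_class_cong:
  "thom_homotopic B A u v \<Longrightarrow> thom_class B A u = thom_class B A v"
  using thom_class_eq_iff[OF BA] by (auto simp: thom_homotopic_def)

lemma thom_homotopicE:
  assumes "thom_homotopic B A u v"
  obtains \<sigma> where "u \<in> THom B A" "v \<in> THom B A" "\<sigma> \<in> eder B A (- 1)" "v = madd B A u (hom_diff B A (- 1) \<sigma>)"
  using assms by (auto simp: thom_homotopic_iff[OF BA])

lemma thom_homotopic_trans:
  assumes "thom_homotopic B A u v" "thom_homotopic B A v w"
  shows "thom_homotopic B A u w"
proof -
  have THom: "u \<in> THom B A" "w \<in> THom B A" using assms by (auto simp: thom_homotopic_def)
  have "thom_class B A u = thom_class B A w"
    using thom_class_cong[OF assms(1)] thom_class_cong[OF assms(2)] by simp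
  then show ?thesis using thom_class_eq_iff[OF BA THom] by simp
qed

lemma thom_homotopic_mscale:
  assumes "thom_homotopic B A u v"
  shows "thom_homotopic B A (mscale B A c u) (mscale B A c v)"
proof -
  obtain \<sigma> where u: "u \<in> THom B A" and v: "v \<in> THom B A" and \<sigma>: "\<sigma> \<in> eder B A (- 1)"
    and eq: "v = madd B A u (hom_diff B A (- 1) \<sigma>)" using assms by (rule thom_homotopicE)
  have "mscale B A c v = madd B A (mscale B A c u) (hom_diff B A (- 1) (mscale B A c \<sigma>))"
    unfolding BA.hom_diff_mscale[OF eder_linear[OF \<sigma>]]
    using THom_closed[OF u] linear_closed[OF BA.linear_hom_diff[OF eder_linear[OF \<sigma>]]]
    by (auto simp: eq madd_def mscale_def fun_eq_iff A.smult_add_right)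
  then show ?thesis by (rule thom_homotopicI[OF BA THom_mscale[OF u] THom_mscale[OF v] eder_mscale[OF \<sigma>]])
qed

lemma thom_homotopic_madd:
  assumes "thom_homotopic B A u v" "thom_homotopic B A u' v'"
  shows "thom_homotopic B A (madd B A u u') (madd B A v v')"
proof -
  obtain \<sigma> where u: "u \<in> THom B A" and v: "v \<in> THom B A" and \<sigma>: "\<sigma> \<in> eder B A (- 1)"
    and eq: "v = madd B A u (hom_diff B A (- 1) \<sigma>)" using assms(1) by (rule thom_homotopicE)
  obtain \<tau> where u': "u' \<in> THom B A" and v': "v' \<in> THom B A" and \<tau>: "\<tau> \<in> eder B A (- 1)"
    and eq': "v' = madd B A u' (hom_diff B A (- 1) \<tau>)" using assms(2) by (rule thom_homotopicE)
  have "madd B A v v' = madd B A (madd B A u u') (hom_diff B A (- 1) (madd B A \<sigma> \<tau>))"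
    unfolding BA.hom_diff_madd[OF eder_linear[OF \<sigma>] eder_linear[OF \<tau>]]
    using THom_closed[OF u] linear_closed[OF BA.linear_hom_diff[OF eder_linear[OF \<sigma>]]]
      THom_closed[OF u'] linear_closed[OF BA.linear_hom_diff[OF eder_linear[OF \<tau>]]]
    by (auto simp: eq eq' madd_def fun_eq_iff A.a_ac)
  then show ?thesis
    by (rule thom_homotopicI[OF BA THom_madd[OF u u'] THom_madd[OF v v'] eder_madd[OF \<sigma> \<tau>]])
qed

lemma thom_homotopic_commutator_right:
  assumes w: "w \<in> THom B A" and "thom_homotopic B A u v"
  shows "thom_homotopic B A (conv_commutator B A w u) (conv_commutator B A w v)"
proof -
  obtain \<sigma> where u: "u \<in> THom B A" and v: "v \<in> THom B A" and \<sigma>: "\<sigma> \<in> eder B A (- 1)"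
    and eq: "v = madd B A u (hom_diff B A (- 1) \<sigma>)" using assms(2) by (rule thom_homotopicE)
  note lin = THom_linear[OF w] THom_linear[OF u] BA.linear_hom_diff[OF eder_linear[OF \<sigma>], of "- 1"]
  have "cbr 0 w v = madd B A (cbr 0 w u) (hom_diff B A (- 1) (cbr (- 1) w \<sigma>))"
    using hom_diff_cbr[OF w eder_Hom[OF \<sigma>]] by (simp add: eq cbr_madd_right[OF lin])
  then have "conv_commutator B A w v = madd B A (conv_commutator B A w u) (hom_diff B A (- 1) (cbr (- 1) w \<sigma>))"
    by (simp add: conv_commutator_eq_cbr lin THom_linear[OF v])
  then show ?thesis
    by (rule thom_homotopicI[OF BA conv_commutator_THom[OF w u] conv_commutator_THom[OF w v]
          cbr_eder[OF THom_eder[OF w] \<sigma>]])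
qed

text \<open>By antisymmetry it suffices to vary the second argument; there \<open>[w, D \<sigma>] = D [w, \<sigma>]\<close>.\<close>

lemma thom_homotopic_commutator:
  assumes uv: "thom_homotopic B A u v" and uv': "thom_homotopic B A u' v'"
  shows "thom_homotopic B A (conv_commutator B A u u') (conv_commutator B A v v')"
proof -
  have THom: "u \<in> THom B A" "v \<in> THom B A" "u' \<in> THom B A" "v' \<in> THom B A"
    using uv uv' by (auto simp: thom_homotopic_def)
  note lin = THom[THEN THom_linear]
  have "thom_homotopic B A (conv_commutator B A u u') (conv_commutator B A v u')"
    using thom_homotopic_mscale[OF thom_homotopic_commutator_right[OF THom(3) uv], of "- 1"]
    by (simp add: conv_commutator_eq_cbr lin cbr_antisym[OF lin(1,3)] cbr_antisym[OF lin(2,3)])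
  moreover have "thom_homotopic B A (conv_commutator B A v u') (conv_commutator B A v v')"
    by (rule thom_homotopic_commutator_right[OF THom(2) uv'])
  ultimately show ?thesis by (rule thom_homotopic_trans)
qed

lemma tangent_lie_simps:
  shows "carrier (tangent_lie B A) = THom_ho B A" "\<zero>\<^bsub>tangent_lie B A\<^esub> = thom_class B A (zmap B A)"
    and "u \<in> THom B A \<Longrightarrow> v \<in> THom B A \<Longrightarrow>
      thom_class B A u \<oplus>\<^bsub>tangent_lie B A\<^esub> thom_class B A v = thom_class B A (madd B A u v)"
    and "u \<in> THom B A \<Longrightarrow> c \<odot>\<^bsub>tangent_lie B A\<^esub> thom_class B A u = thom_class B A (mscale B A c u)"
    and "u \<in> THom B A \<Longrightarrow> v \<in> THom B A \<Longrightarrow>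
      lbr (tangent_lie B A) (thom_class B A u) (thom_class B A v) = thom_class B A (conv_commutator B A u v)"
  by (simp_all add: tangent_lie_def)
    (rule sym, rule thom_class_cong, intro thom_homotopic_madd thom_homotopic_mscale thom_homotopic_commutator
      class_rep_THom(2), assumption+)+

lemma lie_algebra_tangent_lie: "lie_algebra (tangent_lie B A)"
  by (rule lie_algebra_image[OF lie_algebra_cocycle_lie, where cl = "thom_class B A"])
    (simp_all add: tangent_lie_simps THom_ho_def)

end

section \<open>The functor and its naturality in the Hopf algebra\<close>

text \<open>Composition with algebra maps and with Hopf maps are both treated through this criterion, on cocycles.\<close>

lemma tangent_lie_homI:
  fixes B :: "('k::field_char_0, 'b) hopf" and B' :: "('k, 'b) hopf" and A A' :: "('k, 'a) dgmod"
  assumes BA: "hopf_cdga B A" and BA': "hopf_cdga B' A'"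
    and \<phi>: "\<And>u. u \<in> THom B A \<Longrightarrow> \<phi> u \<in> THom B' A'"
    and madd: "\<And>u v. u \<in> THom B A \<Longrightarrow> v \<in> THom B A \<Longrightarrow> \<phi> (madd B A u v) = madd B' A' (\<phi> u) (\<phi> v)"
    and mscale: "\<And>c u. u \<in> THom B A \<Longrightarrow> \<phi> (mscale B A c u) = mscale B' A' c (\<phi> u)"
    and comm: "\<And>u v. u \<in> THom B A \<Longrightarrow> v \<in> THom B A \<Longrightarrow>
      \<phi> (conv_commutator B A u v) = conv_commutator B' A' (\<phi> u) (\<phi> v)"
    and g: "\<And>u. u \<in> THom B A \<Longrightarrow> g (thom_class B A u) = thom_class B' A' (\<phi> u)"
    and ext: "g \<in> extensional (THom_ho B A)"
  shows "g \<in> lie_hom (tangent_lie B A) (tangent_lie B' A')"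
proof -
  interpret BA: hopf_cdga B A by (rule BA)
  interpret BA': hopf_cdga B' A' by (rule BA')
  note simps = tangent_lie_simps[OF BA] tangent_lie_simps[OF BA']
  have "g \<in> linear_maps (tangent_lie B A) (tangent_lie B' A')"
    using ext
    by (intro linear_mapsI)
      (auto simp: simps THom_ho_def g \<phi> madd mscale BA.THom_madd BA.THom_mscale extensional_def)
  then show ?thesis
    by (auto simp: lie_hom_def simps THom_ho_def g \<phi> comm BA.conv_commutator_THom)
qed

definition tangent_functor :: "('k::field, 'b) hopf \<Rightarrow>
    (('k, 'a) dgmod, ('a \<Rightarrow> 'a) set, ('k, ('b \<Rightarrow> 'a) set) lie, ('b \<Rightarrow> 'a) set \<Rightarrow> ('b \<Rightarrow> 'a) set) fctr" where
  "tangent_functor B = \<lparr>omap = tangent_lie B,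
     mmap = (\<lambda>A A' F. \<lambda>C\<in>THom_ho B A. thom_class B A' (compose (carrier B) (class_rep F) (class_rep C)))\<rparr>"

definition tangent_nat :: "('k::field, 'b) hopf \<Rightarrow> ('k, 'b) hopf \<Rightarrow> ('b \<Rightarrow> 'b)
    \<Rightarrow> ('k, 'a) dgmod \<Rightarrow> ('b \<Rightarrow> 'a) set \<Rightarrow> ('b \<Rightarrow> 'a) set" where
  "tangent_nat B B' \<psi> A = (\<lambda>C\<in>THom_ho B' A. thom_class B A (compose (carrier B) (class_rep C) \<psi>))"

lemma tangent_functor_omap [simp]: "omap (tangent_functor B) A = tangent_lie B A"
  by (simp add: tangent_functor_def)

lemma thom_class_mem [intro]: "\<upsilon> \<in> THom B A \<Longrightarrow> thom_class B A \<upsilon> \<in> THom_ho B A"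
  by (simp add: THom_ho_def)

lemma tangent_functor_mmap:
  fixes B :: "('k::field_char_0, 'b) hopf" and A A' :: "('k, 'a) dgmod"
  assumes BA: "hopf_cdga B A" and BA': "hopf_cdga B A'"
    and F: "F \<in> Mor ho_cdgA A A'" and f: "f \<in> F" and \<upsilon>: "\<upsilon> \<in> THom B A"
  shows "mmap (tangent_functor B) A A' F (thom_class B A \<upsilon>) = thom_class B A' (compose (carrier B) f \<upsilon>)"
proof -
  define f' where "f' = class_rep F"
  define \<upsilon>' where "\<upsilon>' = class_rep (thom_class B A \<upsilon>)"
  have f'F: "f' \<in> F" unfolding f'_def class_rep_def using f by (rule someI[where P = "\<lambda>v. v \<in> F"])
  have fh: "f \<in> cdga_hom A A'" by (rule Mor_ho_cdgA_D(1)[OF F f])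
  have \<upsilon>': "\<upsilon>' \<in> THom B A" "thom_homotopic B A \<upsilon> \<upsilon>'"
    unfolding \<upsilon>'_def by (rule class_rep_THom[OF BA \<upsilon>])+
  have "equivclp (cdga_homotopic A A') f f'"
    using f'F unfolding Mor_ho_cdgA_D(2)[OF F f] by (simp add: cdga_class_def)
  then have "thom_class B A' (compose (carrier B) f \<upsilon>') = thom_class B A' (compose (carrier B) f' \<upsilon>')"
    by (rule equivclp_invariant[where F = "\<lambda>h. thom_class B A' (compose (carrier B) h \<upsilon>')"])
      (rule thom_class_cong[OF BA' compose_cdga_homotopic[OF BA BA' _ \<upsilon>'(1)]])
  also have "thom_class B A' (compose (carrier B) f \<upsilon>') = thom_class B A' (compose (carrier B) f \<upsilon>)"
    by (rule thom_class_cong[OF BA' compose_thom_homotopic[OF BA BA' fh \<upsilon>'(2)], symmetric])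
  finally show ?thesis
    using thom_class_mem[OF \<upsilon>] by (simp add: tangent_functor_def f'_def \<upsilon>'_def)
qed

lemma tangent_functor_mmap_lie_hom:
  fixes B :: "('k::field_char_0, 'b) hopf" and A A' :: "('k, 'a) dgmod"
  assumes BA: "hopf_cdga B A" and BA': "hopf_cdga B A'" and F: "F \<in> Mor ho_cdgA A A'"
  shows "mmap (tangent_functor B) A A' F \<in> lie_hom (tangent_lie B A) (tangent_lie B A')"
proof -
  interpret BA: hopf_cdga B A by (rule BA)
  obtain f where f: "f \<in> F" "f \<in> cdga_hom A A'" using F by (rule Mor_ho_cdgA_E)
  note lin = cdga_hom_linear[OF f(2)]
  show ?thesis
  proof (rule tangent_lie_homI[OF BA BA', where \<phi> = "\<lambda>\<upsilon>. compose (carrier B) f \<upsilon>"])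
    fix u v c assume u: "u \<in> THom B A"
    show "compose (carrier B) f u \<in> THom B A'" by (rule compose_THom[OF BA BA' f(2) u])
    show "compose (carrier B) f (mscale B A c u) = mscale B A' c (compose (carrier B) f u)"
      by (auto simp: compose_def mscale_def fun_eq_iff linear_smult[OF lin] BA.THom_closed[OF u])
    show "mmap (tangent_functor B) A A' F (thom_class B A u) = thom_class B A' (compose (carrier B) f u)"
      by (rule tangent_functor_mmap[OF BA BA' F f(1) u])
    assume v: "v \<in> THom B A"
    show "compose (carrier B) f (madd B A u v) = madd B A' (compose (carrier B) f u) (compose (carrier B) f v)"
      by (auto simp: compose_def madd_def fun_eq_iff linear_add[OF lin] BA.THom_closed[OF u] BA.THom_closed[OF v])
    show "compose (carrier B) f (conv_commutator B A u v)
        = conv_commutator B A' (compose (carrier B) f u) (compose (carrier B) f v)"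
      by (rule compose_conv_commutator[OF BA BA' f(2) BA.THom_linear[OF u] BA.THom_linear[OF v]])
  qed (simp add: tangent_functor_def)
qed

lemma category_LieCat: "category (LieCat :: (('k::field, 'l) lie, 'l \<Rightarrow> 'l) cat)"
proof -
  have ks: "kspace L" if "lie_algebra L" for L :: "('k, 'l) lie"
    using that by (simp add: lie_algebra_def kspace_iff_module)
  have lbr: "lbr L x y \<in> carrier L" if "lie_algebra L" "x \<in> carrier L" "y \<in> carrier L" for L :: "('k, 'l) lie" and x y
    using that by (simp add: lie_algebra_def)
  show ?thesis
    unfolding category_def LieCat_def
    by (auto simp: lie_hom_def linear_id_map ks linear_compose compose_id_map compose_assoc_linear
        compose_eq linear_closed lbr)
qed

lemma is_functor_tangent_functor:
  fixes B :: "('k::field_char_0, 'b) hopf"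
  assumes B: "cdg_hopf B"
  shows "is_functor ho_cdgA LieCat
    (tangent_functor B :: (('k, 'a) dgmod, ('a \<Rightarrow> 'a) set, ('k, ('b \<Rightarrow> 'a) set) lie, _) fctr)"
proof -
  let ?T = "tangent_functor B :: (('k, 'a) dgmod, ('a \<Rightarrow> 'a) set, ('k, ('b \<Rightarrow> 'a) set) lie, _) fctr"
  let ?C = "ho_cdgA :: (('k, 'a) dgmod, ('a \<Rightarrow> 'a) set) cat"
  have obj: "A \<in> Obj ?C \<longleftrightarrow> cdg_algebra A" for A by (simp add: ho_cdgA_def)
  have mor: "f \<in> cdga_hom A A' \<Longrightarrow> cdga_class A A' f \<in> Mor ?C A A'" for f A A' by (simp add: ho_cdgA_def)
  have undef: "mmap ?T A A' F C = undefined" if "C \<notin> THom_ho B A" for A A' F C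
    using that by (simp add: tangent_functor_def)
  show ?thesis
    unfolding is_functor_def
  proof (intro conjI ballI category_ho_cdgA category_LieCat)
    fix A assume "A \<in> Obj ?C"
    then have BA: "hopf_cdga B A" and A: "cdg_algebra A" using hopf_cdgaI[OF B] by (auto simp: obj)
    show "omap ?T A \<in> Obj LieCat" by (simp add: LieCat_def lie_algebra_tangent_lie[OF BA])
    show "mmap ?T A A (Ident ?C A) = Ident LieCat (omap ?T A)"
    proof
      fix C
      show "mmap ?T A A (Ident ?C A) C = Ident LieCat (omap ?T A) C"
      proof (cases "C \<in> THom_ho B A")
        case True
        then obtain \<upsilon> where \<upsilon>: "\<upsilon> \<in> THom B A" "C = thom_class B A \<upsilon>" by (auto simp: THom_ho_def)
        have "mmap ?T A A (cdga_class A A (id_map A)) C = thom_class B A (compose (carrier B) (id_map A) \<upsilon>)"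
          unfolding \<upsilon>(2)
          by (rule tangent_functor_mmap[OF BA BA mor cdga_class_self \<upsilon>(1)]) (rule id_map_cdga_hom[OF A])+
        then show ?thesis
          using True \<upsilon> compose_id_map(2)[OF hopf_cdga.THom_linear[OF BA \<upsilon>(1)]]
          by (simp add: ho_cdgA_def LieCat_def id_map_def tangent_lie_simps[OF BA])
      qed (simp add: undef LieCat_def id_map_def tangent_lie_simps[OF BA])
    qed
  next
    fix A A' F assume "A \<in> Obj ?C" "A' \<in> Obj ?C" "F \<in> Mor ?C A A'"
    then show "mmap ?T A A' F \<in> Mor LieCat (omap ?T A) (omap ?T A')"
      using tangent_functor_mmap_lie_hom[OF hopf_cdgaI[OF B, of A] hopf_cdgaI[OF B, of A'], of F]
      by (simp add: obj LieCat_def)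
  next
    fix A A' A'' F G assume "A \<in> Obj ?C" "A' \<in> Obj ?C" "A'' \<in> Obj ?C"
      and F: "F \<in> Mor ?C A A'" and G: "G \<in> Mor ?C A' A''"
    then have alg: "cdg_algebra A" "cdg_algebra A'" "cdg_algebra A''" by (simp_all add: obj)
    note BA = hopf_cdgaI[OF B alg(1)] and BA' = hopf_cdgaI[OF B alg(2)] and BA'' = hopf_cdgaI[OF B alg(3)]
    obtain f where f: "f \<in> F" "f \<in> cdga_hom A A'" "F = cdga_class A A' f" using F by (rule Mor_ho_cdgA_E)
    obtain g where g: "g \<in> G" "g \<in> cdga_hom A' A''" "G = cdga_class A' A'' g" using G by (rule Mor_ho_cdgA_E)
    have gf: "compose (carrier A) g f \<in> cdga_hom A A''" by (rule compose_cdga_hom[OF alg(1) f(2) g(2)])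
    show "mmap ?T A A'' (Comp ?C A A' A'' G F)
      = Comp LieCat (omap ?T A) (omap ?T A') (omap ?T A'') (mmap ?T A' A'' G) (mmap ?T A A' F)"
    proof
      fix C
      show "mmap ?T A A'' (Comp ?C A A' A'' G F) C
        = Comp LieCat (omap ?T A) (omap ?T A') (omap ?T A'') (mmap ?T A' A'' G) (mmap ?T A A' F) C"
      proof (cases "C \<in> THom_ho B A")
        case True
        then obtain \<upsilon> where \<upsilon>: "\<upsilon> \<in> THom B A" "C = thom_class B A \<upsilon>" by (auto simp: THom_ho_def)
        have "mmap ?T A A'' (Comp ?C A A' A'' G F) C = thom_class B A'' (compose (carrier B) (compose (carrier A) g f) \<upsilon>)"
          unfolding \<upsilon>(2) f(3) g(3) Comp_ho_cdgA[OF alg f(2) g(2)]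
          by (rule tangent_functor_mmap[OF BA BA'' mor[OF gf] cdga_class_self[OF gf] \<upsilon>(1)])
        also have "\<dots> = thom_class B A'' (compose (carrier B) g (compose (carrier B) f \<upsilon>))"
          by (simp add: compose_assoc_linear[OF hopf_cdga.THom_linear[OF BA \<upsilon>(1)]])
        also have "\<dots> = mmap ?T A' A'' G (mmap ?T A A' F C)"
          unfolding \<upsilon>(2) tangent_functor_mmap[OF BA BA' F f(1) \<upsilon>(1)]
          by (rule tangent_functor_mmap[OF BA' BA'' G g(1) compose_THom[OF BA BA' f(2) \<upsilon>(1)], symmetric])
        finally show ?thesis using True by (simp add: LieCat_def compose_eq tangent_lie_simps[OF BA])
      qed (simp add: undef LieCat_def compose_def tangent_lie_simps[OF BA])
    qed
  qed
qed

lemma tangent_nat_apply: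
  fixes B :: "('k::field_char_0, 'b) hopf" and A :: "('k, 'a) dgmod"
  assumes BA: "hopf_cdga B A" and B'A: "hopf_cdga B' A" and \<psi>: "\<psi> \<in> cdgh_hom B B'" and \<upsilon>: "\<upsilon> \<in> THom B' A"
  shows "tangent_nat B B' \<psi> A (thom_class B' A \<upsilon>) = thom_class B A (compose (carrier B) \<upsilon> \<psi>)"
proof -
  have "thom_class B A (compose (carrier B) \<upsilon> \<psi>)
      = thom_class B A (compose (carrier B) (class_rep (thom_class B' A \<upsilon>)) \<psi>)"
    by (rule thom_class_cong[OF BA precompose_thom_homotopic[OF BA B'A \<psi> class_rep_THom(2)[OF B'A \<upsilon>]]])
  then show ?thesis using thom_class_mem[OF \<upsilon>] by (simp add: tangent_nat_def)
qed

lemma tangent_nat_lie_hom: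
  fixes B :: "('k::field_char_0, 'b) hopf" and A :: "('k, 'a) dgmod"
  assumes BA: "hopf_cdga B A" and B'A: "hopf_cdga B' A" and \<psi>: "\<psi> \<in> cdgh_hom B B'"
  shows "tangent_nat B B' \<psi> A \<in> lie_hom (tangent_lie B' A) (tangent_lie B A)"
proof -
  interpret B'A: hopf_cdga B' A by (rule B'A)
  note cl = linear_closed[OF cdga_hom_linear[OF cdgh_hom_cdga_hom[OF \<psi>]]]
  show ?thesis
  proof (rule tangent_lie_homI[OF B'A BA, where \<phi> = "\<lambda>\<upsilon>. compose (carrier B) \<upsilon> \<psi>"])
    fix u v c assume u: "u \<in> THom B' A"
    show "compose (carrier B) u \<psi> \<in> THom B A" by (rule precompose_THom[OF BA B'A \<psi> u])
    show "compose (carrier B) (mscale B' A c u) \<psi> = mscale B A c (compose (carrier B) u \<psi>)"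
      by (auto simp: compose_def mscale_def fun_eq_iff cl)
    show "tangent_nat B B' \<psi> A (thom_class B' A u) = thom_class B A (compose (carrier B) u \<psi>)"
      by (rule tangent_nat_apply[OF BA B'A \<psi> u])
    assume v: "v \<in> THom B' A"
    show "compose (carrier B) (madd B' A u v) \<psi> = madd B A (compose (carrier B) u \<psi>) (compose (carrier B) v \<psi>)"
      by (auto simp: compose_def madd_def fun_eq_iff cl)
    show "compose (carrier B) (conv_commutator B' A u v) \<psi>
        = conv_commutator B A (compose (carrier B) u \<psi>) (compose (carrier B) v \<psi>)"
      by (rule precompose_conv_commutator[OF BA B'A \<psi> B'A.THom_linear[OF u] B'A.THom_linear[OF v]])
  qed (simp add: tangent_nat_def)
qed

lemma nat_transformation_tangent_nat:
  fixes B B' :: "('k::field_char_0, 'b) hopf"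
  assumes B: "cdg_hopf B" and B': "cdg_hopf B'" and \<psi>: "\<psi> \<in> cdgh_hom B B'"
  shows "nat_transformation ho_cdgA LieCat (tangent_functor B') (tangent_functor B)
    (tangent_nat B B' \<psi> :: ('k, 'a) dgmod \<Rightarrow> _)"
proof -
  let ?C = "ho_cdgA :: (('k, 'a) dgmod, ('a \<Rightarrow> 'a) set) cat"
  have obj: "A \<in> Obj ?C \<longleftrightarrow> cdg_algebra A" for A by (simp add: ho_cdgA_def)
  show ?thesis
    unfolding nat_transformation_def
  proof (intro conjI ballI is_functor_tangent_functor B B')
    fix A assume "A \<in> Obj ?C"
    then show "tangent_nat B B' \<psi> A \<in> Mor LieCat (omap (tangent_functor B') A) (omap (tangent_functor B) A)"
      using tangent_nat_lie_hom[OF hopf_cdgaI[OF B] hopf_cdgaI[OF B'] \<psi>] by (simp add: obj LieCat_def)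
  next
    fix A A' F assume "A \<in> Obj ?C" "A' \<in> Obj ?C" and F: "F \<in> Mor ?C A A'"
    then have alg: "cdg_algebra A" "cdg_algebra A'" by (simp_all add: obj)
    note BA = hopf_cdgaI[OF B alg(1)] and BA' = hopf_cdgaI[OF B alg(2)]
      and B'A = hopf_cdgaI[OF B' alg(1)] and B'A' = hopf_cdgaI[OF B' alg(2)]
    obtain f where f: "f \<in> F" "f \<in> cdga_hom A A'" using F by (rule Mor_ho_cdgA_E)
    have eq: "tangent_nat B B' \<psi> A' (mmap (tangent_functor B') A A' F C)
        = mmap (tangent_functor B) A A' F (tangent_nat B B' \<psi> A C)" if C: "C \<in> THom_ho B' A" for C
    proof -
      obtain \<upsilon> where \<upsilon>: "\<upsilon> \<in> THom B' A" "C = thom_class B' A \<upsilon>" using C by (auto simp: THom_ho_def)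
      have "tangent_nat B B' \<psi> A' (mmap (tangent_functor B') A A' F C)
          = thom_class B A' (compose (carrier B) (compose (carrier B') f \<upsilon>) \<psi>)"
        by (simp add: \<upsilon>(2) tangent_functor_mmap[OF B'A B'A' F f(1) \<upsilon>(1)]
            tangent_nat_apply[OF BA' B'A' \<psi> compose_THom[OF B'A B'A' f(2) \<upsilon>(1)]])
      also have "\<dots> = thom_class B A' (compose (carrier B) f (compose (carrier B) \<upsilon> \<psi>))"
        by (simp add: compose_assoc_linear[OF cdga_hom_linear[OF cdgh_hom_cdga_hom[OF \<psi>]]])
      also have "\<dots> = mmap (tangent_functor B) A A' F (tangent_nat B B' \<psi> A C)"
        by (simp add: \<upsilon>(2) tangent_nat_apply[OF BA B'A \<psi> \<upsilon>(1)]
            tangent_functor_mmap[OF BA BA' F f(1) precompose_THom[OF BA B'A \<psi> \<upsilon>(1)]])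
      finally show ?thesis .
    qed
    then show "Comp LieCat (omap (tangent_functor B') A) (omap (tangent_functor B') A') (omap (tangent_functor B) A')
        (tangent_nat B B' \<psi> A') (mmap (tangent_functor B') A A' F)
      = Comp LieCat (omap (tangent_functor B') A) (omap (tangent_functor B) A) (omap (tangent_functor B) A')
        (mmap (tangent_functor B) A A' F) (tangent_nat B B' \<psi> A)"
      by (auto simp: LieCat_def compose_def fun_eq_iff tangent_lie_simps[OF B'A])
  qed
qed

lemma id_map_cdgh_hom:
  assumes "cdg_hopf B"
  shows "id_map B \<in> cdgh_hom B B"
proof -
  interpret B: cdg_hopf_algebra B using assms by (simp add: cdg_hopf_algebra_iff)
  note K = B.kspace_axioms
  note id = linear_id_map[OF K]
  have tm: "tmap B B B B 0 (id_map B) (id_map B) t = t" if t: "t \<in> carrier (tspace B B)" for t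
  proof -
    have "tmap B B B B 0 (id_map B) (id_map B) t = id_map (tspace B B) t"
      by (rule B.AA.linear_eq_on_tens[OF B.AA.kspace_tspace B.AA.linear_tmap[OF K K id id]
            linear_id_map[OF B.AA.kspace_tspace] _ t])
        (simp add: B.AA.tmap_tens[OF K K id id] B.AA.tens_closed)
    then show ?thesis using t by simp
  qed
  have "compose (carrier B) (tmap B B B B 0 (id_map B) (id_map B)) (comult B) = comult B"
    using linear_undefined[OF B.comult_linear] by (auto simp: compose_def fun_eq_iff tm)
  then have "coalg_map B B (id_map B)"
    by (simp add: coalg_map_def compose_id_map(1)[OF B.counit_linear] compose_id_map(1)[OF B.comult_linear])
  then show ?thesis using id_map_cdga_hom[OF B.cdg_algebra] by (simp add: cdgh_hom_def)
qed

lemma thom_class_precompose_cong: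
  fixes B :: "('k::field_char_0, 'b) hopf" and A :: "('k, 'a) dgmod"
  assumes BA: "hopf_cdga B A" and B'A: "hopf_cdga B' A"
    and \<psi>: "equivclp (cdgh_homotopic B B') \<psi> \<psi>'" and \<upsilon>: "\<upsilon> \<in> THom B' A"
  shows "thom_class B A (compose (carrier B) \<upsilon> \<psi>) = thom_class B A (compose (carrier B) \<upsilon> \<psi>')"
  using \<psi>
  by (rule equivclp_invariant[where F = "\<lambda>\<psi>. thom_class B A (compose (carrier B) \<upsilon> \<psi>)"])
    (rule thom_class_cong[OF BA precompose_cdgh_homotopic[OF BA B'A _ \<upsilon>]])

text \<open>\<open>(\<upsilon> \<circ> \<phi>) \<circ> \<psi> = \<upsilon> \<circ> (\<phi> \<circ> \<psi>)\<close>, and \<open>\<phi> \<circ> \<psi>\<close> acts on homotopy types as the identity it is homotopic to.\<close>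

lemma tangent_nat_inverse:
  fixes B B' :: "('k::field_char_0, 'b) hopf" and A :: "('k, 'a) dgmod"
  assumes BA: "hopf_cdga B A" and B'A: "hopf_cdga B' A"
    and \<psi>: "\<psi> \<in> cdgh_hom B B'" and \<phi>: "\<phi> \<in> cdgh_hom B' B"
    and inv: "cdgh_class B B (compose (carrier B) \<phi> \<psi>) = cdgh_class B B (id_map B)"
  shows "compose (carrier (tangent_lie B A)) (tangent_nat B B' \<psi> A) (tangent_nat B' B \<phi> A)
    = id_map (tangent_lie B A)"
proof
  fix C
  have "id_map B \<in> cdgh_class B B (compose (carrier B) \<phi> \<psi>)"
    unfolding inv using id_map_cdgh_hom[OF hopf_cdgaD(1)[OF BA]] by (simp add: cdgh_class_def)
  then have hom: "equivclp (cdgh_homotopic B B) (compose (carrier B) \<phi> \<psi>) (id_map B)"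
    by (simp add: cdgh_class_def)
  have "tangent_nat B B' \<psi> A (tangent_nat B' B \<phi> A C) = C" if C: "C \<in> THom_ho B A"
  proof -
    obtain \<upsilon> where \<upsilon>: "\<upsilon> \<in> THom B A" "C = thom_class B A \<upsilon>" using C by (auto simp: THom_ho_def)
    have "tangent_nat B B' \<psi> A (tangent_nat B' B \<phi> A C)
        = thom_class B A (compose (carrier B) (compose (carrier B') \<upsilon> \<phi>) \<psi>)"
      by (simp add: \<upsilon>(2) tangent_nat_apply[OF B'A BA \<phi> \<upsilon>(1)]
          tangent_nat_apply[OF BA B'A \<psi> precompose_THom[OF B'A BA \<phi> \<upsilon>(1)]])
    also have "\<dots> = thom_class B A (compose (carrier B) \<upsilon> (compose (carrier B) \<phi> \<psi>))"
      by (simp add: compose_assoc_linear[OF cdga_hom_linear[OF cdgh_hom_cdga_hom[OF \<psi>]]])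
    also have "\<dots> = thom_class B A (compose (carrier B) \<upsilon> (id_map B))"
      by (rule thom_class_precompose_cong[OF BA BA hom \<upsilon>(1)])
    finally show ?thesis using \<upsilon> by (simp add: compose_id_map(1)[OF hopf_cdga.THom_linear[OF BA \<upsilon>(1)]])
  qed
  then show "compose (carrier (tangent_lie B A)) (tangent_nat B B' \<psi> A) (tangent_nat B' B \<phi> A) C
      = id_map (tangent_lie B A) C"
    by (simp add: compose_def id_map_def tangent_lie_simps[OF BA])
qed

lemma nat_isomorphism_tangent_nat:
  fixes B B' :: "('k::field_char_0, 'b) hopf"
  assumes B: "cdg_hopf B" and B': "cdg_hopf B'" and equiv: "hopf_homotopy_equivalence B B' \<psi>"
  shows "nat_isomorphism ho_cdgA LieCat (tangent_functor B') (tangent_functor B)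
    (tangent_nat B B' \<psi> :: ('k, 'a) dgmod \<Rightarrow> _)"
proof -
  obtain \<phi> where \<psi>: "\<psi> \<in> cdgh_hom B B'" and \<phi>: "\<phi> \<in> cdgh_hom B' B"
    and inv: "cdgh_class B B (compose (carrier B) \<phi> \<psi>) = cdgh_class B B (id_map B)"
      "cdgh_class B' B' (compose (carrier B') \<psi> \<phi>) = cdgh_class B' B' (id_map B')"
    using equiv by (auto simp: hopf_homotopy_equivalence_def)
  show ?thesis
    unfolding nat_isomorphism_def
  proof (intro conjI ballI nat_transformation_tangent_nat B B' \<psi>)
    fix A :: "('k, 'a) dgmod" assume "A \<in> Obj ho_cdgA"
    then have A: "cdg_algebra A" by (simp add: ho_cdgA_def)
    note BA = hopf_cdgaI[OF B A] and B'A = hopf_cdgaI[OF B' A]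
    show "is_iso LieCat (omap (tangent_functor B') A) (omap (tangent_functor B) A) (tangent_nat B B' \<psi> A)"
      unfolding is_iso_def
      using tangent_nat_lie_hom[OF BA B'A \<psi>] tangent_nat_lie_hom[OF B'A BA \<phi>]
        tangent_nat_inverse[OF BA B'A \<psi> \<phi> inv(1)] tangent_nat_inverse[OF B'A BA \<phi> \<psi> inv(2)]
      by (auto simp: LieCat_def)
  qed
qed

theorem theorem3p2:
  "\<exists>TG :: ('k::field_char_0, 'b) hopf \<Rightarrow>
        (('k, 'a) dgmod, ('a \<Rightarrow> 'a) set,
         ('k, ('b \<Rightarrow> 'a) set) lie, ('b \<Rightarrow> 'a) set \<Rightarrow> ('b \<Rightarrow> 'a) set) fctr.
    (\<forall>B. cdg_hopf B \<longrightarrow>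
       is_functor ho_cdgA LieCat (TG B) \<and>
       (\<forall>A. cdg_algebra A \<longrightarrow>
          carrier (omap (TG B) A) = THom_ho B A \<and>
          \<zero>\<^bsub>omap (TG B) A\<^esub> = thom_class B A (zmap B A) \<and>
          (\<forall>\<upsilon>1\<in>THom B A. \<forall>\<upsilon>2\<in>THom B A.
             thom_class B A \<upsilon>1 \<oplus>\<^bsub>omap (TG B) A\<^esub> thom_class B A \<upsilon>2
               = thom_class B A (madd B A \<upsilon>1 \<upsilon>2)) \<and>
          (\<forall>c. \<forall>\<upsilon>\<in>THom B A.
             c \<odot>\<^bsub>omap (TG B) A\<^esub> thom_class B A \<upsilon> = thom_class B A (mscale B A c \<upsilon>)) \<and>
          (\<forall>\<upsilon>1\<in>THom B A. \<forall>\<upsilon>2\<in>THom B A.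
             lbr (omap (TG B) A) (thom_class B A \<upsilon>1) (thom_class B A \<upsilon>2)
               = thom_class B A (conv_commutator B A \<upsilon>1 \<upsilon>2))) \<and>
       (\<forall>A A'. cdg_algebra A \<longrightarrow> cdg_algebra A' \<longrightarrow>
          (\<forall>F\<in>Mor ho_cdgA A A'. \<forall>f\<in>F. \<forall>\<upsilon>\<in>THom B A.
             mmap (TG B) A A' F (thom_class B A \<upsilon>)
               = thom_class B A' (compose (carrier B) f \<upsilon>)))) \<and>
    (\<forall>B B'. cdg_hopf B \<longrightarrow> cdg_hopf B' \<longrightarrow>
       (\<forall>\<Psi>\<in>Mor ho_cdgH B B'.
          \<exists>TN. nat_transformation ho_cdgA LieCat (TG B') (TG B) TN \<and>
            (\<forall>A. cdg_algebra A \<longrightarrow>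
               (\<forall>\<psi>\<in>\<Psi>. \<forall>\<upsilon>'\<in>THom B' A.
                  TN A (thom_class B' A \<upsilon>')
                    = thom_class B A (compose (carrier B) \<upsilon>' \<psi>))) \<and>
            ((\<exists>\<psi>\<in>\<Psi>. hopf_homotopy_equivalence B B' \<psi>) \<longrightarrow>
               nat_isomorphism ho_cdgA LieCat (TG B') (TG B) TN)))"
proof (intro exI[of _ tangent_functor] conjI allI impI)
  fix B :: "('k, 'b) hopf" assume B: "cdg_hopf B"
  show "is_functor ho_cdgA LieCat (tangent_functor B :: (('k, 'a) dgmod, _, _, _) fctr)"
    by (rule is_functor_tangent_functor[OF B])
  fix A :: "('k, 'a) dgmod" assume A: "cdg_algebra A"
  note simps = tangent_lie_simps[OF hopf_cdgaI[OF B A]]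
  show "carrier (omap (tangent_functor B) A) = THom_ho B A"
    "\<zero>\<^bsub>omap (tangent_functor B) A\<^esub> = thom_class B A (zmap B A)"
    "\<forall>\<upsilon>1\<in>THom B A. \<forall>\<upsilon>2\<in>THom B A.
      thom_class B A \<upsilon>1 \<oplus>\<^bsub>omap (tangent_functor B) A\<^esub> thom_class B A \<upsilon>2 = thom_class B A (madd B A \<upsilon>1 \<upsilon>2)"
    "\<forall>\<upsilon>\<in>THom B A. c \<odot>\<^bsub>omap (tangent_functor B) A\<^esub> thom_class B A \<upsilon> = thom_class B A (mscale B A c \<upsilon>)"
    "\<forall>\<upsilon>1\<in>THom B A. \<forall>\<upsilon>2\<in>THom B A.
      lbr (omap (tangent_functor B) A) (thom_class B A \<upsilon>1) (thom_class B A \<upsilon>2)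
        = thom_class B A (conv_commutator B A \<upsilon>1 \<upsilon>2)" for c
    by (simp_all add: simps)
next
  fix B :: "('k, 'b) hopf" and A A' :: "('k, 'a) dgmod"
  assume B: "cdg_hopf B" and A: "cdg_algebra A" and A': "cdg_algebra A'"
  then show "\<forall>F\<in>Mor ho_cdgA A A'. \<forall>f\<in>F. \<forall>\<upsilon>\<in>THom B A.
      mmap (tangent_functor B) A A' F (thom_class B A \<upsilon>) = thom_class B A' (compose (carrier B) f \<upsilon>)"
    using tangent_functor_mmap[OF hopf_cdgaI[OF B A] hopf_cdgaI[OF B A']] by blast
next
  fix B B' :: "('k, 'b) hopf" assume B: "cdg_hopf B" and B': "cdg_hopf B'"
  show "\<forall>\<Psi>\<in>Mor ho_cdgH B B'. \<exists>TN. nat_transformation ho_cdgA LieCat (tangent_functor B') (tangent_functor B) TN \<and>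
      (\<forall>A :: ('k, 'a) dgmod. cdg_algebra A \<longrightarrow> (\<forall>\<psi>\<in>\<Psi>. \<forall>\<upsilon>'\<in>THom B' A.
        TN A (thom_class B' A \<upsilon>') = thom_class B A (compose (carrier B) \<upsilon>' \<psi>))) \<and>
      ((\<exists>\<psi>\<in>\<Psi>. hopf_homotopy_equivalence B B' \<psi>) \<longrightarrow>
        nat_isomorphism ho_cdgA LieCat (tangent_functor B') (tangent_functor B) TN)"
  proof
    fix \<Psi> assume \<Psi>: "\<Psi> \<in> Mor ho_cdgH B B'"
    then obtain \<psi>0 where \<psi>0: "\<psi>0 \<in> cdgh_hom B B'" "\<Psi> = cdgh_class B B' \<psi>0"
      by (auto simp: ho_cdgH_def)
    have rep_apply: "tangent_nat B B' \<psi>0 A (thom_class B' A \<upsilon>) = thom_class B A (compose (carrier B) \<upsilon> \<psi>)"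
      if "cdg_algebra A" "\<psi> \<in> \<Psi>" "\<upsilon> \<in> THom B' A" for A :: "('k, 'a) dgmod" and \<psi> \<upsilon>
      using tangent_nat_apply[OF hopf_cdgaI[OF B that(1)] hopf_cdgaI[OF B' that(1)] \<psi>0(1) that(3)]
        thom_class_precompose_cong[OF hopf_cdgaI[OF B that(1)] hopf_cdgaI[OF B' that(1)] _ that(3), of \<psi>0 \<psi>] that(2)
      by (simp add: \<psi>0(2) cdgh_class_def)
    \<comment> \<open>The representative enters only through its class, so an equivalence may replace \<open>\<psi>0\<close>.\<close>
    have "nat_isomorphism ho_cdgA LieCat (tangent_functor B') (tangent_functor B)
        (tangent_nat B B' \<psi>0 :: ('k, 'a) dgmod \<Rightarrow> _)"
      if \<psi>: "\<psi> \<in> \<Psi>" "hopf_homotopy_equivalence B B' \<psi>" for \<psi>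
    proof -
      have hom: "\<psi> \<in> cdgh_hom B B'" using \<psi>(1) by (simp add: \<psi>0(2) cdgh_class_def)
      have "tangent_nat B B' \<psi>0 A = tangent_nat B B' \<psi> A" if A: "cdg_algebra A" for A :: "('k, 'a) dgmod"
      proof
        fix C
        show "tangent_nat B B' \<psi>0 A C = tangent_nat B B' \<psi> A C"
        proof (cases "C \<in> THom_ho B' A")
          case True
          then show ?thesis
            using rep_apply[OF A \<psi>(1)] tangent_nat_apply[OF hopf_cdgaI[OF B A] hopf_cdgaI[OF B' A] hom]
            by (auto simp: THom_ho_def)
        qed (simp add: tangent_nat_def)
      qed
      then show ?thesis
        using nat_isomorphism_tangent_nat[OF B B' \<psi>(2), where ?'a = 'a] nat_transformation_tangent_nat[OF B B' \<psi>0(1), where ?'a = 'a]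
        unfolding nat_isomorphism_def by (auto simp: ho_cdgA_def)
    qed
    then show "\<exists>TN. nat_transformation ho_cdgA LieCat (tangent_functor B') (tangent_functor B) TN \<and>
      (\<forall>A :: ('k, 'a) dgmod. cdg_algebra A \<longrightarrow> (\<forall>\<psi>\<in>\<Psi>. \<forall>\<upsilon>'\<in>THom B' A.
        TN A (thom_class B' A \<upsilon>') = thom_class B A (compose (carrier B) \<upsilon>' \<psi>))) \<and>
      ((\<exists>\<psi>\<in>\<Psi>. hopf_homotopy_equivalence B B' \<psi>) \<longrightarrow>
        nat_isomorphism ho_cdgA LieCat (tangent_functor B') (tangent_functor B) TN)"
      using rep_apply nat_transformation_tangent_nat[OF B B' \<psi>0(1)]
      by (intro exI[of _ "tangent_nat B B' \<psi>0"]) blast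
  qed
qed

end
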